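(* Let $p$ be a power of $2$, let $q$ be a power of $p$, let $R(x)=\sum_{i=0}^e a_ix^{p^i}\in\mathbb{F}_q[x]$ with $e\ge1$, $a_e\ne0$, and let $A\subset H_R$ be a maximal abelian subgroup. Let $t\in\mathbb{F}_q$ be such that $\mathrm{Tr}_{\mathbb{F}_q/\mathbb{F}_2}(t)=1$. Assume that $A\subset\mathbb{F}_q^2$ and that $\overline{C}_R$ is $\mathbb{F}_{q^2}$-minimal. Write $F_A(x)=\sum_{i=0}^eb_ix^{p^i}$ for the polynomial $F_A$ of the context, and put $F^*(t)=\sum_{i=0}^e(b_it)^{p^{-i}}$ and $R_t(x)=R(x)+F^*(t)^2x$. Then $\overline{C}_{R_t}$ is $\mathbb{F}_{q^2}$-maximal.
   Context: $\mathbb{F}$ is an algebraic closure of $\mathbb{F}_q$; finite fields are viewed inside $\mathbb{F}$; for $u\in\mathbb{F}$, $u^{p^{-i}}$ is the unique $p^i$-th root. $\mathscr{A}$ is the set of $\mathbb{F}_p$-linearized polynomials $\sum_i c_ix^{p^i}\in\mathbb{F}_q[x]$; $\mathrm{Ker}\,g=\{x\in\mathbb{F}: g(x)=0\}$ for $g\in\mathscr{A}$. For $R\in\mathscr{A}$ of degree $p^e$, $e\ge1$, $C_R$ is the affine curve $y^p-y=xR(x)$ over $\mathbb{F}_q$ and $\overline{C}_R$ its smooth compactification. For $R=\sum_{i=0}^ea_ix^{p^i}$ put $E_R(x)=R(x)^{p^e}+\sum_{i=0}^e(a_ix)^{p^{e-i}}$, $f_R(x,y)=-\sum_{i=0}^{e-1}\bigl(\sum_{j=0}^{e-i-1}(a_ix^{p^i}y)^{p^j}+(xR(y))^{p^i}\bigr)$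 and $V_R=\mathrm{Ker}\,E_R$. $H_R=\{(a,b)\in V_R\times\mathbb{F}: b^p-b=aR(a)\}$ is a group under $(a,b)\cdot(a',b')=(a+a',b+b'+f_R(a,a'))$. Let $\pi:H_R\to V_R$, $(a,b)\mapsto a$. Put $\overline{A}=\pi(A)$ and $\overline{U}=\{a\in\overline{A}: f_R(a,a)=0\}$; these are $\mathbb{F}_p$-subspaces of $\mathbb{F}_q$ of dimensions $e$ and $e-1$. Fix (such data exist) a separable $f_{\overline{U}}\in\mathscr{A}$ such that $\overline{U}=\mathrm{Ker}\,f_{\overline{U}}$, $\overline{A}=\mathrm{Ker}(f_{\overline{U}}^p+f_{\overline{U}})$, and such that there exist $S(x)=x^p+s_0x\in\mathscr{A}$ and $\Delta\in\mathbb{F}_q[x]$ with $\Delta(x)^p+\Delta(x)=xR(x)+f_{\overline{U}}(x)S(f_{\overline{U}}(x))$. Put $F_A=f_{\overline{U}}^p+f_{\overline{U}}$. A smooth projective geometrically connected curve $C$ of genus $g$ (over $\mathbb{F}_q$, considered over $\mathbb{F}_{q^2}$) is $\mathbb{F}_{q^2}$-maximal if $|C(\mathbb{F}_{q^2})|=q^2+1+2gq$ and $\mathbb{F}_{q^2}$-minimal if $|C(\mathbb{F}_{q^2})|=q^2+1-2gq$. *)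

theory Defs
  imports "HOL-Algebra.Algebraic_Closure_Type" "HOL-Algebra.Generated_Fields"
begin

section \<open>Finite fields inside an algebraic closure\<close>

text \<open>
  The ambient field \<open>\<bbbF>\<close> is a type \<open>'a :: alg_closed_field\<close>.  If its characteristic divides the
  prime power \<open>q\<close>, then \<open>GF q\<close> is the unique subfield with \<open>q\<close> elements.
\<close>

definition GF :: "nat \<Rightarrow> 'a::field set" where
  "GF q = {u. u ^ q = u}"

definition poly_over :: "'a::field set \<Rightarrow> 'a poly set" where
  "poly_over K = {g. \<forall>n. coeff g n \<in> K}"

definition algebraic_over :: "'a::field set \<Rightarrow> 'a \<Rightarrow> bool" where
  "algebraic_over K u \<longleftrightarrow> (\<exists>g \<in> poly_over K. g \<noteq> 0 \<and> poly g u = 0)"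

text \<open>The trace from the field with \<open>s ^ n\<close> elements to the field with \<open>s\<close> elements.\<close>

definition gf_trace :: "nat \<Rightarrow> nat \<Rightarrow> 'a::field \<Rightarrow> 'a" where
  "gf_trace s n t = (\<Sum>i<n. t ^ (s ^ i))"

text \<open>\<open>u\<close> to the power \<open>p\<^sup>-\<^sup>i\<close>; well defined when \<open>p\<close> is a power of the characteristic.\<close>

definition frob_root :: "nat \<Rightarrow> nat \<Rightarrow> 'a::field \<Rightarrow> 'a" where
  "frob_root p i u = (THE v. v ^ (p ^ i) = u)"


section \<open>Linearized polynomials and the group attached to one of them\<close>

definition lin_polys :: "nat \<Rightarrow> nat \<Rightarrow> 'a::field poly set" where
  "lin_polys p q = {g \<in> poly_over (GF q). \<forall>n. coeff g n \<noteq> 0 \<longrightarrow> (\<exists>i. n = p ^ i)}"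

definition Ker :: "'a::field poly \<Rightarrow> 'a set" where
  "Ker g = {x. poly g x = 0}"

text \<open>
  In the following definitions \<open>R\<close> is a linearized polynomial of degree \<open>p ^ e\<close>; its coefficient
  \<open>a\<^sub>i\<close> is \<open>coeff R (p ^ i)\<close>.
\<close>

definition E_poly :: "nat \<Rightarrow> nat \<Rightarrow> 'a::field poly \<Rightarrow> 'a poly" where
  "E_poly p e R = R ^ (p ^ e) + (\<Sum>i\<le>e. [:0, coeff R (p ^ i):] ^ (p ^ (e - i)))"

definition f_form :: "nat \<Rightarrow> nat \<Rightarrow> 'a::field poly \<Rightarrow> 'a \<Rightarrow> 'a \<Rightarrow> 'a" where
  "f_form p e R x y =
     - (\<Sum>i<e. (\<Sum>j<e - i. (coeff R (p ^ i) * x ^ (p ^ i) * y) ^ (p ^ j))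
               + (x * poly R y) ^ (p ^ i))"

definition H_group :: "nat \<Rightarrow> nat \<Rightarrow> 'a::field poly \<Rightarrow> ('a \<times> 'a) monoid" where
  "H_group p e R =
     \<lparr>carrier = {(a, b). a \<in> Ker (E_poly p e R) \<and> b ^ p - b = a * poly R a},
      monoid.mult = (\<lambda>(a, b) (a', b'). (a + a', b + b' + f_form p e R a a')),
      one = (0, 0)\<rparr>"

definition maximal_abelian_subgroup :: "('g, 'm) monoid_scheme \<Rightarrow> 'g set \<Rightarrow> bool" where
  "maximal_abelian_subgroup G A \<longleftrightarrow>
     subgroup A G \<and> comm_group (G\<lparr>carrier := A\<rparr>) \<and>
     (\<forall>B. subgroup B G \<and> comm_group (G\<lparr>carrier := B\<rparr>) \<and> A \<subseteq> B \<longrightarrow> B = A)"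

definition Abar :: "('a \<times> 'a) set \<Rightarrow> 'a set" where
  "Abar A = fst ` A"

definition Ubar :: "nat \<Rightarrow> nat \<Rightarrow> 'a::field poly \<Rightarrow> ('a \<times> 'a) set \<Rightarrow> 'a set" where
  "Ubar p e R A = {a \<in> Abar A. f_form p e R a a = 0}"

text \<open>\<open>F\<^sup>*(t)\<close> for a linearized polynomial \<open>F\<close> of degree at most \<open>p ^ e\<close>.\<close>

definition F_star :: "nat \<Rightarrow> nat \<Rightarrow> 'a::field poly \<Rightarrow> 'a \<Rightarrow> 'a" where
  "F_star p e F t = (\<Sum>i\<le>e. frob_root p i (coeff F (p ^ i) * t))"


section \<open>Places, divisors and genus of a function field\<close>

text \<open>
  A smooth projective geometrically connected curve over a field \<open>k\<close> is represented by its function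
  field \<open>L\<close>.  Its closed points are the places of \<open>L\<close> over \<open>k\<close>, represented by their valuation
  rings (the local rings of the curve).  Both \<open>k\<close> and \<open>L\<close> are subfields of an ambient field type.
\<close>

definition places :: "'b::field set \<Rightarrow> 'b set \<Rightarrow> 'b set set" where
  "places k L = {V. subring V ring_of_type_algebra \<and> k \<subseteq> V \<and> V \<subset> L \<and>
                    (\<forall>z\<in>L. z \<in> V \<or> inverse z \<in> V)}"

definition max_ideal :: "'b::field set \<Rightarrow> 'b set" where
  "max_ideal V = {z \<in> V. z = 0 \<or> inverse z \<notin> V}"

text \<open>A \<open>k\<close>-rational point is a place whose residue field is \<open>k\<close>.\<close>

definition rational_places :: "'b::field set \<Rightarrow> 'b set \<Rightarrow> 'b set set" where
  "rational_places k L = {V \<in> places k L. \<forall>z\<in>V. \<exists>c\<in>k. z - c \<in> max_ideal V}"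

text \<open>The normalized discrete valuation of a place, for \<open>z \<noteq> 0\<close> in the function field.\<close>

definition place_val :: "'b::field set \<Rightarrow> 'b \<Rightarrow> int" where
  "place_val V z = (THE n. \<exists>t u. max_ideal V = (\<lambda>x. t * x) ` V \<and> u \<in> V - max_ideal V \<and>
                                 z = t powi n * u)"

definition divisors :: "'b::field set \<Rightarrow> 'b set \<Rightarrow> ('b set \<Rightarrow> int) set" where
  "divisors k L = {D. finite {V. D V \<noteq> 0} \<and> {V. D V \<noteq> 0} \<subseteq> places k L}"

text \<open>
  The degree of a divisor over an algebraically closed field of constants, where every place
  has degree one.
\<close>

definition div_degree :: "('b set \<Rightarrow> int) \<Rightarrow> int" where
  "div_degree D = (\<Sum>V | D V \<noteq> 0. D V)"

definition RR_space :: "'b::field set \<Rightarrow> 'b set \<Rightarrow> ('b set \<Rightarrow> int) \<Rightarrow> 'b set" where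
  "RR_space k L D = {z \<in> L. z = 0 \<or> (\<forall>V \<in> places k L. place_val V z \<ge> - D V)}"

text \<open>
  The ambient field for function fields of plane curves over \<open>'a\<close>: an algebraic closure of the
  rational function field \<open>'a(x)\<close>.
\<close>

type_synonym 'a ffield = "'a poly fract alg_closure"

definition of_poly :: "'a::field poly \<Rightarrow> 'a ffield" where
  "of_poly f = to_ac (to_fract f)"

definition const :: "'a::field \<Rightarrow> 'a ffield" where
  "const c = of_poly [:c:]"

definition RR_dim :: "'a::alg_closed_field ffield set \<Rightarrow> ('a ffield set \<Rightarrow> int) \<Rightarrow> nat" where
  "RR_dim L D = vector_space.dim (\<lambda>c z. const c * z) (RR_space (range const) L D)"

text \<open>
  The genus of a function field with algebraically closed field of constants \<open>'a\<close>:
  the maximum of \<open>deg D - \<ell>(D) + 1\<close> over all divisors, as in Riemann's theorem.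
\<close>

definition genus :: "'a::alg_closed_field ffield set \<Rightarrow> int" where
  "genus L = (SUP D \<in> divisors (range const) L. div_degree D - int (RR_dim L D) + 1)"


section \<open>The smooth compactification of \<open>y ^ p - y = f(x)\<close>\<close>

definition AS_root :: "nat \<Rightarrow> 'a::field poly \<Rightarrow> 'a ffield" where
  "AS_root p f = (SOME y. y ^ p - y = of_poly f)"

lemma AS_root:
  assumes "p \<ge> 2"
  shows "AS_root p f ^ p - AS_root p f = of_poly f"
proof -
  let ?g = "monom 1 p + [:- of_poly f, -1:] :: 'a ffield poly"
  have "degree [:- of_poly f, -1:] < degree (monom (1 :: 'a ffield) p)"
    using assms by (simp add: degree_monom_eq)
  hence "degree ?g > 0"
    using degree_add_eq_left by fastforce
  then obtain y where "poly ?g y = 0"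
    using alg_closed_imp_poly_has_root by blast
  hence "y ^ p - y = of_poly f"
    by (simp add: poly_monom algebra_simps)
  thus ?thesis
    unfolding AS_root_def by (rule someI)
qed

text \<open>
  The function field \<open>k(x, y)\<close> with \<open>y ^ p - y = f(x)\<close>, for a subfield \<open>k\<close> of \<open>'a\<close> containing
  the coefficients of \<open>f\<close>.  The polynomial \<open>y ^ p - y - f(x)\<close> is irreducible over \<open>'a(x)\<close> when
  \<open>p\<close> is a power of the characteristic and the degree of \<open>f\<close> is prime to \<open>p\<close>; then up to
  isomorphism the field does not depend on the chosen root, and its field of constants is \<open>k\<close>.
\<close>

definition AS_field :: "nat \<Rightarrow> 'a::field set \<Rightarrow> 'a poly \<Rightarrow> 'a ffield set" where
  "AS_field p k f =
     generate_field ring_of_type_algebra (const ` k \<union> {of_poly [:0, 1:], AS_root p f})"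

definition AS_points :: "nat \<Rightarrow> 'a::field set \<Rightarrow> 'a poly \<Rightarrow> 'a ffield set set" where
  "AS_points p k f = rational_places (const ` k) (AS_field p k f)"

text \<open>
  The genus of a geometrically connected curve does not change under extension of the base field,
  so it is taken over the algebraically closed field \<open>'a\<close>.
\<close>

definition AS_genus :: "nat \<Rightarrow> 'a::alg_closed_field poly \<Rightarrow> int" where
  "AS_genus p f = genus (AS_field p UNIV f)"

text \<open>
  Maximality and minimality over the field with \<open>q\<^sup>2\<close> elements of the smooth compactification of
  \<open>y ^ p - y = x * R(x)\<close>; note that \<open>pCons 0 R\<close> is the polynomial \<open>x * R(x)\<close>.
\<close>

definition C_maximal :: "nat \<Rightarrow> nat \<Rightarrow> 'a::alg_closed_field poly \<Rightarrow> bool" where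
  "C_maximal p q R \<longleftrightarrow>
     int (card (AS_points p (GF (q ^ 2)) (pCons 0 R))) =
       int q ^ 2 + 1 + 2 * AS_genus p (pCons 0 R) * int q"

definition C_minimal :: "nat \<Rightarrow> nat \<Rightarrow> 'a::alg_closed_field poly \<Rightarrow> bool" where
  "C_minimal p q R \<longleftrightarrow>
     int (card (AS_points p (GF (q ^ 2)) (pCons 0 R))) =
       int q ^ 2 + 1 - 2 * AS_genus p (pCons 0 R) * int q"

end

theory Submission
  imports Defs
begin

text \<open>
  The curve \<open>y\<^sup>p - y = f(x)\<close> with \<open>deg f = p m + 1\<close> has one place at infinity, where \<open>x\<^sup>m / y\<close> is a
  local parameter, and its other rational places are the affine points. The functions regular away
  from infinity are the polynomials in \<open>x\<close> and \<open>y\<close>, so the gaps of the semigroup generated by \<open>p\<close>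
  and \<open>p m + 1\<close> give the genus \<open>p m (p - 1) / 2\<close>. Maximality and minimality thus become statements
  about the number of zeros of the quadratic form \<open>Tr(x R(x))\<close> on the field with \<open>q\<^sup>2\<close> elements.

  Put \<open>u = f\<^sub>U(x)\<close>. Up to terms of trace zero, \<open>x R(x)\<close> is \<open>u\<^sup>p\<^sup>+\<^sup>1 + s\<^sub>0 u\<^sup>2\<close>, and passing to \<open>R\<^sub>t\<close> adds
  the square of \<open>Tr(t (u\<^sup>p + u))\<close>. The space of all \<open>x\<close> with \<open>u\<close> in \<open>F\<^sub>q\<close> is totally singular for both
  forms, and modulo it they reduce to forms in \<open>w = u\<^sup>q + u\<close>, where \<open>w\<close> ranges over elements fixed by
  the square of the \<open>p\<close>-Frobenius map. Minimality forces the first reduced form to be an anisotropic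
  plane. The reduced forms differ by the square of \<open>Tr(t) (w\<^sup>p + w)\<close>, and since the absolute trace of
  \<open>t\<close> is 1 this changes the Arf invariant: the second form is a hyperbolic plane, whose number of
  zeros is that of a maximal curve.
\<close>

section \<open>Valuation rings of a field\<close>

text \<open>Points are valuation rings and the genus is a supremum over all divisors, so the point
  count and the genus formula are derived from these definitions: a maximality argument supplies the
  place at infinity, and every divisor is compared with an explicit one. For the forms, the
  rationality of \<open>A\<close> enters twice: it puts the kernel of \<open>u\<close> into
  \<open>GF q\<close>, and it gives \<open>Tq (1 + s0) = 0\<close> as soon as \<open>u\<close> takes
  the value 1 on \<open>GF q\<close>. The condition on \<open>t\<close> enters through a root
  \<open>\<omega>\<close> of \<open>w^2 + w = t\<close>. It satisfies
  \<open>\<omega> ^ q = \<omega> + 1\<close>, so multiplication by \<open>\<omega>\<close> is a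
  section of the relative trace, and the trace of \<open>\<omega>\<close> to F_p shifts the root
  that decides the Arf invariant. Minimality is rigid because averaging over translations turns it
  into \<open>P * (|Y| - p * |zeros 0|) = (p - 1) * p ^ e\<close>, where \<open>P\<close> is the
  number of zeros of \<open>u\<close> and \<open>Y\<close> is an F_p-subspace of the field with
  \<open>p^2\<close> elements. Positivity leaves only \<open>|Y| = p^2\<close> and
  \<open>zeros 0 = {0}\<close>, and then \<open>p * P = p ^ e\<close>, which also fixes the degree
  of \<open>fU\<close>.\<close>

locale subring_set =
  fixes S :: "'b::comm_ring_1 set"
  assumes one_mem: "1 \<in> S"
    and diff_mem: "a \<in> S \<Longrightarrow> b \<in> S \<Longrightarrow> a - b \<in> S"
    and mult_mem: "a \<in> S \<Longrightarrow> b \<in> S \<Longrightarrow> a * b \<in> S"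
begin

lemma zero_mem: "0 \<in> S"
  using diff_mem[OF one_mem one_mem] by simp

lemma uminus_mem: "a \<in> S \<Longrightarrow> - a \<in> S"
  using diff_mem[OF zero_mem] by fastforce

lemma add_mem: "a \<in> S \<Longrightarrow> b \<in> S \<Longrightarrow> a + b \<in> S"
  using diff_mem[OF _ uminus_mem] by fastforce

lemma power_mem: "a \<in> S \<Longrightarrow> a ^ n \<in> S"
  by (induction n) (auto intro: one_mem mult_mem)

lemma sum_mem: "(\<And>i. i \<in> I \<Longrightarrow> h i \<in> S) \<Longrightarrow> sum h I \<in> S"
  by (induction I rule: infinite_finite_induct) (auto intro: zero_mem add_mem)

lemma prod_mem: "(\<And>i. i \<in> I \<Longrightarrow> h i \<in> S) \<Longrightarrow> prod h I \<in> S"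
  by (induction I rule: infinite_finite_induct) (auto intro: one_mem mult_mem)

lemmas mems = zero_mem one_mem uminus_mem add_mem diff_mem mult_mem power_mem sum_mem prod_mem

end

text \<open>Bridge from the record-based algebra in the definition of \<open>places\<close> to plain
  arithmetic in the field type.\<close>

lemma subring_ring_of_type_algebra_iff:
  "subring V (ring_of_type_algebra :: 'b::comm_ring_1 ring) \<longleftrightarrow> subring_set V"
proof -
  interpret R: ring "ring_of_type_algebra :: 'b ring" ..
  have neg: "\<ominus>\<^bsub>ring_of_type_algebra\<^esub> h = - h" for h :: 'b
    by (rule R.minus_equality) (auto simp: ring_of_type_algebra_def)
  show ?thesis
  proof
    assume V: "subring V (ring_of_type_algebra :: 'b ring)"
    show "subring_set V"
    proof
      show "1 \<in> V" using subringE(3)[OF V] by (simp add: ring_of_type_algebra_def)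
      fix a b assume ab: "a \<in> V" "b \<in> V"
      show "a * b \<in> V" using subringE(6)[OF V ab] by (simp add: ring_of_type_algebra_def)
      have "- b \<in> V" using subringE(5)[OF V ab(2)] by (simp only: neg)
      from subringE(7)[OF V ab(1) this] show "a - b \<in> V" by (simp add: ring_of_type_algebra_def)
    qed
  next
    assume "subring_set V"
    then interpret subring_set V .
    show "subring V (ring_of_type_algebra :: 'b ring)"
    proof (rule R.subringI)
      show "\<ominus>\<^bsub>ring_of_type_algebra\<^esub> h \<in> V" if "h \<in> V" for h
        using that by (simp only: neg uminus_mem)
    qed (auto simp: ring_of_type_algebra_def intro: mems)
  qed
qed

locale subfield_set = subring_set S for S :: "'b::field set" +
  assumes inverse_mem: "a \<in> S \<Longrightarrow> inverse a \<in> S"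
begin

lemma divide_mem: "a \<in> S \<Longrightarrow> b \<in> S \<Longrightarrow> a / b \<in> S"
  unfolding divide_inverse by (intro mult_mem inverse_mem)

end

lemma subfield_generate_field:
  "subfield_set (generate_field (ring_of_type_algebra :: 'b::field ring) H)" (is "subfield_set ?F")
proof -
  interpret R: field "ring_of_type_algebra :: 'b ring" ..
  have H: "H \<subseteq> carrier (ring_of_type_algebra :: 'b ring)"
    by (simp add: ring_of_type_algebra_def)
  have "subring ?F ring_of_type_algebra"
    by (rule subfieldE(1)[OF R.generate_field_is_subfield[OF H]])
  then interpret subring_set ?F
    by (simp add: subring_ring_of_type_algebra_iff)
  show ?thesis
  proof
    fix a :: 'b assume a: "a \<in> ?F"
    show "inverse a \<in> ?F"
    proof (cases "a = 0")
      case False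
      have "inv\<^bsub>ring_of_type_algebra\<^esub> a = inverse a"
        using False by (intro R.comm_inv_char) (auto simp: ring_of_type_algebra_def)
      moreover have "a \<noteq> \<zero>\<^bsub>ring_of_type_algebra\<^esub>"
        using False by (simp add: ring_of_type_algebra_def)
      ultimately show ?thesis
        using generate_field.m_inv[OF a] by simp
    qed (use a in simp)
  qed
qed

lemma generate_field_least:
  assumes "subfield_set (F :: 'b::field set)" "H \<subseteq> F"
  shows "generate_field ring_of_type_algebra H \<subseteq> F"
proof
  interpret subfield_set F by fact
  interpret R: field "ring_of_type_algebra :: 'b ring" ..
  have neg: "\<ominus>\<^bsub>ring_of_type_algebra\<^esub> h = - h" for h :: 'b
    by (rule R.minus_equality) (auto simp: ring_of_type_algebra_def)
  have inv: "inv\<^bsub>ring_of_type_algebra\<^esub> h = inverse h" if "h \<noteq> 0" for h :: 'b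
    using that by (intro R.comm_inv_char) (auto simp: ring_of_type_algebra_def)
  fix z assume "z \<in> generate_field ring_of_type_algebra H"
  thus "z \<in> F"
  proof induction
    case (m_inv h)
    thus ?case using inv[of h] inverse_mem[of h] by (simp add: ring_of_type_algebra_def)
  qed (use assms(2) in \<open>auto simp: ring_of_type_algebra_def neg[unfolded ring_of_type_algebra_def] intro: mems\<close>)
qed

text \<open>\<open>V = L\<close> is allowed here.\<close>

locale val_ring = L: subfield_set L + V: subring_set V for L V :: "'b::field set" +
  assumes sub: "V \<subseteq> L"
    and dich: "z \<in> L \<Longrightarrow> z \<in> V \<or> inverse z \<in> V"
begin

abbreviation "\<mm> \<equiv> max_ideal V"

lemma max_ideal_sub: "z \<in> \<mm> \<Longrightarrow> z \<in> V"
  by (simp add: max_ideal_def)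

lemma zero_in_max_ideal: "0 \<in> \<mm>"
  by (simp add: max_ideal_def V.zero_mem)

lemma one_notin_max_ideal: "1 \<notin> \<mm>"
  by (simp add: max_ideal_def V.one_mem)

lemma unit_iff: "z \<in> V - \<mm> \<longleftrightarrow> z \<noteq> 0 \<and> z \<in> V \<and> inverse z \<in> V"
  by (auto simp: max_ideal_def)

lemma max_ideal_mult: "a \<in> \<mm> \<Longrightarrow> b \<in> V \<Longrightarrow> a * b \<in> \<mm>"
proof -
  assume ab: "a \<in> \<mm>" "b \<in> V"
  show ?thesis
  proof (cases "a * b = 0")
    case False
    have "inverse (a * b) \<notin> V"
    proof
      assume "inverse (a * b) \<in> V"
      hence "b * inverse (a * b) \<in> V" using ab V.mult_mem by blast
      thus False using ab False by (simp add: max_ideal_def field_simps)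
    qed
    thus ?thesis using ab V.mult_mem by (simp add: max_ideal_def)
  qed (auto simp: zero_in_max_ideal)
qed

text \<open>One of \<open>a / b\<close> and \<open>b / a\<close> lies in \<open>V\<close>, so the
  sum is a multiple of one summand by an element of \<open>V\<close>. This is where the dichotomy
  makes the non-units an ideal.\<close>

lemma max_ideal_add: "a \<in> \<mm> \<Longrightarrow> b \<in> \<mm> \<Longrightarrow> a + b \<in> \<mm>"
proof -
  have *: "a + b \<in> \<mm>" if ab: "a \<in> \<mm>" "b \<in> \<mm>" and b0: "b \<noteq> 0" and q: "a / b \<in> V" for a b
  proof -
    have "b * (1 + a / b) \<in> \<mm>"
      using ab q by (intro max_ideal_mult V.mems)
    moreover have "b * (1 + a / b) = a + b" using b0 by (simp add: field_simps)
    ultimately show ?thesis by simp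
  qed
  assume ab: "a \<in> \<mm>" "b \<in> \<mm>"
  have "a / b \<in> V \<or> b / a \<in> V"
    using dich[of "a / b"] ab sub L.divide_mem by (auto simp: max_ideal_def)
  thus ?thesis
    using *[OF ab] *[OF ab(2,1)] ab by (cases "a = 0"; cases "b = 0") (auto simp: add.commute)
qed

lemma max_ideal_uminus: "a \<in> \<mm> \<Longrightarrow> - a \<in> \<mm>"
  by (auto simp: max_ideal_def V.uminus_mem) (metis V.uminus_mem minus_minus)

lemma max_ideal_diff: "a \<in> \<mm> \<Longrightarrow> b \<in> \<mm> \<Longrightarrow> a - b \<in> \<mm>"
  using max_ideal_add[OF _ max_ideal_uminus] by fastforce

lemma max_ideal_prime: "a \<in> V \<Longrightarrow> b \<in> V \<Longrightarrow> a * b \<in> \<mm> \<Longrightarrow> a \<in> \<mm> \<or> b \<in> \<mm>"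
  using V.mult_mem[of "inverse a" "inverse b"] by (auto simp: max_ideal_def)

lemma unit_add: "a \<in> V - \<mm> \<Longrightarrow> b \<in> \<mm> \<Longrightarrow> a + b \<in> V - \<mm>"
  using max_ideal_diff[of "a + b" b] V.add_mem max_ideal_sub by auto

lemma unit_mult: "a \<in> V - \<mm> \<Longrightarrow> b \<in> V - \<mm> \<Longrightarrow> a * b \<in> V - \<mm>"
  using max_ideal_prime V.mult_mem by blast

lemma unit_inverse: "a \<in> V - \<mm> \<Longrightarrow> inverse a \<in> V - \<mm>"
  unfolding unit_iff by simp

lemma unit_one: "1 \<in> V - \<mm>"
  by (simp add: one_notin_max_ideal V.one_mem)

lemma unit_power: "a \<in> V - \<mm> \<Longrightarrow> a ^ n \<in> V - \<mm>"
  by (induction n) (use unit_one unit_mult in auto)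

lemma unit_power_int: "a \<in> V - \<mm> \<Longrightarrow> a powi n \<in> V - \<mm>"
  using unit_power unit_inverse by (auto simp: power_int_def simp del: Diff_iff)

text \<open>A case of integral closedness: if \<open>z\<close> were outside \<open>V\<close>, then
  \<open>inverse z\<close> would be in \<open>V\<close>, and so would
  \<open>z = z ^ n * inverse z ^ (n - 1)\<close>.\<close>

lemma power_in_V_iff: "z \<in> L \<Longrightarrow> n > 0 \<Longrightarrow> z ^ n \<in> V \<longleftrightarrow> z \<in> V"
proof
  assume z: "z \<in> L" "n > 0" "z ^ n \<in> V"
  show "z \<in> V"
  proof (rule ccontr)
    assume nz: "z \<notin> V"
    hence iz: "inverse z \<in> V" "z \<noteq> 0" using dich[OF z(1)] V.zero_mem by blast+
    have "z ^ n * inverse z ^ (n - 1) \<in> V"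
      using z(3) iz(1) V.mult_mem V.power_mem by blast
    moreover have "z ^ n * inverse z ^ (n - 1) = z"
      using z(2) iz(2) by (cases n) (simp_all add: power_inverse)
    ultimately show False using nz by metis
  qed
qed (rule V.power_mem)

lemma notin_V_iff: "z \<in> L \<Longrightarrow> z \<notin> V \<longleftrightarrow> z \<noteq> 0 \<and> inverse z \<in> \<mm>"
  using dich[of z] V.zero_mem by (auto simp: max_ideal_def)

text \<open>Relative to a non-unit \<open>t\<close>; it need not generate the maximal ideal.\<close>

definition has_val :: "'b \<Rightarrow> 'b \<Rightarrow> int \<Rightarrow> bool" where
  "has_val t z n \<longleftrightarrow> (\<exists>u \<in> V - \<mm>. z = t powi n * u)"

context
  fixes t assumes t: "t \<in> \<mm>" "t \<noteq> 0"
begin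

lemma has_val_nonzero: "has_val t z n \<Longrightarrow> z \<noteq> 0"
  using t unit_iff by (fastforce simp: has_val_def)

lemma has_val_self: "has_val t t 1"
  unfolding has_val_def by (rule bexI[OF _ unit_one]) simp

lemma has_val_unit: "u \<in> V - \<mm> \<Longrightarrow> has_val t u 0"
  unfolding has_val_def by (rule bexI) auto

lemma has_val_mult: "has_val t a i \<Longrightarrow> has_val t b j \<Longrightarrow> has_val t (a * b) (i + j)"
proof -
  assume "has_val t a i" "has_val t b j"
  then obtain u v where "u \<in> V - \<mm>" "v \<in> V - \<mm>" "a = t powi i * u" "b = t powi j * v"
    by (auto simp: has_val_def)
  thus ?thesis
    unfolding has_val_def using t
    by (intro bexI[of _ "u * v"] unit_mult) (auto simp: power_int_add)
qed

lemma has_val_inverse: "has_val t a i \<Longrightarrow> has_val t (inverse a) (- i)"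
proof -
  assume "has_val t a i"
  then obtain u where "u \<in> V - \<mm>" "a = t powi i * u"
    by (auto simp: has_val_def)
  thus ?thesis
    unfolding has_val_def using t
    by (intro bexI[of _ "inverse u"] unit_inverse) (auto simp: power_int_minus)
qed

lemma has_val_divide: "has_val t a i \<Longrightarrow> has_val t b j \<Longrightarrow> has_val t (a / b) (i - j)"
  using has_val_mult[OF _ has_val_inverse] by (simp add: divide_inverse)

lemma has_val_power: "has_val t a i \<Longrightarrow> has_val t (a ^ n) (int n * i)"
proof (induction n)
  case 0 thus ?case using has_val_unit[OF unit_one] by simp
next
  case (Suc n)
  thus ?case using has_val_mult[of a i "a ^ n" "int n * i"] by (simp add: algebra_simps)
qed

lemma t_powi_in_max_ideal: "n > 0 \<Longrightarrow> t powi n \<in> \<mm>"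
proof -
  assume "n > 0"
  then obtain k where k: "n = int (Suc k)"
    by (metis not0_implies_Suc of_nat_0_less_iff pos_int_cases less_numeral_extra(3))
  have "t * t ^ k \<in> \<mm>"
    by (intro max_ideal_mult t V.power_mem max_ideal_sub)
  thus ?thesis unfolding k power_int_of_nat by simp
qed

lemma has_val_pos_iff: "has_val t z n \<Longrightarrow> z \<in> \<mm> \<longleftrightarrow> n > 0"
  and has_val_nonneg_iff: "has_val t z n \<Longrightarrow> z \<in> V \<longleftrightarrow> n \<ge> 0"
proof -
  assume "has_val t z n"
  then obtain u where u: "u \<in> V - \<mm>" "z = t powi n * u" by (auto simp: has_val_def)
  have 1: "z \<in> \<mm>" if "n > 0"
    using u that by (auto intro!: max_ideal_mult t_powi_in_max_ideal)
  have 2: "z \<notin> V" if "n < 0"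
  proof
    assume "z \<in> V"
    hence "t powi (- n) * z \<in> \<mm>"
      using that by (intro max_ideal_mult t_powi_in_max_ideal) auto
    moreover have "t powi (- n) * z = u"
      using u(2) t by (simp add: power_int_minus field_simps)
    ultimately show False using u(1) by (metis DiffD2)
  qed
  have 3: "z \<in> V - \<mm>" if "n = 0" using u that by simp
  show "z \<in> \<mm> \<longleftrightarrow> n > 0" "z \<in> V \<longleftrightarrow> n \<ge> 0"
    using 1 2 3 max_ideal_sub[of z] by (meson DiffD1 DiffD2 linorder_less_linear not_less order_less_le)+
qed

lemma has_val_unique: "has_val t z n \<Longrightarrow> has_val t z k \<Longrightarrow> n = k"
proof -
  assume a: "has_val t z n" "has_val t z k"
  have "has_val t 1 (n - k)" "has_val t 1 (k - n)"
    using has_val_divide[OF a] has_val_divide[OF a(2,1)] has_val_nonzero[OF a(1)] by simp_all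
  thus ?thesis
    using has_val_nonneg_iff[of 1 "n - k"] has_val_nonneg_iff[of 1 "k - n"] V.one_mem by simp
qed

lemma has_val_add_less: "has_val t a i \<Longrightarrow> has_val t b j \<Longrightarrow> i < j \<Longrightarrow> has_val t (a + b) i"
proof -
  assume ij: "has_val t a i" "has_val t b j" "i < j"
  obtain u where u: "u \<in> V - \<mm>" "a = t powi i * u"
    using ij by (auto simp: has_val_def)
  have "has_val t (b / t powi i) (j - i)"
    using has_val_divide[OF ij(2), of "t powi i" i] unit_one by (auto simp: has_val_def)
  hence "b / t powi i \<in> \<mm>"
    using has_val_pos_iff ij by simp
  from unit_add[OF u(1) this] show ?thesis
    unfolding has_val_def using u t by (intro bexI) (auto simp: field_simps)
qed

text \<open>Pairwise distinct valuations exclude cancellation, so each partial sum has the least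
  valuation of its terms.\<close>

lemma has_val_sum:
  assumes "finite I" "I \<noteq> {}" "\<And>i. i \<in> I \<Longrightarrow> has_val t (h i) (v i)" "inj_on v I"
  shows "has_val t (sum h I) (Min (v ` I))"
  using assms
proof (induction I rule: finite_ne_induct)
  case (insert a F)
  have IH: "has_val t (sum h F) (Min (v ` F))"
    using insert by auto
  have a: "has_val t (h a) (v a)" using insert by auto
  have "Min (v ` F) \<in> v ` F" using insert by auto
  moreover have "v a \<notin> v ` F" using insert.hyps(3) insert.prems(2) by (simp add: insert_Diff_if)
  ultimately have ne: "v a \<noteq> Min (v ` F)" by metis
  have Min: "Min (v ` insert a F) = min (v a) (Min (v ` F))"
    using insert by simp
  have s: "sum h (insert a F) = h a + sum h F" using insert by simp
  show ?case
  proof (cases "v a < Min (v ` F)")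
    case True
    thus ?thesis unfolding Min s using has_val_add_less[OF a IH] by simp
  next
    case False
    thus ?thesis unfolding Min s using has_val_add_less[OF IH a] ne by (simp add: add.commute)
  qed
qed auto

lemma max_ideal_generator:
  assumes "\<And>z. z \<in> V \<Longrightarrow> z \<noteq> 0 \<Longrightarrow> \<exists>n. has_val t z n"
  shows "\<mm> = (\<lambda>x. t * x) ` V"
proof
  show "(\<lambda>x. t * x) ` V \<subseteq> \<mm>" using max_ideal_mult t by auto
  show "\<mm> \<subseteq> (\<lambda>x. t * x) ` V"
  proof
    fix z assume z: "z \<in> \<mm>"
    show "z \<in> (\<lambda>x. t * x) ` V"
    proof (cases "z = 0")
      case True thus ?thesis using V.zero_mem by (auto intro!: image_eqI[of _ _ 0])
    next
      case False
      then obtain n where n: "has_val t z n" using assms z max_ideal_sub by blast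
      hence "n > 0" using has_val_pos_iff z by auto
      hence "z / t \<in> V" using has_val_nonneg_iff[OF has_val_divide[OF n has_val_self]] by simp
      thus ?thesis using t by (auto intro!: image_eqI[of _ _ "z / t"])
    qed
  qed
qed

text \<open>The description in \<open>place_val\<close> ranges over all generators of the maximal
  ideal. Two generators differ by a unit, so they give the same exponent.\<close>

lemma place_val_eq:
  assumes gen: "\<mm> = (\<lambda>x. t * x) ` V" and z: "has_val t z n"
  shows "place_val V z = n"
  unfolding place_val_def
proof (rule the_equality)
  show "\<exists>t u. \<mm> = (\<lambda>x. t * x) ` V \<and> u \<in> V - \<mm> \<and> z = t powi n * u"
    using z gen by (auto simp: has_val_def)
next
  fix k assume "\<exists>t u. \<mm> = (\<lambda>x. t * x) ` V \<and> u \<in> V - \<mm> \<and> z = t powi k * u"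
  then obtain s u where s: "\<mm> = (\<lambda>x. s * x) ` V" "u \<in> V - \<mm>" "z = s powi k * u" by blast
  have "s \<in> \<mm>" unfolding s(1) using V.one_mem by force
  then obtain a where a: "s = t * a" "a \<in> V" unfolding gen by blast
  obtain b where b: "t = s * b" "b \<in> V" using t unfolding s(1) by blast
  have "a * b = 1" using a(1) b(1) t by (auto simp: mult.commute)
  hence "a \<in> V - \<mm>" using a b unfolding unit_iff by (metis inverse_unique mult_zero_left zero_neq_one)
  hence "has_val t s 1" unfolding has_val_def using a by auto
  hence "s powi k * u = t powi k * (a powi k * u)" "a powi k * u \<in> V - \<mm>"
    using a s(2) \<open>a \<in> V - \<mm>\<close> by (simp_all add: power_int_mult_distrib unit_mult unit_power_int del: Diff_iff)
  hence "has_val t z k" unfolding has_val_def s(3) by blast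
  thus "k = n" using has_val_unique z by blast
qed

end

end

lemma places_iff:
  assumes "subfield_set L"
  shows "V \<in> places k L \<longleftrightarrow> val_ring L V \<and> k \<subseteq> V \<and> V \<noteq> L"
  using assms
  by (auto simp: places_def subring_ring_of_type_algebra_iff val_ring_def val_ring_axioms_def)

definition polys_in :: "'b::comm_ring_1 set \<Rightarrow> 'b poly set" where
  "polys_in S = {P. \<forall>n. coeff P n \<in> S}"

lemma poly_over_eq: "poly_over = polys_in"
  by (simp add: poly_over_def polys_in_def fun_eq_iff)

context subring_set
begin

lemma subring_polys_in: "subring_set (polys_in S)"
  by standard (auto simp: polys_in_def coeff_mult intro: mems)

lemma pCons_in_polys_in_iff: "pCons a P \<in> polys_in S \<longleftrightarrow> a \<in> S \<and> P \<in> polys_in S"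
  by (auto simp: polys_in_def coeff_pCons split: nat.splits)

lemma monom_in_polys_in: "c \<in> S \<Longrightarrow> monom c n \<in> polys_in S"
  by (auto simp: polys_in_def zero_mem)

lemma smult_in_polys_in: "c \<in> S \<Longrightarrow> P \<in> polys_in S \<Longrightarrow> smult c P \<in> polys_in S"
  by (auto simp: polys_in_def mult_mem)

lemma poly_mem: "P \<in> polys_in S \<Longrightarrow> z \<in> S \<Longrightarrow> poly P z \<in> S"
  by (auto simp: poly_altdef polys_in_def intro!: mems)

text \<open>The divisor is monic, so no inverses occur and the quotient stays over \<open>S\<close>.
  Below, \<open>S\<close> is also taken to be a polynomial ring.\<close>

lemma division_by_linear:
  assumes "P \<in> polys_in S" "c \<in> S"
  obtains Q where "Q \<in> polys_in S" "P = [:- c, 1:] * Q + [:poly P c:]"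
proof -
  have "\<exists>Q \<in> polys_in S. P = [:- c, 1:] * Q + [:poly P c:]"
    using assms(1)
  proof (induction P)
    case 0
    show ?case by (intro bexI[of _ 0]) (auto simp: polys_in_def zero_mem)
  next
    case (pCons a P)
    hence a: "a \<in> S" "P \<in> polys_in S" by (simp_all add: pCons_in_polys_in_iff)
    then obtain Q where Q: "Q \<in> polys_in S" "P = [:- c, 1:] * Q + [:poly P c:]"
      using pCons by blast
    have "poly P c \<in> S" using poly_mem a assms by blast
    moreover have "pCons a P = [:- c, 1:] * pCons (poly P c) Q + [:poly (pCons a P) c:]"
      using arg_cong[OF Q(2), of "pCons 0"] by (simp add: algebra_simps)
    ultimately show ?case
      using Q(1) by (intro bexI[of _ "pCons (poly P c) Q"]) (simp_all add: pCons_in_polys_in_iff)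
  qed
  thus ?thesis using that by blast
qed

lemma adjoin:
  "subring_set ((\<lambda>P. poly P z) ` polys_in S)" "S \<subseteq> (\<lambda>P. poly P z) ` polys_in S"
  "z \<in> (\<lambda>P. poly P z) ` polys_in S"
proof -
  interpret P: subring_set "polys_in S" by (rule subring_polys_in)
  show "subring_set ((\<lambda>P. poly P z) ` polys_in S)"
  proof
    show "1 \<in> (\<lambda>P. poly P z) ` polys_in S"
      using P.one_mem by (rule rev_image_eqI) simp
  next
    fix a b assume "a \<in> (\<lambda>P. poly P z) ` polys_in S" "b \<in> (\<lambda>P. poly P z) ` polys_in S"
    then obtain P Q where "P \<in> polys_in S" "Q \<in> polys_in S" "a = poly P z" "b = poly Q z"
      by blast
    thus "a - b \<in> (\<lambda>P. poly P z) ` polys_in S" "a * b \<in> (\<lambda>P. poly P z) ` polys_in S"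
      using P.diff_mem[of P Q] P.mult_mem[of P Q]
      by (auto simp flip: poly_diff poly_mult)
  qed
  show "S \<subseteq> (\<lambda>P. poly P z) ` polys_in S"
  proof
    fix s assume "s \<in> S"
    thus "s \<in> (\<lambda>P. poly P z) ` polys_in S"
      by (intro rev_image_eqI[of "[:s:]"]) (auto simp: pCons_in_polys_in_iff P.zero_mem)
  qed
  show "z \<in> (\<lambda>P. poly P z) ` polys_in S"
    by (rule rev_image_eqI[of "[:0, 1:]"])
       (auto simp: pCons_in_polys_in_iff P.zero_mem zero_mem one_mem)
qed

end

lemma subring_set_UN:
  assumes "subset.chain \<A> C" "C \<noteq> {}" "\<And>B. B \<in> C \<Longrightarrow> subring_set B"
  shows "subring_set (\<Union>C)"
proof
  show "1 \<in> \<Union>C" using assms subring_set.one_mem by fastforce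
next
  fix a b assume ab: "a \<in> \<Union>C" "b \<in> \<Union>C"
  then obtain A B where AB: "A \<in> C" "B \<in> C" "a \<in> A" "b \<in> B" by blast
  hence "A \<subseteq> B \<or> B \<subseteq> A"
    using assms(1) by (meson subset.chain_total subset_chain_def)
  then obtain D where D: "D \<in> C" "a \<in> D" "b \<in> D" using AB by blast
  interpret subring_set D using D assms by blast
  show "a - b \<in> \<Union>C" "a * b \<in> \<Union>C" using D diff_mem mult_mem by blast+
qed

text \<open>A subring maximal among those that do not contain \<open>1/u\<close> is a valuation ring.\<close>

lemma exists_val_ring:
  fixes L :: "'b::field set"
  assumes L: "subfield_set L" and A: "subring_set A" "A \<subseteq> L" and u: "u \<in> A" "inverse u \<notin> A"
  obtains V where "val_ring L V" "A \<subseteq> V" "inverse u \<notin> V"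
proof -
  interpret L: subfield_set L by fact
  define \<A> where "\<A> = {B. subring_set B \<and> A \<subseteq> B \<and> B \<subseteq> L \<and> inverse u \<notin> B}"
  have u0: "u \<noteq> 0" using u by auto
  have "\<exists>M\<in>\<A>. \<forall>B\<in>\<A>. M \<subseteq> B \<longrightarrow> B = M"
  proof (rule subset_Zorn_nonempty)
    show "\<A> \<noteq> {}" using A u by (auto simp: \<A>_def)
    fix C assume C: "C \<noteq> {}" "subset.chain \<A> C"
    hence sub: "C \<subseteq> \<A>" by (simp add: subset_chain_def)
    have "subring_set (\<Union>C)"
      using C sub by (intro subring_set_UN[of \<A>]) (auto simp: \<A>_def)
    thus "\<Union>C \<in> \<A>" using C sub unfolding \<A>_def by blast
  qed
  then obtain M where M: "M \<in> \<A>" and max: "\<And>B. B \<in> \<A> \<Longrightarrow> M \<subseteq> B \<Longrightarrow> B = M" by blast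
  interpret M: subring_set M using M by (simp add: \<A>_def)
  have M_sub: "M \<subseteq> L" "A \<subseteq> M" "inverse u \<notin> M" using M by (auto simp: \<A>_def)
  have uM: "u \<in> M" using M_sub u by auto
  have big: "inverse u \<in> B" if "subring_set B" "M \<subset> B" "B \<subseteq> L" for B
    using max[of B] that M_sub by (auto simp: \<A>_def)
  \<comment> \<open>Adjoin the inverse of \<open>s = 1 - u * b\<close> to \<open>M\<close>. Each
    power of \<open>s\<close> is again of the form \<open>1 - u * d\<close>, so
    \<open>inverse u = c / s ^ k\<close> would give \<open>inverse u = c + d\<close> in
    \<open>M\<close>. The larger ring thus avoids \<open>inverse u\<close>, and by maximality it is
    \<open>M\<close> itself.\<close>
  have inv: "inverse (1 - u * b) \<in> M" and nz: "1 - u * b \<noteq> 0" if b: "b \<in> M" for b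
  proof -
    define s where "s = 1 - u * b"
    have sM: "s \<in> M" unfolding s_def by (intro M.mems uM b)
    show nz: "1 - u * b \<noteq> 0"
    proof
      assume "1 - u * b = 0"
      hence "b = inverse u" using u0 by (simp add: field_simps)
      thus False using M_sub b by simp
    qed
    have pow: "\<exists>d\<in>M. s ^ k = 1 - u * d" for k
    proof (induction k)
      case 0 show ?case by (intro bexI[of _ 0]) (auto intro: M.zero_mem)
    next
      case (Suc k)
      then obtain d where d: "d \<in> M" "s ^ k = 1 - u * d" by blast
      have "s ^ Suc k = 1 - u * (d + b - u * b * d)"
        unfolding power_Suc d(2) by (simp add: s_def algebra_simps)
      moreover have "d + b - u * b * d \<in> M"
        by (intro M.diff_mem M.add_mem M.mult_mem d b uM)
      ultimately show ?case by blast
    qed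
    define B where "B = {c / s ^ k | c k. c \<in> M}"
    have "subring_set B"
    proof
      have "1 = 1 / s ^ 0" by simp
      thus "1 \<in> B" unfolding B_def using M.one_mem by blast
      fix x y assume "x \<in> B" "y \<in> B"
      then obtain c k d l where *: "c \<in> M" "d \<in> M" "x = c / s ^ k" "y = d / s ^ l"
        by (auto simp: B_def)
      have "x - y = (c * s ^ l - d * s ^ k) / s ^ (k + l)"
        using nz by (simp add: *(3,4) power_add diff_divide_distrib flip: s_def)
      moreover have "c * s ^ l - d * s ^ k \<in> M" using * sM by (intro M.diff_mem M.mult_mem M.power_mem)
      ultimately show "x - y \<in> B" unfolding B_def by blast
      have "x * y = (c * d) / s ^ (k + l)"
        using * by (simp add: power_add)
      thus "x * y \<in> B" unfolding B_def using * M.mult_mem by blast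
    qed
    moreover have "M \<subseteq> B"
    proof
      fix c assume "c \<in> M"
      moreover have "c = c / s ^ 0" by simp
      ultimately show "c \<in> B" unfolding B_def by blast
    qed
    moreover have "B \<subseteq> L"
      unfolding B_def using M_sub sM by (auto intro!: L.divide_mem L.power_mem)
    moreover have "inverse u \<notin> B"
    proof
      assume "inverse u \<in> B"
      then obtain c k where c: "c \<in> M" "inverse u = c / s ^ k" by (auto simp: B_def)
      obtain d where d: "d \<in> M" "s ^ k = 1 - u * d" using pow by blast
      have "s ^ k \<noteq> 0" using nz by (simp add: s_def)
      hence "inverse u = c + d" using c d u0 by (simp add: field_simps)
      thus False using M_sub c d M.add_mem by auto
    qed
    ultimately have "B = M" using big by blast
    moreover have "inverse s = 1 / s ^ 1" by (simp add: inverse_eq_divide)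
    hence "inverse s \<in> B" unfolding B_def using M.one_mem by blast
    ultimately show "inverse (1 - u * b) \<in> M" by (simp add: s_def)
  qed
  \<comment> \<open>For \<open>z\<close> outside \<open>M\<close>, maximality puts
    \<open>inverse u\<close> into the ring generated by \<open>M\<close> and \<open>z\<close>, which
    gives such a representation. If neither \<open>z\<close> nor \<open>inverse z\<close> were in
    \<open>M\<close>, two representations of minimal degree could be played off against each
    other.\<close>
  define rep where "rep z n \<longleftrightarrow> (\<exists>P \<in> polys_in M. degree P = n \<and> u * poly P z = 1)" for z n
  have rep: "\<exists>n. rep z n" if "z \<in> L" "z \<notin> M" for z
  proof -
    have "(\<lambda>P. poly P z) ` polys_in M \<subseteq> L"
      using that M_sub L.poly_mem by (force simp: polys_in_def)
    hence "inverse u \<in> (\<lambda>P. poly P z) ` polys_in M"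
      using that M.adjoin[of z] by (intro big) auto
    then obtain P where "P \<in> polys_in M" "poly P z = inverse u" by auto
    thus ?thesis unfolding rep_def using u0 by (intro exI bexI[of _ P]) auto
  qed
  have False if z: "z \<noteq> 0" and n: "rep z n" and m: "rep (inverse z) m" and le: "m \<le> n"
    and min: "\<And>k. k < n \<Longrightarrow> \<not> rep z k" for z n m
  proof -
    interpret P: subring_set "polys_in M" by (rule M.subring_polys_in)
    obtain P where P: "P \<in> polys_in M" "degree P = n" "u * poly P z = 1"
      using n by (auto simp: rep_def)
    obtain R where R: "R \<in> polys_in M" "degree R = m" "u * poly R (inverse z) = 1"
      using m by (auto simp: rep_def)
    have Ri: "coeff R i \<in> M" and Pi: "coeff P i \<in> M" for i using R P by (auto simp: polys_in_def)
    have "n > 0"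
    proof (rule ccontr)
      assume "\<not> n > 0"
      then obtain c where "P = [:c:]" using P degree_eq_zeroE by blast
      hence "u * c = 1" "c \<in> M" using P(3) Pi[of 0] by auto
      hence "inverse u \<in> M" using u0 by (metis inverse_unique)
      thus False using M_sub by simp
    qed
    \<comment> \<open>Multiply the representation for \<open>inverse z\<close> by
      \<open>z ^ n\<close>. There \<open>z ^ n\<close> itself gets the invertible coefficient
      \<open>1 - u * coeff R 0\<close>, so it can be expressed by lower powers of \<open>z\<close>.
      Substituting this for the leading term of \<open>P\<close> contradicts the minimality of
      \<open>n\<close>.\<close>
    define v where "v = inverse (1 - u * coeff R 0)"
    have v: "v \<in> M" "v * (1 - u * coeff R 0) = 1" using inv[OF Ri] nz[OF Ri] by (auto simp: v_def)
    define Q where "Q = (\<Sum>i\<in>{1..m}. monom (v * coeff R i) (n - i))"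
    have Q: "Q \<in> polys_in M" unfolding Q_def
      by (intro P.sum_mem M.monom_in_polys_in M.mult_mem v Ri)
    have dQ: "degree Q < n"
    proof -
      have "degree Q \<le> n - 1" unfolding Q_def
        by (intro degree_sum_le order.trans[OF degree_monom_le]) auto
      thus ?thesis using \<open>n > 0\<close> by simp
    qed
    have "1 = u * (\<Sum>i\<le>m. coeff R i * inverse z ^ i)"
      using R by (simp add: poly_altdef)
    also have "{..m} = insert 0 {1..m}" by auto
    finally have "1 - u * coeff R 0 = u * (\<Sum>i\<in>{1..m}. coeff R i * inverse z ^ i)"
      by (simp add: algebra_simps)
    hence "v * (1 - u * coeff R 0) * z ^ n
             = v * (u * (\<Sum>i\<in>{1..m}. coeff R i * inverse z ^ i)) * z ^ n" by simp
    hence "z ^ n = u * (\<Sum>i\<in>{1..m}. v * coeff R i * (inverse z ^ i * z ^ n))"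
      unfolding v by (simp add: sum_distrib_left sum_distrib_right mult_ac)
    also have "(\<Sum>i\<in>{1..m}. v * coeff R i * (inverse z ^ i * z ^ n)) = poly Q z"
      unfolding Q_def poly_sum
    proof (rule sum.cong[OF refl])
      fix i assume "i \<in> {1..m}"
      hence "z ^ n = z ^ i * z ^ (n - i)" using le by (simp flip: power_add)
      thus "v * coeff R i * (inverse z ^ i * z ^ n) = poly (monom (v * coeff R i) (n - i)) z"
        using z by (simp add: poly_monom field_simps)
    qed
    finally have zn: "z ^ n = u * poly Q z" .
    define S where "S = smult (coeff P n * u) Q + (P - monom (coeff P n) n)"
    have "S \<in> polys_in M" unfolding S_def
      by (intro P.add_mem P.diff_mem M.smult_in_polys_in M.monom_in_polys_in M.mult_mem Q P Pi uM)
    moreover have "degree (P - monom (coeff P n) n) < n"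
    proof -
      have "degree (P - monom (coeff P n) n) \<le> n - 1"
      proof (rule degree_le, safe)
        fix i assume i: "n - 1 < i"
        hence "i = n \<or> i > degree P" using P(2) by linarith
        thus "coeff (P - monom (coeff P n) n) i = 0" using P(2) by (auto simp: coeff_eq_0)
      qed
      thus ?thesis using \<open>n > 0\<close> by simp
    qed
    hence "degree S < n" unfolding S_def using dQ
      by (intro degree_add_less) (auto intro: le_less_trans[OF degree_smult_le])
    moreover have "poly S z = poly P z"
      unfolding S_def by (simp add: poly_monom zn algebra_simps)
    ultimately show False using min[of "degree S"] P(3) by (auto simp: rep_def)
  qed
  note key = this
  have "z \<in> M \<or> inverse z \<in> M" if zL: "z \<in> L" for z
  proof (rule ccontr)
    assume *: "\<not> (z \<in> M \<or> inverse z \<in> M)"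
    hence z0: "z \<noteq> 0" using M.zero_mem by auto
    obtain n where n: "rep z n" "\<And>k. k < n \<Longrightarrow> \<not> rep z k"
      using rep[of z] * zL by (metis exists_least_iff)
    obtain m where m: "rep (inverse z) m" "\<And>k. k < m \<Longrightarrow> \<not> rep (inverse z) k"
      using rep[of "inverse z"] * L.inverse_mem[OF zL] by (metis exists_least_iff)
    show False
    proof (cases "m \<le> n")
      case True thus ?thesis using key[OF z0 n(1) m(1)] n by blast
    next
      case False thus ?thesis using key[of "inverse z" m n] z0 n m by auto
    qed
  qed
  hence "val_ring L M" using M_sub by unfold_locales auto
  thus ?thesis using that M_sub by blast
qed

section \<open>The function field of an Artin--Schreier curve\<close>

lemma of_poly_simps [simp]:
  "of_poly 0 = 0" "of_poly 1 = 1" "of_poly (G + H) = of_poly G + of_poly H"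
  "of_poly (G - H) = of_poly G - of_poly H" "of_poly (- G) = - of_poly G"
  "of_poly (G * H) = of_poly G * of_poly H"
  "of_poly G = of_poly H \<longleftrightarrow> G = H" "of_poly G = 0 \<longleftrightarrow> G = 0"
  by (simp_all add: of_poly_def)

lemma of_poly_power [simp]: "of_poly (G ^ n) = of_poly G ^ n"
  by (induction n) simp_all

lemma const_add [simp]: "const (a + b) = const a + const b"
  and const_diff [simp]: "const (a - b) = const a - const b"
  and const_mult [simp]: "const (a * b) = const a * const b"
  and const_uminus [simp]: "const (- a) = - const a"
  and const_0 [simp]: "const 0 = 0"
  and const_eq_iff [simp]: "const a = const b \<longleftrightarrow> a = b"
  and const_eq_0_iff [simp]: "const a = 0 \<longleftrightarrow> a = 0"
  by (simp_all add: const_def of_poly_def flip: to_ac_add to_ac_diff to_ac_mult to_ac_minus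
        to_fract_add to_fract_diff to_fract_mult to_fract_uminus)

lemma const_1 [simp]: "const 1 = 1"
  by (simp add: const_def flip: one_pCons)

lemma const_power [simp]: "const (a ^ n) = const a ^ n"
  by (induction n) simp_all

lemma const_inverse [simp]: "const (inverse a) = inverse (const a)"
proof (cases "a = 0")
  case False
  have "const a * const (inverse a) = const (a * inverse a)" by simp
  hence "const a * const (inverse a) = 1" using False by (simp del: const_mult)
  thus ?thesis by (rule inverse_unique[symmetric])
qed simp

lemma const_divide [simp]: "const (a / b) = const a / const b"
  by (simp add: divide_inverse)

lemma of_poly_pCons: "of_poly (pCons a G) = const a + of_poly [:0, 1:] * of_poly G"
proof -
  have "pCons a G = [:a:] + [:0, 1:] * G" by simp
  thus ?thesis unfolding const_def by (simp only: of_poly_simps)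
qed

lemma of_poly_linear: "of_poly [:- a, 1:] = of_poly [:0, 1:] - const a"
  unfolding const_def by (simp flip: of_poly_simps(4))

lemma of_poly_eq_poly: "of_poly G = poly (map_poly const G) (of_poly [:0, 1:])"
proof (induction G)
  case (pCons a G)
  thus ?case using of_poly_pCons[of a G] by (simp add: map_poly_pCons)
qed simp

lemma poly_ring_hom_map:
  fixes h :: "'b::comm_ring_1 \<Rightarrow> 'c::comm_ring_1"
  assumes "h 0 = 0" "\<And>a b. h (a + b) = h a + h b" "\<And>a b. h (a * b) = h a * h b"
  shows "poly (map_poly h (P + Q)) z = poly (map_poly h P) z + poly (map_poly h Q) z"
    and "poly (map_poly h (P * Q)) z = poly (map_poly h P) z * poly (map_poly h Q) z"
proof -
  have add: "map_poly h (P + Q) = map_poly h P + map_poly h Q" for P Q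
    by (intro poly_eqI) (simp add: coeff_map_poly assms(1,2))
  thus "poly (map_poly h (P + Q)) z = poly (map_poly h P) z + poly (map_poly h Q) z"
    by simp
  show "poly (map_poly h (P * Q)) z = poly (map_poly h P) z * poly (map_poly h Q) z"
  proof (induction P)
    case (pCons a P)
    have "map_poly h (smult a Q) = smult (h a) (map_poly h Q)"
      by (intro poly_eqI) (simp add: coeff_map_poly assms(1,3))
    thus ?case using pCons.IH
      by (simp add: add map_poly_pCons assms(1) distrib_right mult.assoc)
  qed simp
qed

lemma poly_map_const_linear:
  "poly (map_poly const ([:- c, 1:] * Q + [:d:])) z = (z - const c) * poly (map_poly const Q) z + const d"
proof -
  have "poly (map_poly const [:- c, 1:]) z = z - const c" by (simp add: map_poly_pCons)
  moreover have "poly (map_poly const [:d:]) z = const d" by (simp add: map_poly_pCons)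
  ultimately show ?thesis by (simp only: poly_ring_hom_map[of const, OF const_0 const_add const_mult])
qed

lemma fract_poly_clear_denominators:
  fixes g :: "'b::idom fract poly"
  obtains d G where "d \<noteq> 0" "smult (to_fract d) g = map_poly to_fract G"
proof -
  have "\<exists>d G. d \<noteq> 0 \<and> smult (to_fract d) g = map_poly to_fract G"
  proof (induction g)
    case 0
    show ?case by (intro exI[of _ 1] exI[of _ 0]) simp
  next
    case (pCons c g)
    then obtain d G where d: "d \<noteq> 0" "smult (to_fract d) g = map_poly to_fract G" by blast
    obtain a b where c: "c = to_fract a / to_fract b" "b \<noteq> 0"
      by (cases c) (simp add: Fract_conv_to_fract)
    have "smult (to_fract (b * d)) (pCons c g) = map_poly to_fract (pCons (a * d) (smult b G))"
    proof -
      have "smult (to_fract (b * d)) g = smult (to_fract b) (map_poly to_fract G)"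
        by (simp flip: d(2))
      also have "\<dots> = map_poly to_fract (smult b G)"
        by (intro poly_eqI) (simp add: coeff_map_poly)
      finally show ?thesis using c by (simp add: map_poly_pCons)
    qed
    moreover have "b * d \<noteq> 0" using c d by simp
    ultimately show ?case by blast
  qed
  thus ?thesis using that by blast
qed

text \<open>Clear denominators in an algebraic equation for \<open>z\<close> and cancel powers of
  \<open>z\<close> until the constant term is nonzero. The result plays the part of a norm: a
  multiple of \<open>z\<close> that is a polynomial in \<open>x\<close> alone, so the zeros of
  \<open>z\<close> lie over finitely many values of \<open>x\<close>.\<close>

lemma ffield_algebraic:
  fixes z :: "'a::field ffield"
  assumes "z \<noteq> 0"
  obtains G0 :: "'a poly" and G1 :: "'a poly poly"
  where "G0 \<noteq> 0" "z * poly (map_poly of_poly G1) z = of_poly G0"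
proof -
  obtain g :: "'a poly fract poly" where g: "g \<noteq> 0" "poly (map_poly to_ac g) z = 0"
    by (rule alg_closure_algebraic)
  obtain d G where d: "d \<noteq> 0" "smult (to_fract d) g = map_poly to_fract G"
    by (rule fract_poly_clear_denominators)
  have "map_poly of_poly G = map_poly to_ac (smult (to_fract d) g)"
    unfolding d(2) by (intro poly_eqI) (simp add: coeff_map_poly of_poly_def)
  also have "\<dots> = smult (of_poly d) (map_poly to_ac g)"
    by (intro poly_eqI) (simp add: coeff_map_poly of_poly_def)
  finally have "poly (map_poly of_poly G) z = 0" using g by simp
  moreover have "G \<noteq> 0" using d g by auto
  ultimately have "\<exists>G0 G1. G0 \<noteq> 0 \<and> z * poly (map_poly of_poly G1) z = of_poly G0"
  proof (induction G)
    case (pCons a G)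
    show ?case
    proof (cases "a = 0")
      case True thus ?thesis using pCons assms by (auto simp: map_poly_pCons)
    next
      case False
      have neg: "map_poly of_poly (- G) = - map_poly of_poly G"
        by (intro poly_eqI) (simp add: coeff_map_poly)
      have "z * poly (map_poly of_poly (- G)) z = of_poly a"
        using pCons.prems unfolding neg by (simp add: map_poly_pCons neg_eq_iff_add_eq_0 add.commute)
      thus ?thesis using False by blast
    qed
  qed simp
  thus ?thesis using that by blast
qed

text \<open>The condition \<open>of_nat p = 0\<close> makes \<open>Y^p - Y - c\<close> separable for
  every \<open>c\<close>. The shape \<open>p * m + 1\<close> of the degree makes the pole orders of
  \<open>x\<close> and \<open>y\<close> at infinity coprime.\<close>

locale AS_curve =
  fixes p m :: nat and f :: "'a::alg_closed_field poly"
  assumes p_ge_2: "p \<ge> 2" and of_nat_p: "of_nat p = (0 :: 'a)" and degree_f: "degree f = p * m + 1"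
begin

definition x :: "'a ffield" where "x = of_poly [:0, 1:]"
definition y :: "'a ffield" where "y = AS_root p f"

text \<open>Polynomials in two variables are encoded as polynomials in \<open>Y\<close> over
  polynomials in \<open>x\<close>, which suits division by the equation \<open>\<Phi>\<close>, monic
  in \<open>Y\<close>.\<close>

definition ev :: "'a poly poly \<Rightarrow> 'a ffield" where
  "ev P = poly (map_poly of_poly P) y"

definition ev_at :: "'a \<Rightarrow> 'a \<Rightarrow> 'a poly poly \<Rightarrow> 'a" where
  "ev_at \<alpha> \<beta> P = poly (poly P [:\<beta>:]) \<alpha>"

definition \<Phi> :: "'a poly poly" where
  "\<Phi> = monom 1 p - monom 1 1 - [:f:]"

lemma AS_eq: "y ^ p - y = of_poly f"
  unfolding y_def using p_ge_2 by (rule AS_root)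

lemma f_nonzero: "f \<noteq> 0"
  using degree_f by auto

lemma ev_pCons: "ev (pCons a P) = of_poly a + y * ev P"
  by (simp add: ev_def map_poly_pCons)

lemma ev_0 [simp]: "ev 0 = 0"
  by (simp add: ev_def)

lemma ev_const [simp]: "ev [:a:] = of_poly a"
  by (simp add: ev_pCons)

lemma ev_1 [simp]: "ev 1 = 1"
  using ev_const[of 1] by (simp flip: one_pCons)

lemma ev_add [simp]: "ev (P + Q) = ev P + ev Q"
  and ev_mult [simp]: "ev (P * Q) = ev P * ev Q"
  unfolding ev_def by (rule poly_ring_hom_map; simp)+

lemma ev_uminus [simp]: "ev (- P) = - ev P"
  using ev_add[of P "- P"] by (simp add: eq_neg_iff_add_eq_0 add.commute)

lemma ev_diff [simp]: "ev (P - Q) = ev P - ev Q"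
  using ev_add[of P "- Q"] by simp

lemma ev_smult [simp]: "ev (smult a P) = of_poly a * ev P"
  using ev_mult[of "[:a:]" P] by simp

lemma ev_monom [simp]: "ev (monom a n) = of_poly a * y ^ n"
  by (induction n) (simp_all add: monom_0 monom_Suc ev_pCons)

lemma ev_\<Phi>: "ev \<Phi> = 0"
  using AS_eq by (simp add: \<Phi>_def)

lemma ev_sum: "ev P = (\<Sum>j | coeff P j \<noteq> 0. of_poly (coeff P j) * y ^ j)"
proof -
  have "ev P = (\<Sum>j\<le>degree P. of_poly (coeff P j) * y ^ j)"
    unfolding ev_def by (simp add: poly_altdef coeff_map_poly degree_map_poly)
  also have "\<dots> = (\<Sum>j | coeff P j \<noteq> 0. of_poly (coeff P j) * y ^ j)"
    by (intro sum.mono_neutral_right) (auto intro: le_degree)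
  finally show ?thesis .
qed

lemma ev_at_simps [simp]:
  "ev_at \<alpha> \<beta> 0 = 0" "ev_at \<alpha> \<beta> 1 = 1" "ev_at \<alpha> \<beta> (P + Q) = ev_at \<alpha> \<beta> P + ev_at \<alpha> \<beta> Q"
  "ev_at \<alpha> \<beta> (P - Q) = ev_at \<alpha> \<beta> P - ev_at \<alpha> \<beta> Q" "ev_at \<alpha> \<beta> (P * Q) = ev_at \<alpha> \<beta> P * ev_at \<alpha> \<beta> Q"
  "ev_at \<alpha> \<beta> [:G:] = poly G \<alpha>" "ev_at \<alpha> \<beta> (smult G P) = poly G \<alpha> * ev_at \<alpha> \<beta> P"
  "ev_at \<alpha> \<beta> (pCons G P) = poly G \<alpha> + \<beta> * ev_at \<alpha> \<beta> P"
  by (simp_all add: ev_at_def)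

lemma ev_at_\<Phi>: "ev_at \<alpha> \<beta> \<Phi> = \<beta> ^ p - \<beta> - poly f \<alpha>"
  by (simp add: \<Phi>_def ev_at_def poly_monom poly_power)

lemma ev_algebraic:
  assumes "ev P \<noteq> 0"
  obtains G Q where "G \<noteq> 0" "ev P * ev Q = of_poly G"
proof -
  obtain G0 and G1 where G: "G0 \<noteq> 0" "ev P * poly (map_poly of_poly G1) (ev P) = of_poly G0"
    using ffield_algebraic[OF assms] by blast
  have "poly (map_poly of_poly G1) (ev P) = ev (poly (map_poly (\<lambda>a. [:a:]) G1) P)"
    by (induction G1) (simp_all add: map_poly_pCons)
  thus ?thesis using that G by metis
qed

end

text \<open>Two choices of \<open>K\<close> matter: the field with \<open>q^2\<close> elements for
  counting points, and \<open>UNIV\<close> for the genus.\<close>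

locale AS_curve_over = AS_curve p m f + K: subfield_set K
  for p m and f :: "'a::alg_closed_field poly" and K :: "'a set" +
  assumes f_over: "f \<in> polys_in K"
begin

definition L :: "'a ffield set" where "L = AS_field p K f"

abbreviation "KX \<equiv> polys_in K"
abbreviation "KXY \<equiv> polys_in KX"

sublocale KX: subring_set KX by (rule K.subring_polys_in)
sublocale KXY: subring_set KXY by (rule KX.subring_polys_in)

lemma const_over: "c \<in> K \<Longrightarrow> [:c:] \<in> KX"
  by (simp add: K.pCons_in_polys_in_iff KX.zero_mem)

lemma lift_over: "G \<in> KX \<Longrightarrow> [:G:] \<in> KXY"
  by (simp add: KX.pCons_in_polys_in_iff KXY.zero_mem)

lemma linear_over: "c \<in> K \<Longrightarrow> [:c, 1:] \<in> KX"
  by (simp add: K.pCons_in_polys_in_iff KX.zero_mem K.one_mem)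

lemma \<Phi>_over: "\<Phi> \<in> KXY"
  unfolding \<Phi>_def by (intro KXY.diff_mem KX.monom_in_polys_in lift_over f_over KX.one_mem)

sublocale L: subfield_set L
  unfolding L_def AS_field_def by (rule subfield_generate_field)

lemma const_in_L: "c \<in> K \<Longrightarrow> const c \<in> L"
  and x_in_L: "x \<in> L" and y_in_L: "y \<in> L"
  unfolding L_def AS_field_def x_def y_def by (auto intro: generate_field.incl)

lemma of_poly_in_ring:
  assumes "subring_set V" "const ` K \<subseteq> V" "x \<in> V" "G \<in> KX"
  shows "of_poly G \<in> V"
  using assms(4)
proof (induction G)
  case 0
  then show ?case using subring_set.zero_mem[OF assms(1)] by simp
next
  case (pCons a G)
  interpret subring_set V by fact
  have "a \<in> K" "G \<in> KX" using pCons by (simp_all add: K.pCons_in_polys_in_iff)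
  thus ?case using pCons assms of_poly_pCons[of a G, folded x_def] by (auto intro!: add_mem mult_mem)
qed

lemma ev_in_ring:
  assumes "subring_set V" "const ` K \<subseteq> V" "x \<in> V" "y \<in> V" "P \<in> KXY"
  shows "ev P \<in> V"
  using assms(5)
proof (induction P)
  case 0
  then show ?case using subring_set.zero_mem[OF assms(1)] by simp
next
  case (pCons a P)
  interpret subring_set V by fact
  have "a \<in> KX" "P \<in> KXY" using pCons by (simp_all add: KX.pCons_in_polys_in_iff)
  thus ?case using pCons assms of_poly_in_ring[OF assms(1-3)] by (auto simp: ev_pCons intro!: add_mem mult_mem)
qed

lemma ev_in_L: "P \<in> KXY \<Longrightarrow> ev P \<in> L"
  using const_in_L x_in_L y_in_L L.subring_set_axioms by (intro ev_in_ring) auto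

lemma L_cases:
  assumes "z \<in> L"
  obtains P Q where "P \<in> KXY" "Q \<in> KXY" "ev Q \<noteq> 0" "z = ev P / ev Q"
proof -
  define F where "F = {ev P / ev Q | P Q. P \<in> KXY \<and> Q \<in> KXY \<and> ev Q \<noteq> 0}"
  have FI: "ev P / ev Q \<in> F" if "P \<in> KXY" "Q \<in> KXY" "ev Q \<noteq> 0" for P Q
    using that by (auto simp: F_def)
  have FI1: "ev P \<in> F" if "P \<in> KXY" for P
    using FI[OF that KXY.one_mem] by simp
  have "subfield_set F"
  proof
    show "1 \<in> F" using FI1[OF KXY.one_mem] by simp
    fix a assume a: "a \<in> F"
    then obtain P Q where PQ: "P \<in> KXY" "Q \<in> KXY" "ev Q \<noteq> 0" "a = ev P / ev Q"
      by (auto simp: F_def)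
    show "inverse a \<in> F"
    proof (cases "ev P = 0")
      case True thus ?thesis using PQ a by simp
    next
      case False thus ?thesis using FI[of Q P] PQ by simp
    qed
    fix b assume "b \<in> F"
    then obtain R S where RS: "R \<in> KXY" "S \<in> KXY" "ev S \<noteq> 0" "b = ev R / ev S"
      by (auto simp: F_def)
    have "a - b = ev (P * S - R * Q) / ev (Q * S)" "a * b = ev (P * R) / ev (Q * S)"
      unfolding PQ(4) RS(4) using PQ(3) RS(3) by (simp_all add: diff_divide_distrib)
    moreover have "ev (Q * S) \<noteq> 0" using PQ RS by simp
    ultimately show "a - b \<in> F" "a * b \<in> F"
      using PQ RS by (auto intro!: FI KXY.diff_mem KXY.mult_mem simp del: ev_mult ev_diff)
  qed
  moreover have "const c \<in> F" if "c \<in> K" for c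
    using FI1[OF lift_over[OF const_over[OF that]]] by (simp add: const_def)
  moreover have "x \<in> F"
    using FI1[OF lift_over[OF linear_over[OF K.zero_mem]]] by (simp add: x_def)
  moreover have "y \<in> F"
    using FI1[of "[:0, 1:]"]
    by (simp add: ev_pCons KX.pCons_in_polys_in_iff KX.zero_mem KX.one_mem KXY.zero_mem)
  ultimately have "L \<subseteq> F"
    unfolding L_def AS_field_def x_def y_def by (intro generate_field_least) auto
  thus ?thesis using that assms by (auto simp: F_def)
qed

text \<open>Division by \<open>\<Phi>\<close>, which is monic of degree \<open>p\<close> in
  \<open>Y\<close>. It reaches the range \<open>degree P' < p\<close> in which the monomials have
  distinct pole orders.\<close>

lemma reduction:
  assumes "P \<in> KXY"
  obtains P' Q where "P' \<in> KXY" "degree P' < p" "P = P' + \<Phi> * Q"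
proof -
  have cp: "coeff \<Phi> p = 1"
    using p_ge_2 by (auto simp: \<Phi>_def coeff_pCons split: nat.splits)
  have cn: "coeff \<Phi> n = 0" if "n > p" for n
    using p_ge_2 that by (auto simp: \<Phi>_def coeff_pCons split: nat.splits)
  have "\<exists>P' Q. P' \<in> KXY \<and> degree P' < p \<and> P = P' + \<Phi> * Q"
    using assms
  proof (induction P)
    case 0
    show ?case using p_ge_2 KXY.zero_mem by (intro exI[of _ 0]) auto
  next
    case (pCons a P)
    hence a: "a \<in> KX" "P \<in> KXY" by (simp_all add: KX.pCons_in_polys_in_iff)
    then obtain P' Q where P: "P' \<in> KXY" "degree P' < p" "P = P' + \<Phi> * Q" using pCons by blast
    define c where "c = coeff (pCons a P') p"
    define R where "R = pCons a P' - smult c \<Phi>"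
    have aP: "pCons a P' \<in> KXY" using a P by (simp add: KX.pCons_in_polys_in_iff)
    hence "c \<in> KX" by (simp add: c_def polys_in_def)
    hence "R \<in> KXY" unfolding R_def by (intro KXY.diff_mem KX.smult_in_polys_in \<Phi>_over aP)
    moreover have "degree R < p"
    proof -
      have "degree R \<le> p - 1"
      proof (rule degree_le, safe)
        fix i assume "p - 1 < i"
        hence "i = p \<or> i > p" by linarith
        moreover have "coeff (pCons a P') i = 0" if "i > p"
          using that P(2) by (auto simp: coeff_pCons coeff_eq_0 split: nat.splits)
        ultimately show "coeff R i = 0" by (auto simp: R_def c_def cp cn)
      qed
      thus ?thesis using p_ge_2 by linarith
    qed
    moreover have "pCons a P = R + \<Phi> * (pCons 0 Q + [:c:])"
      using arg_cong[OF P(3), of "pCons 0"] by (simp add: R_def algebra_simps)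
    ultimately show ?case by blast
  qed
  thus ?thesis using that by blast
qed

end

context AS_curve
begin

text \<open>At infinity \<open>x\<^sup>i y\<^sup>j\<close> has pole order \<open>p i + (p m + 1) j\<close>. For \<open>j < p\<close> these numbers are
  distinct, so \<open>wt P\<close> is the valuation of \<open>ev P\<close> if the degree of \<open>P\<close> in \<open>Y\<close> is less than \<open>p\<close>.\<close>

definition wt :: "'a poly poly \<Rightarrow> int" where
  "wt P = Min ((\<lambda>j. - int (p * degree (coeff P j) + (p * m + 1) * j)) ` {j. coeff P j \<noteq> 0})"

text \<open>Modulo \<open>p\<close> the number is \<open>j\<close>; this determines \<open>j\<close>
  below \<open>p\<close>, and then the degree.\<close>

lemma wt_inj:
  assumes "j < p" "k < p" "p * d + (p * m + 1) * j = p * e + (p * m + 1) * k"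
  shows "j = k" "d = e"
proof -
  have "(p * (d + m * j) + j) mod p = (p * (e + m * k) + k) mod p"
    using assms(3) by (simp add: algebra_simps)
  thus "j = k" using assms(1,2) by (metis mod_less mod_mult_self4)
  thus "d = e" using assms p_ge_2 by simp
qed

lemma wt_le: "coeff P j \<noteq> 0 \<Longrightarrow> wt P \<le> - int (p * degree (coeff P j) + (p * m + 1) * j)"
  unfolding wt_def by (intro Min_le) (auto simp: MOST_coeff_eq_0[unfolded eventually_cofinite])

lemma wt_attained:
  assumes "P \<noteq> 0"
  obtains j where "coeff P j \<noteq> 0" "wt P = - int (p * degree (coeff P j) + (p * m + 1) * j)"
proof -
  have "{j. coeff P j \<noteq> 0} \<noteq> {}" using assms leading_coeff_neq_0 by blast
  hence "wt P \<in> (\<lambda>j. - int (p * degree (coeff P j) + (p * m + 1) * j)) ` {j. coeff P j \<noteq> 0}"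
    unfolding wt_def by (intro Min_in) (auto simp: MOST_coeff_eq_0[unfolded eventually_cofinite])
  thus ?thesis using that by auto
qed

end

context AS_curve_over
begin

lemma const_unit:
  assumes "val_ring L V" "const ` K \<subseteq> V" "c \<in> K" "c \<noteq> 0"
  shows "const c \<in> V - max_ideal V"
  using assms K.inverse_mem[of c] by (auto simp: max_ideal_def simp flip: const_inverse)

text \<open>If \<open>y\<close> has a pole, then \<open>1 - inverse y ^ (p - 1)\<close> is a unit,
  and it is the quotient of \<open>y ^ p - y\<close> by \<open>y ^ p\<close>.\<close>

lemma y_power_unit:
  assumes "val_ring L V" "y \<notin> V"
  obtains w where "w \<in> V - max_ideal V" "y ^ p * w = of_poly f"
proof -
  interpret V: val_ring L V by fact
  have y0: "y \<noteq> 0" "inverse y \<in> max_ideal V" using V.notin_V_iff[OF y_in_L] assms(2) by auto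
  have pe: "p = Suc (Suc (p - 2))" using p_ge_2 by simp
  have "inverse y * inverse y ^ (p - 2) \<in> max_ideal V"
    using y0 V.max_ideal_sub by (intro V.max_ideal_mult V.V.power_mem) auto
  hence "1 + - (inverse y * inverse y ^ (p - 2)) \<in> V - max_ideal V"
    by (intro V.unit_add V.unit_one V.max_ideal_uminus)
  hence w: "1 - inverse y ^ (p - 1) \<in> V - max_ideal V" (is "?w \<in> _")
    by (subst pe) simp
  have "y ^ p * inverse y ^ (p - 1) = y"
    using y0 by (subst (1) pe, subst pe) (simp add: field_simps)
  hence "y ^ p * ?w = of_poly f"
    using AS_eq by (simp add: algebra_simps)
  thus ?thesis using that w by blast
qed

lemma y_integral:
  assumes "val_ring L V" "of_poly f \<in> V"
  shows "y \<in> V"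
proof (rule ccontr)
  interpret V: val_ring L V by fact
  assume y: "y \<notin> V"
  then obtain w where w: "w \<in> V - max_ideal V" "y ^ p * w = of_poly f"
    using y_power_unit[OF assms(1)] by blast
  have "y ^ p = of_poly f * inverse w"
    using w V.unit_iff[of w] by (simp add: field_simps)
  also have "\<dots> \<in> V" using V.unit_inverse[OF w(1)] assms(2) by (intro V.V.mult_mem) auto
  finally show False using V.power_in_V_iff[OF y_in_L, of p] y p_ge_2 by simp
qed

end

section \<open>The place at infinity\<close>

locale AS_infinity = AS_curve_over p m f K + V: val_ring L V
  for p m and f :: "'a::alg_closed_field poly" and K V +
  assumes const_V: "const ` K \<subseteq> V" and x_notin_V: "x \<notin> V"
begin

abbreviation "\<mm> \<equiv> max_ideal V"

definition t :: "'a ffield" where "t = x ^ m / y"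

lemma x_nonzero: "x \<noteq> 0" and inverse_x: "inverse x \<in> \<mm>"
  using V.notin_V_iff[OF x_in_L] x_notin_V by auto

text \<open>After division by \<open>x ^ degree G\<close> only the leading coefficient survives
  modulo the non-unit \<open>inverse x\<close>.\<close>

lemma of_poly_leading_term:
  assumes "G \<in> KX" "G \<noteq> 0"
  obtains u where "u \<in> V - \<mm>" "of_poly G = x ^ degree G * u"
proof -
  have "\<exists>u \<in> V - \<mm>. of_poly G = x ^ degree G * u"
    using assms
  proof (induction G)
    case (pCons a G)
    hence a: "a \<in> K" "G \<in> KX" by (simp_all add: K.pCons_in_polys_in_iff)
    show ?case
    proof (cases "G = 0")
      case True
      hence "a \<noteq> 0" using pCons by simp
      thus ?thesis
        using True const_unit[OF V.val_ring_axioms const_V] a by (intro bexI[of _ "const a"]) (auto simp: const_def)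
    next
      case False
      then obtain u where u: "u \<in> V - \<mm>" "of_poly G = x ^ degree G * u" using pCons a by blast
      have "inverse x * (inverse x ^ degree G * const a) \<in> \<mm>"
        using a const_V inverse_x V.max_ideal_sub
        by (intro V.max_ideal_mult V.V.mult_mem V.V.power_mem) auto
      hence "u + inverse x * (inverse x ^ degree G * const a) \<in> V - \<mm>"
        by (rule V.unit_add[OF u(1)])
      moreover have "of_poly (pCons a G) =
        x ^ degree (pCons a G) * (u + inverse x * (inverse x ^ degree G * const a))"
        using False x_nonzero of_poly_pCons[of a G, folded x_def] u(2)
        by (simp add: field_simps)
      ultimately show ?thesis by blast
    qed
  qed simp
  thus ?thesis using that by blast
qed

lemma y_power:
  obtains u where "u \<in> V - \<mm>" "y ^ p = x ^ (p * m + 1) * u"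
proof -
  obtain u where u: "u \<in> V - \<mm>" "of_poly f = x ^ (p * m + 1) * u"
    using of_poly_leading_term[OF f_over f_nonzero] degree_f by metis
  have y: "y \<notin> V"
  proof
    assume "y \<in> V"
    hence "of_poly f \<in> V" unfolding AS_eq[symmetric] by (intro V.V.diff_mem V.V.power_mem)
    hence "of_poly f * inverse u \<in> V" using V.unit_inverse[OF u(1)] by (intro V.V.mult_mem) auto
    moreover have "of_poly f * inverse u = x ^ (p * m + 1)" using u V.unit_iff[of u] by simp
    ultimately have "x ^ (p * m + 1) \<in> V" by (simp only:)
    thus False using V.power_in_V_iff[OF x_in_L, of "p * m + 1"] x_notin_V by simp
  qed
  then obtain w where w: "w \<in> V - \<mm>" "y ^ p * w = of_poly f"
    using y_power_unit[OF V.val_ring_axioms] by blast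
  have "y ^ p = x ^ (p * m + 1) * (u * inverse w)"
    using u w V.unit_iff[of w] by (simp add: field_simps)
  thus ?thesis using that V.unit_mult[OF u(1) V.unit_inverse[OF w(1)]] by blast
qed

text \<open>Since \<open>y ^ p\<close> is \<open>x ^ (p * m + 1)\<close> times a unit
  \<open>u\<close>, the power \<open>t ^ p\<close> equals \<open>inverse x * inverse u\<close>.
  Hence \<open>t\<close> is a non-unit, and \<open>x\<close> has valuation \<open>- p\<close> with
  respect to it.\<close>

lemma t_in_max_ideal: "t \<in> \<mm>" and t_nonzero: "t \<noteq> 0" and y_nonzero: "y \<noteq> 0"
  and has_val_x: "V.has_val t x (- int p)"
proof -
  obtain u where u: "u \<in> V - \<mm>" "y ^ p = x ^ (p * m + 1) * u" by (rule y_power)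
  have u0: "u \<noteq> 0" using u(1) V.unit_iff by blast
  have y0: "y \<noteq> 0"
  proof
    assume "y = 0"
    hence "x ^ (p * m + 1) * u = 0" using u(2) p_ge_2 by (simp add: power_0_left)
    thus False using u0 x_nonzero by simp
  qed
  thus "y \<noteq> 0" .
  show t0: "t \<noteq> 0" using y0 x_nonzero by (simp add: t_def)
  have "t ^ p * y ^ p = (x ^ m) ^ p" using y0 by (simp add: t_def power_divide)
  hence tp: "t ^ p = inverse x * inverse u"
    unfolding u(2) using x_nonzero u0
    by (simp add: field_simps power_mult[symmetric] mult.commute[of p m])
  have "t \<in> L" unfolding t_def by (intro L.divide_mem L.power_mem x_in_L y_in_L)
  have m: "t ^ p \<in> \<mm>"
    unfolding tp using V.unit_inverse[OF u(1)] inverse_x by (intro V.max_ideal_mult) auto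
  hence "t \<in> V" using V.power_in_V_iff[OF \<open>t \<in> L\<close>, of p] V.max_ideal_sub[OF m] p_ge_2 by simp
  thus "t \<in> \<mm>" using V.unit_power[of t p] m by auto
  have "x = t powi (- int p) * inverse u"
    using tp t0 u0 x_nonzero by (simp add: power_int_minus field_simps)
  thus "V.has_val t x (- int p)" unfolding V.has_val_def using V.unit_inverse[OF u(1)] by blast
qed

lemmas has_val_facts =
  V.has_val_mult[OF t_in_max_ideal t_nonzero] V.has_val_divide[OF t_in_max_ideal t_nonzero]
  V.has_val_power[OF t_in_max_ideal t_nonzero] V.has_val_unit[OF t_in_max_ideal t_nonzero]

lemma has_val_y: "V.has_val t y (- int (p * m + 1))"
proof -
  have "V.has_val t (x ^ m / t) (int m * - int p - 1)"
    by (intro has_val_facts has_val_x V.has_val_self t_in_max_ideal t_nonzero)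
  moreover have "x ^ m / t = y" using x_nonzero y_nonzero by (simp add: t_def)
  moreover have "int m * - int p - 1 = - int (p * m + 1)" by simp
  ultimately show ?thesis by (simp only:)
qed

lemma has_val_of_poly:
  assumes "G \<in> KX" "G \<noteq> 0"
  shows "V.has_val t (of_poly G) (- int (p * degree G))"
proof -
  obtain u where u: "u \<in> V - \<mm>" "of_poly G = x ^ degree G * u"
    using of_poly_leading_term assms by blast
  have "V.has_val t (of_poly G) (int (degree G) * - int p + 0)"
    unfolding u(2) by (intro has_val_facts has_val_x u(1))
  thus ?thesis by (simp add: algebra_simps)
qed

lemma has_val_ev:
  assumes "P \<in> KXY" "degree P < p" "P \<noteq> 0"
  shows "V.has_val t (ev P) (wt P)"
  unfolding ev_sum wt_def
proof (rule V.has_val_sum[OF t_in_max_ideal t_nonzero])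
  show "finite {j. coeff P j \<noteq> 0}" by (simp add: MOST_coeff_eq_0[unfolded eventually_cofinite])
  show "{j. coeff P j \<noteq> 0} \<noteq> {}" using assms(3) leading_coeff_neq_0 by blast
  show "V.has_val t (of_poly (coeff P j) * y ^ j) (- int (p * degree (coeff P j) + (p * m + 1) * j))"
    if "j \<in> {j. coeff P j \<noteq> 0}" for j
  proof -
    have "V.has_val t (of_poly (coeff P j) * y ^ j)
            (- int (p * degree (coeff P j)) + int j * - int (p * m + 1))"
      using that assms(1)
      by (intro has_val_facts has_val_of_poly has_val_y) (auto simp: polys_in_def)
    thus ?thesis by (simp add: algebra_simps)
  qed
  show "inj_on (\<lambda>j. - int (p * degree (coeff P j) + (p * m + 1) * j)) {j. coeff P j \<noteq> 0}"
  proof (rule inj_onI)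
    fix j k assume jk: "j \<in> {j. coeff P j \<noteq> 0}" "k \<in> {j. coeff P j \<noteq> 0}"
      and eq: "- int (p * degree (coeff P j) + (p * m + 1) * j)
                 = - int (p * degree (coeff P k) + (p * m + 1) * k)"
    have "j < p" "k < p" using jk assms(2) by (auto dest: le_degree)
    thus "j = k" using wt_inj(1)[of j k] eq by (metis neg_equal_iff_equal of_nat_eq_iff)
  qed
qed

lemma ev_nonzero: "P \<in> KXY \<Longrightarrow> degree P < p \<Longrightarrow> P \<noteq> 0 \<Longrightarrow> ev P \<noteq> 0"
  using has_val_ev V.has_val_nonzero t_in_max_ideal t_nonzero by blast

lemma reduced_cases:
  assumes "z \<in> L"
  obtains P Q where "P \<in> KXY" "Q \<in> KXY" "degree P < p" "degree Q < p" "Q \<noteq> 0"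
    "z \<noteq> 0 \<Longrightarrow> P \<noteq> 0" "z = ev P / ev Q" "ev Q \<noteq> 0"
proof -
  obtain P Q where PQ: "P \<in> KXY" "Q \<in> KXY" "ev Q \<noteq> 0" "z = ev P / ev Q"
    using L_cases[OF assms] .
  obtain P' P'' where P': "P' \<in> KXY" "degree P' < p" "P = P' + \<Phi> * P''" using reduction[OF PQ(1)] .
  obtain Q' Q'' where Q': "Q' \<in> KXY" "degree Q' < p" "Q = Q' + \<Phi> * Q''" using reduction[OF PQ(2)] .
  have "ev P = ev P'" "ev Q = ev Q'" using P'(3) Q'(3) by (simp_all add: ev_\<Phi>)
  thus ?thesis using that[of P' Q'] PQ P' Q' by force
qed

text \<open>The value \<open>wt P - wt Q\<close> does not involve \<open>V\<close>. This later
  forces any two places at infinity to coincide.\<close>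

lemma has_val_L:
  assumes "z \<in> L" "z \<noteq> 0"
  obtains P Q where "P \<in> KXY" "Q \<in> KXY" "degree P < p" "degree Q < p" "P \<noteq> 0" "Q \<noteq> 0"
    "z = ev P / ev Q" "V.has_val t z (wt P - wt Q)"
proof -
  obtain P Q where *: "P \<in> KXY" "Q \<in> KXY" "degree P < p" "degree Q < p" "Q \<noteq> 0" "P \<noteq> 0" "z = ev P / ev Q"
    using reduced_cases[OF assms(1)] assms(2) by metis
  have "V.has_val t z (wt P - wt Q)"
    unfolding *(7) by (intro has_val_facts has_val_ev *)
  thus ?thesis using that * by blast
qed

lemma max_ideal_eq: "\<mm> = (\<lambda>z. t * z) ` V"
  using V.sub has_val_L
  by (intro V.max_ideal_generator t_in_max_ideal t_nonzero) (metis subsetD)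

lemma place_val_infinity:
  assumes "V.has_val t z n"
  shows "place_val V z = n"
  by (rule V.place_val_eq[OF t_in_max_ideal t_nonzero max_ideal_eq assms])

text \<open>For a unit \<open>ev P / ev Q\<close> the weights of \<open>P\<close> and
  \<open>Q\<close> agree, so by \<open>wt_inj\<close> both have the same dominant monomial.
  Subtracting the ratio \<open>c\<close> of its coefficients raises the weight of the
  numerator.\<close>

lemma residue:
  assumes "z \<in> V"
  shows "\<exists>c\<in>K. z - const c \<in> \<mm>"
proof (cases "z \<in> \<mm>")
  case True
  thus ?thesis using K.zero_mem by (intro bexI[of _ 0]) auto
next
  case False
  hence z0: "z \<noteq> 0" using V.zero_in_max_ideal by auto
  obtain P Q where PQ: "P \<in> KXY" "Q \<in> KXY" "degree P < p" "degree Q < p" "P \<noteq> 0" "Q \<noteq> 0"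
    "z = ev P / ev Q" "V.has_val t z (wt P - wt Q)"
    using has_val_L[of z] assms V.sub z0 by blast
  have evQ: "ev Q \<noteq> 0" using ev_nonzero PQ by blast
  have "wt P - wt Q = 0"
    using V.has_val_unique[OF t_in_max_ideal t_nonzero PQ(8)]
      V.has_val_unit[OF t_in_max_ideal t_nonzero, of z] assms False by simp
  hence eq: "wt P = wt Q" by simp
  obtain j where j: "coeff P j \<noteq> 0" "wt P = - int (p * degree (coeff P j) + (p * m + 1) * j)"
    using wt_attained[OF PQ(5)] .
  obtain k where k: "coeff Q k \<noteq> 0" "wt Q = - int (p * degree (coeff Q k) + (p * m + 1) * k)"
    using wt_attained[OF PQ(6)] .
  have lt: "j < p" "k < p" using j k PQ by (auto dest: le_degree)
  have "p * degree (coeff P j) + (p * m + 1) * j = p * degree (coeff Q k) + (p * m + 1) * k"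
    using j k eq by linarith
  from wt_inj[OF lt this] have jk: "k = j" "degree (coeff Q j) = degree (coeff P j)" by simp_all
  define c where "c = lead_coeff (coeff P j) / lead_coeff (coeff Q j)"
  have cK: "c \<in> K"
    unfolding c_def using PQ by (intro K.divide_mem) (auto simp: polys_in_def)
  define R where "R = P - smult [:c:] Q"
  have R: "R \<in> KXY"
    unfolding R_def by (intro KXY.diff_mem KX.smult_in_polys_in PQ const_over cK)
  have dR: "degree R < p"
    unfolding R_def using PQ by (intro degree_diff_less) (auto intro: le_less_trans[OF degree_smult_le])
  have zc: "z - const c = ev R / ev Q"
    unfolding R_def PQ(7) const_def using evQ by (simp add: field_simps)
  have "z - const c \<in> \<mm>"
  proof (cases "R = 0")
    case True thus ?thesis using zc V.zero_in_max_ideal by simp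
  next
    case False
    obtain l where l: "coeff R l \<noteq> 0" "wt R = - int (p * degree (coeff R l) + (p * m + 1) * l)"
      using wt_attained[OF False] .
    have lp: "l < p" using l dR by (auto dest: le_degree)
    have Rl: "coeff R l = coeff P l - smult c (coeff Q l)" by (simp add: R_def)
    \<comment> \<open>If the dominant term of \<open>R\<close> has the old exponent \<open>j\<close>
      of \<open>Y\<close>, its coefficient has lost its leading term. For any other exponent
      \<open>wt_inj\<close> excludes a tie with the dominant monomial of \<open>P\<close> and
      \<open>Q\<close>.\<close>
    have "wt R > wt Q"
    proof (cases "l = j")
      case True
      have "degree (coeff R j) < degree (coeff P j)"
      proof (rule ccontr)
        assume nl: "\<not> ?thesis"
        have "degree (coeff R j) \<le> degree (coeff P j)"
          unfolding Rl[unfolded True] using jk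
          by (intro degree_diff_le) (auto intro: order.trans[OF degree_smult_le])
        hence "degree (coeff R j) = degree (coeff P j)" using nl by simp
        hence "lead_coeff (coeff R j) = lead_coeff (coeff P j) - c * lead_coeff (coeff Q j)"
          using Rl[unfolded True] jk by simp
        also have "\<dots> = 0" using k(1) jk(1) by (simp add: c_def del: leading_coeff_0_iff)
            (metis leading_coeff_0_iff)
        finally show False using l True by simp
      qed
      thus ?thesis using l j eq True p_ge_2 by simp
    next
      case False
      have "p * degree (coeff R l) + (p * m + 1) * l < p * degree (coeff P j) + (p * m + 1) * j"
      proof -
        have b: "p * degree (coeff S l) + (p * m + 1) * l < p * degree (coeff P j) + (p * m + 1) * j"
          if S: "coeff S l \<noteq> 0" "wt S = wt P" for S
        proof -
          have "p * degree (coeff S l) + (p * m + 1) * l \<le> p * degree (coeff P j) + (p * m + 1) * j"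
            using wt_le[OF S(1)] S(2) j by linarith
          moreover have "p * degree (coeff S l) + (p * m + 1) * l \<noteq> p * degree (coeff P j) + (p * m + 1) * j"
            using wt_inj(1)[OF lp lt(1)] False by blast
          ultimately show ?thesis by simp
        qed
        consider "degree (coeff R l) \<le> degree (coeff P l)" "coeff P l \<noteq> 0"
          | "degree (coeff R l) \<le> degree (coeff Q l)" "coeff Q l \<noteq> 0"
        proof -
          have "degree (coeff R l) \<le> max (degree (coeff P l)) (degree (coeff Q l))"
            unfolding Rl by (intro degree_diff_le_max[THEN order.trans] max.mono order.refl degree_smult_le)
          moreover have "coeff P l \<noteq> 0 \<or> coeff Q l \<noteq> 0" using l(1) Rl by auto
          ultimately show ?thesis using that by (cases "coeff P l = 0"; cases "coeff Q l = 0")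
              (auto simp: max_def split: if_splits)
        qed
        thus ?thesis
        proof cases
          case 1
          have "p * degree (coeff R l) \<le> p * degree (coeff P l)" using 1 by simp
          thus ?thesis using b[OF 1(2)] by linarith
        next
          case 2
          have "p * degree (coeff R l) \<le> p * degree (coeff Q l)" using 2 by simp
          thus ?thesis using b[OF 2(2)] eq by linarith
        qed
      qed
      thus ?thesis using l(2) j(2) eq by linarith
    qed
    moreover have "V.has_val t (z - const c) (wt R - wt Q)"
      unfolding zc by (intro has_val_facts has_val_ev R dR False PQ)
    ultimately show ?thesis using V.has_val_pos_iff[OF t_in_max_ideal t_nonzero] by simp
  qed
  thus ?thesis using cK by blast
qed

end

context AS_curve_over
begin

text \<open>The ring \<open>A\<close> consists of the polynomials in \<open>inverse x\<close>. It
  does not contain \<open>x\<close>, since \<open>x ^ (d + 1)\<close> is not a polynomial in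
  \<open>x\<close> of degree at most \<open>d\<close>; so \<open>exists_val_ring\<close> applies
  with \<open>inverse x\<close> in the place of \<open>u\<close>.\<close>

lemma exists_infinity: "\<exists>V. AS_infinity p m f K V"
proof -
  have x0: "x \<noteq> 0" by (simp add: x_def)
  have x_pow: "x ^ n = of_poly (monom 1 n)" for n
    by (simp add: x_def monom_altdef)
  have x_pow_in: "monom 1 n \<in> KX" for n by (intro K.monom_in_polys_in K.one_mem)
  define A where "A = {of_poly G / x ^ d | G d. G \<in> KX \<and> degree G \<le> d}"
  have AI: "of_poly G / x ^ d \<in> A" if "G \<in> KX" "degree G \<le> d" for G d
    using that by (auto simp: A_def)
  have "subring_set A"
  proof
    show "1 \<in> A" using AI[OF KX.one_mem, of 0] by simp
    fix a b assume "a \<in> A" "b \<in> A"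
    then obtain G d H e where *: "G \<in> KX" "degree G \<le> d" "a = of_poly G / x ^ d"
      "H \<in> KX" "degree H \<le> e" "b = of_poly H / x ^ e" by (auto simp: A_def)
    have "a - b = of_poly (G * monom 1 e - H * monom 1 d) / x ^ (d + e)"
      unfolding *(3,6) using x0 by (simp add: x_pow[symmetric] power_add diff_divide_distrib)
    moreover have "degree (G * monom 1 e) \<le> d + e" "degree (H * monom 1 d) \<le> d + e"
      using *(2,5) degree_mult_le[of G "monom 1 e"] degree_mult_le[of H "monom 1 d"]
        degree_monom_le[of "1::'a" e] degree_monom_le[of "1::'a" d] by linarith+
    hence "degree (G * monom 1 e - H * monom 1 d) \<le> d + e" by (intro degree_diff_le)
    ultimately show "a - b \<in> A"
      by (auto intro!: AI KX.diff_mem KX.mult_mem x_pow_in * simp del: of_poly_simps)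
    have "a * b = of_poly (G * H) / x ^ (d + e)"
      unfolding *(3,6) by (simp add: power_add)
    thus "a * b \<in> A"
      using * by (auto intro!: AI KX.mult_mem order.trans[OF degree_mult_le] simp del: of_poly_simps)
  qed
  moreover have "A \<subseteq> L"
    unfolding A_def using of_poly_in_ring[OF L.subring_set_axioms _ x_in_L] const_in_L
    by (auto intro!: L.divide_mem L.power_mem x_in_L)
  moreover have "inverse x \<in> A"
    using AI[OF KX.one_mem, of 1] by (simp add: inverse_eq_divide)
  moreover have "inverse (inverse x) \<notin> A"
  proof
    assume "inverse (inverse x) \<in> A"
    then obtain G d where G: "degree G \<le> d" "x = of_poly G / x ^ d" by (auto simp: A_def)
    have "x ^ Suc d = of_poly G / x ^ d * x ^ d" using G(2) by simp
    also have "\<dots> = of_poly G" using x0 by simp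
    finally have "monom 1 (Suc d) = G" unfolding x_pow by simp
    thus False using G(1) by (auto simp: degree_monom_eq)
  qed
  ultimately obtain V where V: "val_ring L V" "A \<subseteq> V" "inverse (inverse x) \<notin> V"
    using exists_val_ring[OF L.subfield_set_axioms] by metis
  have "const ` K \<subseteq> A"
  proof
    fix z assume "z \<in> const ` K"
    then obtain c where c: "c \<in> K" "z = const c" by blast
    have "of_poly [:c:] / x ^ 0 \<in> A" using const_over[OF c(1)] by (intro AI) auto
    thus "z \<in> A" by (simp add: c const_def)
  qed
  hence "AS_infinity p m f K V"
    using V AS_curve_over_axioms by (auto simp: AS_infinity_def AS_infinity_axioms_def)
  thus ?thesis by blast
qed

lemma infinity_unique:
  assumes "AS_infinity p m f K V" "AS_infinity p m f K W"
  shows "V = W"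
proof -
  have "V \<subseteq> W" if "AS_infinity p m f K V" "AS_infinity p m f K W" for V W
  proof
    interpret V: AS_infinity p m f K V by fact
    interpret W: AS_infinity p m f K W by fact
    fix z assume z: "z \<in> V"
    show "z \<in> W"
    proof (cases "z = 0")
      case False
      obtain P Q where PQ: "P \<in> KXY" "Q \<in> KXY" "degree P < p" "degree Q < p" "P \<noteq> 0" "Q \<noteq> 0"
        "z = ev P / ev Q" "V.V.has_val V.t z (wt P - wt Q)"
        using V.has_val_L[of z] z V.V.sub False by blast
      have "W.V.has_val W.t z (wt P - wt Q)"
        unfolding PQ(7) by (intro W.has_val_facts W.has_val_ev PQ)
      thus ?thesis
        using V.V.has_val_nonneg_iff[OF V.t_in_max_ideal V.t_nonzero PQ(8)]
          W.V.has_val_nonneg_iff[OF W.t_in_max_ideal W.t_nonzero] z by blast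
    qed (simp add: W.V.V.zero_mem)
  qed
  thus ?thesis using assms by blast
qed

definition infinity :: "'a ffield set" where
  "infinity = (THE V. AS_infinity p m f K V)"

sublocale infinity: AS_infinity p m f K infinity
  unfolding infinity_def using exists_infinity infinity_unique by (metis theI)

lemma infinity_eqI: "val_ring L V \<Longrightarrow> const ` K \<subseteq> V \<Longrightarrow> x \<notin> V \<Longrightarrow> V = infinity"
  using AS_curve_over_axioms
  by (intro infinity_unique infinity.AS_infinity_axioms)
     (auto simp: AS_infinity_def AS_infinity_axioms_def)

lemma infinity_place: "infinity \<in> rational_places (const ` K) L"
  using infinity.residue infinity.V.val_ring_axioms infinity.const_V infinity.x_notin_V x_in_L
  by (auto simp: rational_places_def places_iff[OF L.subfield_set_axioms])

end

lemma (in AS_curve) AS_curve_over_UNIV: "AS_curve_over p m f UNIV"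
  by unfold_locales (auto simp: polys_in_def)

lemma (in AS_curve) ev_linear: "ev [:- [:b:], 1:] = y - const b"
proof -
  have "of_poly (- [:b:]) = - const b" by (simp only: const_def of_poly_simps)
  thus ?thesis by (simp add: ev_pCons)
qed

text \<open>Makes values at a point well defined on functions. The remainder of \<open>P\<close>
  modulo \<open>\<Phi>\<close> has degree below \<open>p\<close> and evaluates to zero, so it is
  zero by its valuation at infinity; what is left is a multiple of \<open>\<Phi>\<close>, which
  vanishes at the point.\<close>

lemma (in AS_curve) ev_eq_0_imp:
  assumes "ev P = 0" "\<beta> ^ p - \<beta> = poly f \<alpha>"
  shows "ev_at \<alpha> \<beta> P = 0"
proof -
  interpret U: AS_curve_over p m f UNIV by (rule AS_curve_over_UNIV)
  have "P \<in> U.KXY" by (simp add: polys_in_def)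
  then obtain P' Q where P': "P' \<in> U.KXY" "degree P' < p" "P = P' + \<Phi> * Q" using U.reduction by blast
  have "ev P' = 0" using assms P' by (simp add: ev_\<Phi>)
  hence "P' = 0" using U.infinity.ev_nonzero P' by blast
  thus ?thesis using P' assms by (simp add: ev_at_\<Phi>)
qed

section \<open>The places at the affine points\<close>

locale AS_point = AS_curve_over p m f K
  for p m and f :: "'a::alg_closed_field poly" and K +
  fixes \<alpha> \<beta> :: 'a
  assumes \<alpha>_over: "\<alpha> \<in> K" and \<beta>_over: "\<beta> \<in> K" and point: "\<beta> ^ p - \<beta> = poly f \<alpha>"
begin

abbreviation "pt \<equiv> ev_at \<alpha> \<beta>"

definition s :: "'a ffield" where "s = x - const \<alpha>"

definition \<O> :: "'a ffield set" where
  "\<O> = {ev P / ev Q | P Q. P \<in> KXY \<and> Q \<in> KXY \<and> pt Q \<noteq> 0}"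

lemma at_in_K: "P \<in> KXY \<Longrightarrow> pt P \<in> K"
  unfolding ev_at_def by (intro K.poly_mem KX.poly_mem const_over \<alpha>_over \<beta>_over)

lemma ev_nonzero: "pt P \<noteq> 0 \<Longrightarrow> ev P \<noteq> 0"
  using ev_eq_0_imp point by blast

lemma s_eq: "s = ev [:[:- \<alpha>, 1:]:]"
  by (simp add: s_def x_def of_poly_linear)

lemma s_over: "[:[:- \<alpha>, 1:]:] \<in> KXY"
  by (intro lift_over linear_over K.uminus_mem \<alpha>_over)

lemma s_nonzero: "s \<noteq> 0"
  by (simp add: s_eq)

lemma s_in_L: "s \<in> L"
  unfolding s_eq using s_over by (rule ev_in_L)

lemma point_division:
  assumes "P \<in> KXY"
  obtains P1 r where "P1 \<in> KXY" "r \<in> KX" "P = [:- [:\<beta>:], 1:] * P1 + [:[:- \<alpha>, 1:] * r + [:pt P:]:]"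
proof -
  obtain P1 where P1: "P1 \<in> KXY" "P = [:- [:\<beta>:], 1:] * P1 + [:poly P [:\<beta>:]:]"
    using KX.division_by_linear[OF assms const_over[OF \<beta>_over]] .
  have "poly P [:\<beta>:] \<in> KX" by (intro KX.poly_mem assms const_over \<beta>_over)
  then obtain r where "r \<in> KX" "poly P [:\<beta>:] = [:- \<alpha>, 1:] * r + [:poly (poly P [:\<beta>:]) \<alpha>:]"
    using K.division_by_linear[OF _ \<alpha>_over] by blast
  thus ?thesis using that P1 by (simp add: ev_at_def)
qed

text \<open>The derivative of \<open>Y\<^sup>p - Y\<close> is \<open>-1\<close>, so \<open>x - \<alpha>\<close> is a local parameter.\<close>

lemma y_minus_\<beta>:
  obtains h H where "h \<in> KXY" "pt h \<noteq> 0" "H \<in> KX" "(y - const \<beta>) * ev h = s * of_poly H"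
proof -
  define \<Psi> where "\<Psi> = monom 1 p - monom 1 1 - [:[:poly f \<alpha>:]:]"
  have "poly f \<alpha> \<in> K" by (intro K.poly_mem f_over \<alpha>_over)
  hence "\<Psi> \<in> KXY"
    unfolding \<Psi>_def by (intro KXY.diff_mem KX.monom_in_polys_in lift_over const_over KX.one_mem)
  then obtain h where h: "h \<in> KXY" "\<Psi> = [:- [:\<beta>:], 1:] * h + [:poly \<Psi> [:\<beta>:]:]"
    using KX.division_by_linear[OF _ const_over[OF \<beta>_over]] by blast
  have pow: "[:\<beta>:] ^ n = [:\<beta> ^ n:]" for n by (simp add: poly_const_pow)
  have "poly \<Psi> [:\<beta>:] = 0"
    using point by (simp add: \<Psi>_def poly_monom pow)
  hence \<Psi>: "\<Psi> = [:- [:\<beta>:], 1:] * h" using h by simp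
  have "of_nat p = (0 :: 'a poly)" using of_nat_p by (simp add: of_nat_poly)
  hence "pderiv \<Psi> = - 1"
    by (simp add: \<Psi>_def pderiv_diff pderiv_monom monom_0 one_pCons)
  hence "poly (pderiv \<Psi>) [:\<beta>:] = - 1" by simp
  \<comment> \<open>By the product rule, at the root \<open>\<beta>\<close> the cofactor
    \<open>h\<close> takes the value of the derivative of \<open>\<Psi>\<close>.\<close>
  hence "poly h [:\<beta>:] = - 1" unfolding \<Psi> pderiv_mult by (simp add: pderiv_pCons)
  hence "pt h \<noteq> 0" by (simp add: ev_at_def)
  obtain H where H: "H \<in> KX" "f = [:- \<alpha>, 1:] * H + [:poly f \<alpha>:]"
    using K.division_by_linear[OF f_over \<alpha>_over] .
  have "(y - const \<beta>) * ev h = ev \<Psi>"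
    unfolding \<Psi> ev_mult ev_linear ..
  also have "\<dots> = of_poly f - of_poly [:poly f \<alpha>:]"
    using AS_eq by (simp add: \<Psi>_def)
  also have "\<dots> = s * of_poly H"
    by (subst H(2)) (simp add: s_eq del: mult_pCons_left)
  finally show ?thesis using that h(1) \<open>pt h \<noteq> 0\<close> H(1) by blast
qed

text \<open>The functions \<open>s\<close> and \<open>y - const \<beta>\<close> generate the ideal
  of the point, and \<open>y - const \<beta>\<close> becomes a multiple of \<open>s\<close> after
  multiplication by \<open>ev h\<close>, where \<open>h\<close> does not vanish at the
  point.\<close>

lemma divide_by_s:
  assumes "P \<in> KXY" "pt P = 0"
  obtains P' Q where "P' \<in> KXY" "Q \<in> KXY" "pt Q \<noteq> 0" "ev P * ev Q = s * ev P'"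
proof -
  obtain h H where h: "h \<in> KXY" "pt h \<noteq> 0" "H \<in> KX" "(y - const \<beta>) * ev h = s * of_poly H"
    using y_minus_\<beta> .
  obtain P1 r where P: "P1 \<in> KXY" "r \<in> KX"
    "P = [:- [:\<beta>:], 1:] * P1 + [:[:- \<alpha>, 1:] * r + [:pt P:]:]"
    using point_division[OF assms(1)] .
  have evP: "ev P = (y - const \<beta>) * ev P1 + s * of_poly r"
    by (subst P(3), unfold ev_add ev_mult ev_linear ev_const of_poly_simps(3,6))
       (simp add: assms(2) s_eq)
  have "ev P * ev h = ((y - const \<beta>) * ev h) * ev P1 + s * of_poly r * ev h"
    unfolding evP by (simp only: distrib_left distrib_right mult_ac)
  also have "\<dots> = s * ev (smult H P1 + smult r h)"
    unfolding h(4) by (simp add: algebra_simps)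
  finally show ?thesis
    using that h P by (auto intro!: KXY.add_mem KX.smult_in_polys_in simp del: ev_add ev_smult)
qed

text \<open>Division by \<open>s\<close> must stop: some multiple of \<open>ev P\<close> is a
  polynomial \<open>G\<close> in \<open>x\<close>, and one division more than the order of
  \<open>G\<close> at \<open>\<alpha>\<close> would make the cofactor \<open>G1\<close> times
  \<open>Q\<close> vanish at the point, where neither factor does.\<close>

lemma order_at_point:
  assumes "P \<in> KXY" "ev P \<noteq> 0"
  obtains n P' Q where "P' \<in> KXY" "Q \<in> KXY" "pt P' \<noteq> 0" "pt Q \<noteq> 0" "ev P * ev Q = s ^ n * ev P'"
proof (rule ccontr)
  assume no: "\<not> thesis"
  have step: "\<exists>P' Q. P' \<in> KXY \<and> Q \<in> KXY \<and> pt Q \<noteq> 0 \<and> ev P * ev Q = s ^ n * ev P'" for n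
  proof (induction n)
    case 0
    show ?case using assms KXY.one_mem by (intro exI[of _ P] exI[of _ 1]) auto
  next
    case (Suc n)
    then obtain P' Q where P': "P' \<in> KXY" "Q \<in> KXY" "pt Q \<noteq> 0" "ev P * ev Q = s ^ n * ev P'" by blast
    hence "pt P' = 0" using no that by blast
    then obtain P'' Q' where P'': "P'' \<in> KXY" "Q' \<in> KXY" "pt Q' \<noteq> 0" "ev P' * ev Q' = s * ev P''"
      using divide_by_s P' by metis
    have "ev P * ev (Q * Q') = (ev P * ev Q) * ev Q'" by simp
    also have "\<dots> = s ^ n * (ev P' * ev Q')" unfolding P'(4) by simp
    also have "\<dots> = s ^ Suc n * ev P''" unfolding P''(4) by simp
    finally have "ev P * ev (Q * Q') = s ^ Suc n * ev P''" .
    thus ?case using P' P'' KXY.mult_mem[of Q Q'] by (intro exI[of _ P''] exI[of _ "Q * Q'"]) auto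
  qed
  obtain G R where G: "G \<noteq> 0" "ev P * ev R = of_poly G" using ev_algebraic[OF assms(2)] .
  obtain G1 where G1: "G = [:- \<alpha>, 1:] ^ order \<alpha> G * G1" "\<not> [:- \<alpha>, 1:] dvd G1"
    using order_decomp[OF G(1)] by blast
  have G1': "poly G1 \<alpha> \<noteq> 0" using G1(2) poly_eq_0_iff_dvd by blast
  define n where "n = order \<alpha> G"
  obtain P' Q where P': "Q \<in> KXY" "pt Q \<noteq> 0" "ev P * ev Q = s ^ Suc n * ev P'" using step by blast
  have s: "s = of_poly [:- \<alpha>, 1:]" by (simp add: s_eq)
  have "of_poly G = s ^ n * of_poly G1"
    by (subst G1(1)) (simp add: n_def s del: mult_pCons_left)
  hence "s ^ n * (of_poly G1 * ev Q) = (ev P * ev R) * ev Q" by (simp add: G(2))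
  also have "\<dots> = (ev P * ev Q) * ev R" by simp
  also have "\<dots> = s ^ n * (s * (ev P' * ev R))" unfolding P'(3) by simp
  finally have "ev ([:G1:] * Q) = ev ([:[:- \<alpha>, 1:]:] * (P' * R))"
    using s_nonzero by (simp add: s del: mult_pCons_left)
  hence "ev ([:G1:] * Q - [:[:- \<alpha>, 1:]:] * (P' * R)) = 0" by simp
  from ev_eq_0_imp[OF this point] show False using G1' P'(2) by simp
qed

lemma L_cases_point:
  assumes "z \<in> L" "z \<noteq> 0"
  obtains n P Q where "P \<in> KXY" "Q \<in> KXY" "pt P \<noteq> 0" "pt Q \<noteq> 0" "z = s powi n * (ev P / ev Q)"
proof -
  obtain P Q where PQ: "P \<in> KXY" "Q \<in> KXY" "ev Q \<noteq> 0" "z = ev P / ev Q" using L_cases[OF assms(1)] .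
  have "ev P \<noteq> 0" using PQ assms by auto
  then obtain i P1 P2 where P: "P1 \<in> KXY" "P2 \<in> KXY" "pt P1 \<noteq> 0" "pt P2 \<noteq> 0"
    "ev P * ev P2 = s ^ i * ev P1" using order_at_point PQ(1) by metis
  obtain j Q1 Q2 where Q: "Q1 \<in> KXY" "Q2 \<in> KXY" "pt Q1 \<noteq> 0" "pt Q2 \<noteq> 0"
    "ev Q * ev Q2 = s ^ j * ev Q1" using order_at_point PQ(2,3) by metis
  have "ev P = s ^ i * ev P1 / ev P2" "ev Q = s ^ j * ev Q1 / ev Q2"
    using P Q ev_nonzero by (simp_all add: field_simps)
  hence "z = s powi (int i - int j) * (ev (P1 * Q2) / ev (P2 * Q1))"
    unfolding PQ(4) using s_nonzero by (simp add: power_int_diff mult_ac)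
  moreover have "P1 * Q2 \<in> KXY" "P2 * Q1 \<in> KXY" "pt (P1 * Q2) \<noteq> 0" "pt (P2 * Q1) \<noteq> 0"
    using P Q by (auto intro: KXY.mult_mem)
  ultimately show ?thesis using that by blast
qed

lemma \<O>I: "P \<in> KXY \<Longrightarrow> Q \<in> KXY \<Longrightarrow> pt Q \<noteq> 0 \<Longrightarrow> ev P / ev Q \<in> \<O>"
  by (auto simp: \<O>_def)

lemma \<O>I1: "P \<in> KXY \<Longrightarrow> ev P \<in> \<O>"
  using \<O>I[OF _ KXY.one_mem] by fastforce

lemma \<O>_subring: "subring_set \<O>"
proof
  show "1 \<in> \<O>" using \<O>I1[OF KXY.one_mem] by simp
  fix a b assume "a \<in> \<O>" "b \<in> \<O>"
  then obtain P Q R S where PQ: "P \<in> KXY" "Q \<in> KXY" "pt Q \<noteq> 0" "a = ev P / ev Q"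
    and RS: "R \<in> KXY" "S \<in> KXY" "pt S \<noteq> 0" "b = ev R / ev S"
    by (auto simp: \<O>_def)
  have "a - b = ev (P * S - R * Q) / ev (Q * S)" "a * b = ev (P * R) / ev (Q * S)"
    unfolding PQ(4) RS(4) using PQ(3) RS(3) ev_nonzero by (simp_all add: diff_divide_distrib)
  thus "a - b \<in> \<O>" "a * b \<in> \<O>"
    using PQ RS by (auto intro!: \<O>I KXY.diff_mem KXY.mult_mem simp del: ev_mult ev_diff)
qed

sublocale \<O>: val_ring L \<O>
proof -
  interpret subring_set \<O> by (rule \<O>_subring)
  show "val_ring L \<O>"
  proof
    show "\<O> \<subseteq> L" unfolding \<O>_def by (auto intro!: L.divide_mem ev_in_L)
    fix z assume z: "z \<in> L"
    show "z \<in> \<O> \<or> inverse z \<in> \<O>"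
    proof (cases "z = 0")
      case False
      then obtain n P Q where PQ: "P \<in> KXY" "Q \<in> KXY" "pt P \<noteq> 0" "pt Q \<noteq> 0"
        "z = s powi n * (ev P / ev Q)" using L_cases_point z by metis
      have s: "s ^ k \<in> \<O>" for k unfolding s_eq by (intro power_mem \<O>I1 s_over)
      show ?thesis
      proof (cases "n \<ge> 0")
        case True
        hence "z = s ^ nat n * (ev P / ev Q)" using PQ by (simp add: power_int_def)
        hence "z \<in> \<O>" using mult_mem[OF s \<O>I[OF PQ(1,2,4)]] by (simp only:)
        thus ?thesis ..
      next
        case False
        hence "inverse z = s ^ nat (- n) * (ev Q / ev P)"
          using PQ(5) s_nonzero by (simp add: power_int_def power_inverse field_simps)
        hence "inverse z \<in> \<O>" using mult_mem[OF s \<O>I[OF PQ(2,1,3)]] by (simp only:)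
        thus ?thesis ..
      qed
    qed (simp add: zero_mem)
  qed
qed

lemma const_sub_\<O>: "const ` K \<subseteq> \<O>"
  using \<O>I1[OF lift_over[OF const_over]] by (auto simp: const_def)

lemma s_in_max_ideal: "s \<in> max_ideal \<O>"
proof -
  have "inverse s \<notin> \<O>"
  proof
    assume "inverse s \<in> \<O>"
    then obtain P Q where PQ: "pt Q \<noteq> 0" "inverse s = ev P / ev Q" by (auto simp: \<O>_def)
    hence "ev (Q - [:[:- \<alpha>, 1:]:] * P) = 0"
      using s_nonzero ev_nonzero[OF PQ(1)]
      unfolding ev_diff ev_mult s_eq[symmetric] by (simp add: field_simps)
    from ev_eq_0_imp[OF this point] show False using PQ by simp
  qed
  thus ?thesis unfolding max_ideal_def using \<O>I1[OF s_over] by (simp add: s_eq)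
qed

lemma max_ideal_\<O>I: "P \<in> KXY \<Longrightarrow> Q \<in> KXY \<Longrightarrow> pt Q \<noteq> 0 \<Longrightarrow> pt P = 0 \<Longrightarrow> ev P / ev Q \<in> max_ideal \<O>"
proof -
  assume PQ: "P \<in> KXY" "Q \<in> KXY" "pt Q \<noteq> 0" "pt P = 0"
  obtain P' R where R: "P' \<in> KXY" "R \<in> KXY" "pt R \<noteq> 0" "ev P * ev R = s * ev P'"
    using divide_by_s PQ by metis
  have "ev P / ev Q = s * (ev P' / ev (R * Q))"
    using R(3,4) PQ(3) ev_nonzero by (simp add: field_simps)
  moreover have "ev P' / ev (R * Q) \<in> \<O>"
    using R PQ by (intro \<O>I KXY.mult_mem) auto
  ultimately show ?thesis
    using \<O>.max_ideal_mult[OF s_in_max_ideal] by (simp only:)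
qed

lemma unit_\<O>I: "P \<in> KXY \<Longrightarrow> Q \<in> KXY \<Longrightarrow> pt Q \<noteq> 0 \<Longrightarrow> pt P \<noteq> 0 \<Longrightarrow> ev P / ev Q \<in> \<O> - max_ideal \<O>"
  unfolding \<O>.unit_iff using ev_nonzero[of P] ev_nonzero[of Q] \<O>I[of P Q] \<O>I[of Q P] by simp

lemma y_in_max_ideal: "y - const \<beta> \<in> max_ideal \<O>"
proof -
  have "ev [:[:- \<beta>:], 1:] / ev 1 \<in> max_ideal \<O>"
    by (rule max_ideal_\<O>I)
       (auto intro!: const_over K.uminus_mem \<beta>_over KXY.one_mem
         simp: KX.pCons_in_polys_in_iff KX.one_mem KXY.zero_mem)
  thus ?thesis by (simp add: ev_pCons flip: const_def)
qed

lemma has_val_\<O>: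
  assumes "z \<in> L" "z \<noteq> 0"
  shows "\<exists>n. \<O>.has_val s z n"
proof -
  obtain n P Q where "P \<in> KXY" "Q \<in> KXY" "pt P \<noteq> 0" "pt Q \<noteq> 0" "z = s powi n * (ev P / ev Q)"
    using L_cases_point assms by metis
  thus ?thesis unfolding \<O>.has_val_def using unit_\<O>I by blast
qed

lemma place_val_\<O>: "\<O>.has_val s z n \<Longrightarrow> place_val \<O> z = n"
  using \<O>.sub has_val_\<O>
  by (intro \<O>.place_val_eq[OF s_in_max_ideal s_nonzero] \<O>.max_ideal_generator s_in_max_ideal s_nonzero)
     blast+

lemma residue_\<O>:
  assumes "z \<in> \<O>"
  shows "\<exists>c\<in>K. z - const c \<in> max_ideal \<O>"
proof -
  obtain P Q where PQ: "P \<in> KXY" "Q \<in> KXY" "pt Q \<noteq> 0" "z = ev P / ev Q"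
    using assms by (auto simp: \<O>_def)
  define c where "c = pt P / pt Q"
  have c: "c \<in> K" unfolding c_def by (intro K.divide_mem at_in_K PQ)
  have "ev (P - smult [:c:] Q) / ev Q \<in> max_ideal \<O>"
    using PQ by (intro max_ideal_\<O>I KXY.diff_mem KX.smult_in_polys_in const_over c) (simp_all add: c_def)
  moreover have "ev (P - smult [:c:] Q) / ev Q = z - const c"
    using PQ ev_nonzero by (simp add: const_def diff_divide_distrib)
  ultimately show ?thesis using c by auto
qed

lemma \<O>_place: "\<O> \<in> rational_places (const ` K) L"
proof -
  have "inverse s \<notin> \<O>" using s_in_max_ideal s_nonzero by (simp add: max_ideal_def)
  hence "\<O> \<noteq> L" using L.inverse_mem[OF s_in_L] by blast
  thus ?thesis
    using residue_\<O> \<O>.val_ring_axioms const_sub_\<O>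
    by (auto simp: rational_places_def places_iff[OF L.subfield_set_axioms])
qed

lemma x_in_\<O>: "x \<in> \<O>"
  using \<O>.V.add_mem[OF \<O>.max_ideal_sub[OF s_in_max_ideal], of "const \<alpha>"] const_sub_\<O> \<alpha>_over
  by (auto simp: s_def)

text \<open>A polynomial that does not vanish at the point is a nonzero constant plus a non-unit of
  \<open>V\<close>, hence a unit of \<open>V\<close>. So a power of \<open>s\<close> times a
  quotient of such polynomials has the same valuation in \<open>V\<close> as in
  \<open>\<O>\<close>.\<close>

lemma \<O>_eqI:
  assumes "val_ring L V" "const ` K \<subseteq> V" "V \<noteq> L" "s \<in> max_ideal V" "y - const \<beta> \<in> max_ideal V"
  shows "V = \<O>"
proof -
  interpret V: val_ring L V by fact
  have xV: "x \<in> V"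
    using V.V.add_mem[OF V.max_ideal_sub[OF assms(4)], of "const \<alpha>"] assms(2) \<alpha>_over
    by (auto simp: s_def)
  have yV: "y \<in> V"
    using V.V.add_mem[OF V.max_ideal_sub[OF assms(5)], of "const \<beta>"] assms(2) \<beta>_over by auto
  note in_V = of_poly_in_ring[OF V.V.subring_set_axioms assms(2) xV]
    ev_in_ring[OF V.V.subring_set_axioms assms(2) xV yV]
  have unit: "ev P \<in> V - max_ideal V" if P: "P \<in> KXY" "pt P \<noteq> 0" for P
  proof -
    obtain P1 r where Pr: "P1 \<in> KXY" "r \<in> KX"
      "P = [:- [:\<beta>:], 1:] * P1 + [:[:- \<alpha>, 1:] * r + [:pt P:]:]"
      using point_division[OF P(1)] .
    have eq: "ev P = const (pt P) + ((y - const \<beta>) * ev P1 + s * of_poly r)"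
      by (subst Pr(3), unfold ev_add ev_mult ev_linear ev_const of_poly_simps(3,6))
         (simp add: s_eq const_def)
    have "inverse (const (pt P)) \<in> V"
      using at_in_K[OF P(1)] assms(2) K.inverse_mem unfolding const_inverse[symmetric] by blast
    hence "const (pt P) \<in> V - max_ideal V"
      unfolding V.unit_iff using at_in_K[OF P(1)] assms(2) P(2) by auto
    thus ?thesis unfolding eq
      using in_V Pr assms(4,5) by (intro V.unit_add V.max_ideal_add V.max_ideal_mult) auto
  qed
  have unit2: "ev P / ev Q \<in> V - max_ideal V" if "P \<in> KXY" "Q \<in> KXY" "pt P \<noteq> 0" "pt Q \<noteq> 0" for P Q
    unfolding divide_inverse by (intro V.unit_mult V.unit_inverse unit that)
  show ?thesis
  proof
    show "\<O> \<subseteq> V"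
    proof
      fix z assume "z \<in> \<O>"
      then obtain P Q where PQ: "P \<in> KXY" "Q \<in> KXY" "pt Q \<noteq> 0" "z = ev P / ev Q"
        by (auto simp: \<O>_def)
      show "z \<in> V" unfolding PQ(4) divide_inverse
        using V.unit_inverse[OF unit[OF PQ(2,3)]] in_V(2)[OF PQ(1)] by (intro V.V.mult_mem) auto
    qed
  next
    show "V \<subseteq> \<O>"
    proof
      fix z assume z: "z \<in> V"
      show "z \<in> \<O>"
      proof (cases "z = 0")
        case False
        then obtain n P Q where PQ: "P \<in> KXY" "Q \<in> KXY" "pt P \<noteq> 0" "pt Q \<noteq> 0"
          "z = s powi n * (ev P / ev Q)" using L_cases_point z V.sub by (metis subsetD)
        have "V.has_val s z n" unfolding V.has_val_def using PQ unit2 by blast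
        hence "n \<ge> 0" using V.has_val_nonneg_iff[OF assms(4) s_nonzero] z by blast
        moreover have "\<O>.has_val s z n" unfolding \<O>.has_val_def using PQ unit_\<O>I by blast
        ultimately show ?thesis using \<O>.has_val_nonneg_iff[OF s_in_max_ideal s_nonzero] by blast
      qed (simp add: \<O>.V.zero_mem)
    qed
  qed
qed

end

section \<open>Classification and count of the rational places\<close>

context AS_curve_over
begin

definition points :: "('a \<times> 'a) set" where
  "points = {(\<alpha>, \<beta>). \<alpha> \<in> K \<and> \<beta> \<in> K \<and> \<beta> ^ p - \<beta> = poly f \<alpha>}"

definition point_place :: "'a \<times> 'a \<Rightarrow> 'a ffield set" where
  "point_place P = AS_point.\<O> p f K (fst P) (snd P)"

lemma AS_point_points: "P \<in> points \<Longrightarrow> AS_point p m f K (fst P) (snd P)"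
  using AS_curve_over_axioms by (auto simp: points_def AS_point_def AS_point_axioms_def)

text \<open>Replacing \<open>x\<close> and \<open>y\<close> by their residues in the curve equation
  leaves a constant in the maximal ideal. It must be zero, so the residues form a point of the
  curve, and \<open>\<O>_eqI\<close> identifies the place.\<close>

lemma place_at_point:
  assumes V: "val_ring L V" "const ` K \<subseteq> V" "V \<noteq> L"
    and "\<alpha> \<in> K" "\<beta> \<in> K" "x - const \<alpha> \<in> max_ideal V" "y - const \<beta> \<in> max_ideal V"
  shows "(\<alpha>, \<beta>) \<in> points" "V = point_place (\<alpha>, \<beta>)"
proof -
  interpret V: val_ring L V by fact
  have xV: "x \<in> V"
    using V.V.add_mem[OF V.max_ideal_sub[OF assms(6)], of "const \<alpha>"] assms(2,4) by auto
  have yV: "y \<in> V"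
    using V.V.add_mem[OF V.max_ideal_sub[OF assms(7)], of "const \<beta>"] assms(2,5) by auto
  have *: "poly (map_poly const G) z - const (poly G c) \<in> max_ideal V"
    if G: "G \<in> KX" "c \<in> K" and z: "z \<in> V" "z - const c \<in> max_ideal V" for G c z
  proof -
    obtain Q where Q: "Q \<in> KX" "G = [:- c, 1:] * Q + [:poly G c:]"
      using K.division_by_linear[OF G] .
    have QV: "poly (map_poly const Q) z \<in> V"
      using Q(1)
    proof (induction Q)
      case (pCons a Q)
      thus ?case using V(2) z(1)
        by (auto simp: map_poly_pCons K.pCons_in_polys_in_iff intro!: V.V.add_mem V.V.mult_mem)
    qed (simp add: V.V.zero_mem)
    have "poly (map_poly const G) z = (z - const c) * poly (map_poly const Q) z + const (poly G c)"
      by (subst Q(2)) (rule poly_map_const_linear)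
    thus ?thesis using V.max_ideal_mult[OF z(2) QV] by simp
  qed
  have "of_poly f - const (poly f \<alpha>) \<in> max_ideal V"
    using *[OF f_over assms(4) xV assms(6)] by (simp only: of_poly_eq_poly[of f, folded x_def])
  moreover have "y ^ p - y - const (\<beta> ^ p - \<beta>) \<in> max_ideal V"
  proof -
    have "monom 1 p - monom 1 1 \<in> KX" by (intro KX.diff_mem K.monom_in_polys_in K.one_mem)
    moreover have "map_poly const (monom 1 p - monom 1 1) = monom 1 p - monom (1 :: 'a ffield) 1"
      by (intro poly_eqI) (simp add: coeff_map_poly)
    ultimately show ?thesis using *[of "monom 1 p - monom 1 1" \<beta> y] assms(5,7) yV
      by (simp add: poly_monom)
  qed
  ultimately have "y ^ p - y - const (\<beta> ^ p - \<beta>) - (of_poly f - const (poly f \<alpha>)) \<in> max_ideal V"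
    using V.max_ideal_diff by blast
  moreover have "y ^ p - y - const (\<beta> ^ p - \<beta>) - (of_poly f - const (poly f \<alpha>))
    = const (poly f \<alpha> - (\<beta> ^ p - \<beta>))"
    using AS_eq by simp
  ultimately have "const (poly f \<alpha> - (\<beta> ^ p - \<beta>)) \<in> max_ideal V" by (simp only:)
  moreover have "poly f \<alpha> - (\<beta> ^ p - \<beta>) \<in> K"
    by (intro K.mems K.poly_mem f_over assms(4,5))
  ultimately have "poly f \<alpha> - (\<beta> ^ p - \<beta>) = 0" using const_unit[OF V(1,2)] by blast
  thus pt: "(\<alpha>, \<beta>) \<in> points" using assms(4,5) by (simp add: points_def)
  interpret P: AS_point p m f K \<alpha> \<beta> using AS_point_points[OF pt] by simp
  have "V = P.\<O>" using V assms(6,7) by (intro P.\<O>_eqI) (simp_all add: P.s_def)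
  thus "V = point_place (\<alpha>, \<beta>)" by (simp add: point_place_def)
qed

lemma place_cases:
  assumes "V \<in> rational_places (const ` K) L"
  shows "V = infinity \<or> V \<in> point_place ` points"
proof (cases "x \<in> V")
  case False
  thus ?thesis using assms infinity_eqI
    by (auto simp: rational_places_def places_iff[OF L.subfield_set_axioms])
next
  case True
  have V: "val_ring L V" "const ` K \<subseteq> V" "V \<noteq> L" and res: "\<And>z. z \<in> V \<Longrightarrow> \<exists>c\<in>K. z - const c \<in> max_ideal V"
    using assms by (auto simp: rational_places_def places_iff[OF L.subfield_set_axioms])
  interpret V: val_ring L V by fact
  have "y \<in> V"
    using y_integral[OF V(1)] of_poly_in_ring[OF V.V.subring_set_axioms V(2) True f_over] by blast
  then obtain \<alpha> \<beta> where "\<alpha> \<in> K" "x - const \<alpha> \<in> max_ideal V" "\<beta> \<in> K" "y - const \<beta> \<in> max_ideal V"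
    using res True by blast
  from place_at_point[OF V this(1,3,2,4)] show ?thesis by blast
qed

lemma point_place_facts:
  assumes "P \<in> points"
  shows "point_place P \<in> rational_places (const ` K) L" "x \<in> point_place P"
    "x - const (fst P) \<in> max_ideal (point_place P)" "y - const (snd P) \<in> max_ideal (point_place P)"
proof -
  interpret P: AS_point p m f K "fst P" "snd P" using assms by (rule AS_point_points)
  show "point_place P \<in> rational_places (const ` K) L" "x \<in> point_place P"
    "x - const (fst P) \<in> max_ideal (point_place P)" "y - const (snd P) \<in> max_ideal (point_place P)"
    using P.\<O>_place P.x_in_\<O> P.s_in_max_ideal P.y_in_max_ideal by (simp_all add: point_place_def P.s_def)
qed

theorem rational_places_eq:
  "rational_places (const ` K) L = insert infinity (point_place ` points)"
  using place_cases point_place_facts(1) infinity_place by blast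

lemma infinity_not_point_place: "infinity \<notin> point_place ` points"
  using point_place_facts(2) infinity.x_notin_V by blast

lemma inj_point_place: "inj_on point_place points"
proof (rule inj_onI)
  fix P Q assume PQ: "P \<in> points" "Q \<in> points" and eq: "point_place P = point_place Q"
  have V: "val_ring L (point_place P)" "const ` K \<subseteq> point_place P"
    using point_place_facts(1)[OF PQ(1)]
    by (auto simp: rational_places_def places_iff[OF L.subfield_set_axioms])
  interpret V: val_ring L "point_place P" by fact
  have K: "fst P - fst Q \<in> K" "snd P - snd Q \<in> K"
    using PQ by (auto simp: points_def intro!: K.diff_mem)
  have "const (fst P - fst Q) \<in> max_ideal (point_place P)"
    using V.max_ideal_diff[OF point_place_facts(3)[OF PQ(2), folded eq] point_place_facts(3)[OF PQ(1)]]
    by simp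
  moreover have "const (snd P - snd Q) \<in> max_ideal (point_place P)"
    using V.max_ideal_diff[OF point_place_facts(4)[OF PQ(2), folded eq] point_place_facts(4)[OF PQ(1)]]
    by simp
  ultimately have "fst P - fst Q = 0" "snd P - snd Q = 0"
    using const_unit[OF V K(1)] const_unit[OF V K(2)] by blast+
  thus "P = Q" by (simp add: prod_eq_iff)
qed

theorem card_AS_points:
  assumes "finite K"
  shows "card (AS_points p K f) = 1 + card points"
proof -
  have "points \<subseteq> K \<times> K" by (auto simp: points_def)
  hence "finite points" using assms finite_subset by blast
  thus ?thesis
    unfolding AS_points_def L_def[symmetric] rational_places_eq
    using infinity_not_point_place card_image[OF inj_point_place] by simp
qed

end

section \<open>All places over the algebraically closed field of constants\<close>

context AS_curve
begin

sublocale U: AS_curve_over p m f UNIV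
  by (rule AS_curve_over_UNIV)

lemma in_polys_in_UNIV [simp]: "P \<in> polys_in UNIV" "Q \<in> polys_in (polys_in UNIV)"
  by (simp_all add: polys_in_def)

text \<open>Over algebraically closed constants \<open>G\<close> splits into linear factors, and the
  maximal ideal is prime, so some factor \<open>z - const c\<close> is a non-unit.\<close>

lemma root_in_max_ideal:
  assumes "val_ring U.L V" "range const \<subseteq> V" "z \<in> V" "G \<noteq> 0" "poly (map_poly const G) z \<in> max_ideal V"
  shows "\<exists>c. z - const c \<in> max_ideal V"
  using assms(4,5)
proof (induction "degree G" arbitrary: G)
  case 0
  then obtain c where c: "G = [:c:]" "c \<noteq> 0" by (metis degree_eq_zeroE pCons_0_0)
  thus ?case using U.const_unit[OF assms(1,2), of c] 0 by (simp add: map_poly_pCons)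
next
  case (Suc n)
  interpret V: val_ring U.L V by fact
  obtain c where "poly G c = 0" using Suc alg_closed_imp_poly_has_root by (metis zero_less_Suc)
  then obtain H where H: "G = [:- c, 1:] * H" using poly_eq_0_iff_dvd by blast
  have H0: "H \<noteq> 0" using H Suc by auto
  have eq: "poly (map_poly const G) z = (z - const c) * poly (map_poly const H) z"
    using poly_map_const_linear[of c H 0 z] by (simp add: H del: mult_pCons_left)
  have "poly (map_poly const H) z \<in> V"
    by (induction H) (use assms(2,3) in \<open>auto simp: map_poly_pCons V.V.zero_mem intro!: V.V.add_mem V.V.mult_mem\<close>)
  moreover have "z - const c \<in> V" using assms(2,3) by (intro V.V.diff_mem) auto
  ultimately have "z - const c \<in> max_ideal V \<or> poly (map_poly const H) z \<in> max_ideal V"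
    using V.max_ideal_prime Suc.prems(2) unfolding eq by blast
  moreover have "n = degree H" using Suc(2) H0 unfolding H by (subst (asm) degree_mult_eq) auto
  ultimately show ?case using Suc.hyps(1) H0 by blast
qed

text \<open>Rationality is automatic here. If \<open>x\<close> is in \<open>V\<close>, the
  non-trivial ring \<open>V\<close> has a non-unit of the form \<open>ev P\<close>, hence a nonzero
  polynomial in \<open>x\<close> in its maximal ideal; this yields a residue for \<open>x\<close>,
  and the equation then yields one for \<open>y\<close>.\<close>

theorem places_UNIV:
  "places (range const) U.L = insert U.infinity (U.point_place ` U.points)"
proof
  show "insert U.infinity (U.point_place ` U.points) \<subseteq> places (range const) U.L"
    unfolding U.rational_places_eq[symmetric] by (auto simp: rational_places_def)
  show "places (range const) U.L \<subseteq> insert U.infinity (U.point_place ` U.points)"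
  proof
    fix V assume "V \<in> places (range const) U.L"
    hence V: "val_ring U.L V" "range const \<subseteq> V" "V \<noteq> U.L"
      by (auto simp: places_iff[OF U.L.subfield_set_axioms])
    interpret V: val_ring U.L V by fact
    show "V \<in> insert U.infinity (U.point_place ` U.points)"
    proof (cases "x \<in> V")
      case False
      thus ?thesis using U.infinity_eqI V by blast
    next
      case xV: True
      note in_V = U.of_poly_in_ring[OF V.V.subring_set_axioms V(2) xV]
      have yV: "y \<in> V" using U.y_integral[OF V(1)] in_V by simp
      obtain z where z: "z \<in> U.L" "z \<notin> V" using V V.sub by blast
      hence iz: "z \<noteq> 0" "inverse z \<in> max_ideal V" using V.notin_V_iff[OF z(1)] by auto
      obtain P Q where PQ: "ev Q \<noteq> 0" "inverse z = ev P / ev Q"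
        using U.L_cases[OF U.L.inverse_mem[OF z(1)]] by metis
      have ev: "ev R \<in> V" for R
        by (intro U.ev_in_ring[OF V.V.subring_set_axioms V(2) xV yV]) simp
      have P: "ev P \<noteq> 0" "ev P \<in> max_ideal V"
        using PQ iz V.max_ideal_mult[OF iz(2) ev[of Q]] by auto
      obtain G R where G: "G \<noteq> 0" "ev P * ev R = of_poly G" using ev_algebraic[OF P(1)] .
      have "of_poly G \<in> max_ideal V" using V.max_ideal_mult[OF P(2) ev[of R]] G(2) by simp
      then obtain \<alpha> where \<alpha>: "x - const \<alpha> \<in> max_ideal V"
        using root_in_max_ideal[OF V(1,2) xV G(1)] unfolding of_poly_eq_poly[of G, folded x_def] by blast
      \<comment> \<open>\<open>T\<close> is the fibre equation over \<open>\<alpha>\<close>. Its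
        value at \<open>y\<close> is \<open>f(x) - f(\<alpha>)\<close>, a multiple of the non-unit
        \<open>x - const \<alpha>\<close>.\<close>
      define T where "T = monom 1 p - monom 1 1 - [:poly f \<alpha>:]"
      have "coeff T p = 1"
        using p_ge_2 by (auto simp: T_def coeff_pCons split: nat.splits)
      hence T0: "T \<noteq> 0" by auto
      have "map_poly const T = monom 1 p - monom 1 1 - [:const (poly f \<alpha>):]"
        by (intro poly_eqI) (simp add: T_def coeff_map_poly coeff_pCons split: nat.splits)
      hence "poly (map_poly const T) y = of_poly f - of_poly [:poly f \<alpha>:]"
        using AS_eq by (simp add: poly_monom const_def)
      also have "\<dots> = of_poly (f - [:poly f \<alpha>:])" by simp
      also obtain H where "f - [:poly f \<alpha>:] = [:- \<alpha>, 1:] * H"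
      proof -
        have "poly (f - [:poly f \<alpha>:]) \<alpha> = 0" by simp
        thus ?thesis using that poly_eq_0_iff_dvd by blast
      qed
      also have "of_poly ([:- \<alpha>, 1:] * H) = (x - const \<alpha>) * of_poly H"
        by (simp only: of_poly_simps of_poly_linear x_def)
      also have "\<dots> \<in> max_ideal V" using V.max_ideal_mult[OF \<alpha>] in_V by simp
      finally obtain \<beta> where "y - const \<beta> \<in> max_ideal V"
        using root_in_max_ideal[OF V(1,2) yV T0] by blast
      from U.place_at_point[OF V _ _ \<alpha> this] show ?thesis by blast
    qed
  qed
qed

end

section \<open>The genus of an Artin--Schreier curve\<close>

lemma card_roots_separable:
  fixes G :: "'a::alg_closed_field poly"
  assumes "G \<noteq> 0" "\<And>z. poly G z = 0 \<Longrightarrow> poly (pderiv G) z \<noteq> 0"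
  shows "card {z. poly G z = 0} = degree G"
  using assms
proof (induction "degree G" arbitrary: G)
  case 0
  then obtain c where "G = [:c:]" "c \<noteq> 0" by (metis degree_eq_zeroE pCons_0_0)
  thus ?case by simp
next
  case (Suc n)
  obtain a where a: "poly G a = 0" using Suc alg_closed_imp_poly_has_root by (metis zero_less_Suc)
  then obtain H where H: "G = [:- a, 1:] * H" using poly_eq_0_iff_dvd by blast
  have H0: "H \<noteq> 0" using H Suc by auto
  have pd: "pderiv G = [:- a, 1:] * pderiv H + H"
    unfolding H pderiv_mult by (simp add: pderiv_pCons)
  have Ha: "poly H a \<noteq> 0" using Suc(4)[OF a] unfolding pd by simp
  have deg: "n = degree H" using Suc(2) H0 unfolding H by (subst (asm) degree_mult_eq) auto
  have "card {z. poly H z = 0} = degree H"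
  proof (rule Suc(1)[OF deg H0])
    fix z assume z: "poly H z = 0"
    hence "poly G z = 0" by (simp add: H)
    from Suc(4)[OF this] show "poly (pderiv H) z \<noteq> 0" using z unfolding pd by auto
  qed
  moreover have "{z. poly G z = 0} = insert a {z. poly H z = 0}" unfolding H by auto
  ultimately show ?case using Ha poly_roots_finite[OF H0] Suc(2) deg by simp
qed

text \<open>The derivative of \<open>z^n - z - c\<close> is -1. This serves with
  \<open>n = p\<close> for points of the curve, with a power of \<open>p\<close> and
  \<open>c = 0\<close> for the orders of finite fields, and with \<open>n = 2\<close> to solve
  quadratic equations.\<close>

lemma card_AS_fibre:
  fixes c :: "'a::alg_closed_field"
  assumes "n \<ge> 2" "of_nat n = (0 :: 'a)"
  shows "card {z. z ^ n - z = c} = n"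
proof -
  define G where "G = monom 1 n - monom 1 1 - [:c:]"
  have cf: "coeff G n = 1" "coeff G i = 0" if "i > n" for i
    using assms(1) that by (auto simp: G_def coeff_pCons split: nat.splits)
  have "degree G = n"
    using cf(1)[of "Suc n"] cf(2) by (intro antisym degree_le le_degree) auto
  moreover have "G \<noteq> 0" using cf(1)[of "Suc n"] by auto
  moreover have "pderiv G = - 1"
    using assms(2) by (simp add: G_def pderiv_diff pderiv_monom monom_0 one_pCons)
  ultimately have "card {z. poly G z = 0} = n" by (subst card_roots_separable) simp_all
  thus ?thesis by (simp add: G_def poly_monom)
qed

interpretation vs: vector_space "\<lambda>(c :: 'a::alg_closed_field) (z :: 'a ffield). const c * z"
  by unfold_locales (simp_all add: algebra_simps)

lemma basis_of_subspace:
  fixes W :: "'a::alg_closed_field ffield set"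
  assumes "W \<subseteq> vs.span B" "finite B"
  obtains C where "finite C" "C \<subseteq> W" "W \<subseteq> vs.span C" "card C = vs.dim W"
proof -
  obtain C where C: "C \<subseteq> W" "vs.independent C" "W \<subseteq> vs.span C"
    using vs.maximal_independent_subset by blast
  have "finite C" using vs.independent_span_bound[OF assms(2) C(2)] C(1) assms(1) by blast
  thus ?thesis using that C vs.basis_card_eq_dim[OF C(1,3,2)] by blast
qed

lemma div_degree_eq:
  assumes "finite S" "{V. D V \<noteq> 0} \<subseteq> S"
  shows "div_degree D = sum D S"
  unfolding div_degree_def using assms by (intro sum.mono_neutral_left) auto

section \<open>Riemann-Roch spaces and the growth of their dimension\<close>

context AS_curve
begin

abbreviation "pls \<equiv> places (range const) U.L"

lemma place_val_ring: "V \<in> pls \<Longrightarrow> val_ring U.L V"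
  by (simp add: places_iff[OF U.L.subfield_set_axioms])

text \<open>Puts infinity and the affine points on one footing, so that the arguments on divisors
  need no case distinction.\<close>

lemma exists_parameter:
  assumes "V \<in> pls"
  shows "\<exists>t. t \<in> U.L \<and> t \<noteq> 0 \<and> t \<in> max_ideal V \<and>
           (\<forall>z\<in>U.L. z \<noteq> 0 \<longrightarrow> val_ring.has_val V t z (place_val V z))"
proof -
  consider "V = U.infinity" | P where "P \<in> U.points" "V = U.point_place P"
    using assms places_UNIV by blast
  thus ?thesis
  proof cases
    case 1
    have "U.infinity.V.has_val U.infinity.t z (place_val U.infinity z)" if "z \<in> U.L" "z \<noteq> 0" for z
      using U.infinity.has_val_L[OF that] U.infinity.place_val_infinity by metis
    thus ?thesis
      unfolding 1 using U.infinity.t_in_max_ideal U.infinity.t_nonzero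
        U.infinity.V.sub U.infinity.V.max_ideal_sub by (intro exI[of _ U.infinity.t]) blast
  next
    case (2 P)
    interpret P: AS_point p m f UNIV "fst P" "snd P" using 2(1) by (rule U.AS_point_points)
    have "P.\<O>.has_val P.s z (place_val P.\<O> z)" if "z \<in> U.L" "z \<noteq> 0" for z
      using P.has_val_\<O>[OF that] P.place_val_\<O> by metis
    thus ?thesis
      unfolding 2 U.point_place_def using P.s_in_max_ideal P.s_nonzero P.s_in_L
      by (intro exI[of _ P.s]) blast
  qed
qed

definition param :: "'a ffield set \<Rightarrow> 'a ffield" where
  "param V = (SOME t. t \<in> U.L \<and> t \<noteq> 0 \<and> t \<in> max_ideal V \<and>
     (\<forall>z\<in>U.L. z \<noteq> 0 \<longrightarrow> val_ring.has_val V t z (place_val V z)))"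

lemma param:
  assumes "V \<in> pls"
  shows "param V \<in> U.L" "param V \<noteq> 0" "param V \<in> max_ideal V"
    "\<And>z. z \<in> U.L \<Longrightarrow> z \<noteq> 0 \<Longrightarrow> val_ring.has_val V (param V) z (place_val V z)"
  using someI_ex[OF exists_parameter[OF assms]] unfolding param_def by blast+

lemma place_val_unique:
  assumes "V \<in> pls" "z \<in> U.L" "val_ring.has_val V (param V) z n"
  shows "place_val V z = n"
proof -
  interpret V: val_ring U.L V using assms(1) by (rule place_val_ring)
  note t = param[OF assms(1)]
  show ?thesis
    using V.has_val_unique[OF t(3,2) t(4)] V.has_val_nonzero[OF t(3,2)] assms by blast
qed

lemma place_val_mult:
  assumes "V \<in> pls" "z \<in> U.L" "w \<in> U.L" "z \<noteq> 0" "w \<noteq> 0"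
  shows "place_val V (z * w) = place_val V z + place_val V w"
proof -
  interpret V: val_ring U.L V using assms(1) by (rule place_val_ring)
  note t = param[OF assms(1)]
  show ?thesis
    using assms by (intro place_val_unique V.has_val_mult[OF t(3,2)] t(4) U.L.mult_mem)
qed

text \<open>Turns a bound on the valuation into membership in the ring \<open>V\<close>, so that
  closure of Riemann-Roch spaces under sums follows from closure of \<open>V\<close>.\<close>

lemma param_powi_mult_iff:
  assumes "V \<in> pls" "z \<in> U.L" "z \<noteq> 0"
  shows "param V powi n * z \<in> V \<longleftrightarrow> place_val V z \<ge> - n"
    and "param V powi n * z \<in> max_ideal V \<longleftrightarrow> place_val V z > - n"
proof -
  interpret V: val_ring U.L V using assms(1) by (rule place_val_ring)
  note t = param[OF assms(1)]
  have "V.has_val (param V) (param V powi n) n"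
    unfolding V.has_val_def using V.unit_one by (intro bexI[of _ 1]) simp_all
  hence "V.has_val (param V) (param V powi n * z) (n + place_val V z)"
    using assms by (intro V.has_val_mult[OF t(3,2)] t(4))
  from V.has_val_nonneg_iff[OF t(3,2) this] V.has_val_pos_iff[OF t(3,2) this]
  show "param V powi n * z \<in> V \<longleftrightarrow> place_val V z \<ge> - n"
    and "param V powi n * z \<in> max_ideal V \<longleftrightarrow> place_val V z > - n" by auto
qed

abbreviation "RR \<equiv> RR_space (range const) U.L"

lemma RR_iff: "z \<in> RR D \<longleftrightarrow> z \<in> U.L \<and> (\<forall>V\<in>pls. param V powi D V * z \<in> V)"
proof (cases "z = 0")
  case True
  have "0 \<in> V" if "V \<in> pls" for V
    using place_val_ring[OF that] unfolding val_ring_def by (simp add: subring_set.zero_mem)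
  thus ?thesis using True U.L.zero_mem by (simp add: RR_space_def)
next
  case False
  thus ?thesis using param_powi_mult_iff(1) by (auto simp: RR_space_def)
qed

lemma subspace_RR: "vs.subspace (RR D)"
proof (rule vs.subspaceI)
  show "0 \<in> RR D" using U.L.zero_mem by (simp add: RR_space_def)
next
  fix a b assume ab: "a \<in> RR D" "b \<in> RR D"
  show "a + b \<in> RR D"
    unfolding RR_iff
  proof (intro conjI ballI)
    show "a + b \<in> U.L" using ab by (auto simp: RR_iff intro: U.L.add_mem)
    fix V assume V: "V \<in> pls"
    interpret V: val_ring U.L V using V by (rule place_val_ring)
    show "param V powi D V * (a + b) \<in> V"
      unfolding distrib_left using ab V by (intro V.V.add_mem) (auto simp: RR_iff)
  qed
next
  fix c a assume a: "a \<in> RR D"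
  show "const c * a \<in> RR D"
    unfolding RR_iff
  proof (intro conjI ballI)
    show "const c * a \<in> U.L" using a by (auto simp: RR_iff intro!: U.L.mult_mem U.const_in_L)
    fix V assume V: "V \<in> pls"
    interpret V: val_ring U.L V using V by (rule place_val_ring)
    have "const c \<in> V" using V by (auto simp: places_def)
    moreover have "param V powi D V * a \<in> V" using a V by (auto simp: RR_iff)
    ultimately have "const c * (param V powi D V * a) \<in> V" by (rule V.V.mult_mem)
    thus "param V powi D V * (const c * a) \<in> V" by (simp add: mult_ac)
  qed
qed

lemma RR_mono: "(\<And>V. V \<in> pls \<Longrightarrow> D V \<le> E V) \<Longrightarrow> RR D \<subseteq> RR E"
  by (force simp: RR_space_def)

text \<open>Multiply by the power \<open>D V + 1\<close> of a parameter at \<open>V\<close> and take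
  residues. This is a linear map from the larger space to the constants with kernel
  \<open>RR D\<close>, so one extra element \<open>b\<close> suffices.\<close>

lemma RR_step:
  assumes V: "V \<in> pls"
  shows "\<exists>b. RR (D(V := D V + 1)) \<subseteq> vs.span (insert b (RR D))"
proof (cases "RR (D(V := D V + 1)) \<subseteq> RR D")
  case True
  have "RR D \<subseteq> vs.span (insert 0 (RR D))" by (auto intro: vs.span_base)
  thus ?thesis using True by blast
next
  case False
  define E where "E = D(V := D V + 1)"
  obtain b where b: "b \<in> RR E" "b \<notin> RR D" using False by (auto simp: E_def)
  interpret V: val_ring U.L V using V by (rule place_val_ring)
  define t where "t = param V powi (D V + 1)"
  have bL: "b \<in> U.L" "b \<noteq> 0" using b by (auto simp: RR_space_def)
  have key: "z \<in> RR D \<longleftrightarrow> t * z \<in> max_ideal V" if "z \<in> RR E" for z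
  proof (cases "z = 0")
    case True thus ?thesis using V.zero_in_max_ideal U.L.zero_mem by (simp add: RR_space_def)
  next
    case z: False
    have zL: "z \<in> U.L" using that by (simp add: RR_space_def)
    have "t * z \<in> max_ideal V \<longleftrightarrow> place_val V z \<ge> - D V"
      unfolding t_def using param_powi_mult_iff(2)[OF V zL z] by auto
    moreover have "place_val W z \<ge> - D W" if "W \<in> pls" "W \<noteq> V" for W
      using that(1) z \<open>z \<in> RR E\<close> fun_upd_other[OF that(2), of D "D V + 1"]
      by (auto simp: RR_space_def E_def simp del: fun_upd_apply)
    ultimately show ?thesis using z zL V by (auto simp: RR_space_def)
  qed
  have tV: "t * z \<in> V" if "z \<in> RR E" for z
    using that V unfolding t_def by (auto simp: RR_iff E_def)
  have res: "\<exists>c. z - const c \<in> max_ideal V" if "z \<in> V" for z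
  proof -
    have "V \<in> rational_places (range const) U.L"
      using V by (simp add: places_UNIV U.rational_places_eq)
    thus ?thesis using that by (auto simp: rational_places_def)
  qed
  obtain c0 where c0: "t * b - const c0 \<in> max_ideal V" using res tV b by blast
  have "t * b \<notin> max_ideal V" using key b by blast
  hence c0_nz: "c0 \<noteq> 0" using c0 by auto
  have constV: "const c \<in> V" for c using V by (auto simp: places_def)
  have "RR E \<subseteq> vs.span (insert b (RR D))"
  proof
    fix z assume z: "z \<in> RR E"
    obtain c where c: "t * z - const c \<in> max_ideal V" using res tV z by blast
    define w where "w = z - const (c / c0) * b"
    have wE: "w \<in> RR E"
      unfolding w_def using subspace_RR z b(1) vs.subspace_diff vs.subspace_scale by blast
    have "(t * z - const c) - (t * b - const c0) * const (c / c0) \<in> max_ideal V"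
      by (intro V.max_ideal_diff V.max_ideal_mult c c0 constV)
    moreover have "(t * z - const c) - (t * b - const c0) * const (c / c0) = t * w"
      using c0_nz by (simp add: w_def algebra_simps)
    ultimately have "t * w \<in> max_ideal V" by (simp only:)
    hence "w \<in> RR D" using key[OF wE] by blast
    hence "w + const (c / c0) * b \<in> vs.span (insert b (RR D))"
      by (intro vs.span_add vs.span_scale vs.span_base) auto
    thus "z \<in> vs.span (insert b (RR D))" by (simp add: w_def)
  qed
  thus ?thesis unfolding E_def by blast
qed

lemma divisors_update: "D \<in> divisors (range const) U.L \<Longrightarrow> V \<in> pls \<Longrightarrow> D(V := n) \<in> divisors (range const) U.L"
proof -
  assume D: "D \<in> divisors (range const) U.L" "V \<in> pls"
  have sub: "{W. (D(V := n)) W \<noteq> 0} \<subseteq> insert V {W. D W \<noteq> 0}" by auto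
  moreover have "finite (insert V {W. D W \<noteq> 0})" using D by (simp add: divisors_def)
  ultimately have "finite {W. (D(V := n)) W \<noteq> 0}" by (rule finite_subset)
  moreover have "{W. (D(V := n)) W \<noteq> 0} \<subseteq> pls" using sub D by (auto simp: divisors_def)
  ultimately show ?thesis by (simp add: divisors_def)
qed

text \<open>Climb from \<open>D\<close> to \<open>E\<close> one place at a time with
  \<open>RR_step\<close>. The finite spanning set \<open>B\<close> provides finite bases for all
  spaces on the way, where \<open>vs.dim\<close> has its usual meaning.\<close>

lemma RR_dim_le:
  assumes "D \<in> divisors (range const) U.L" "E \<in> divisors (range const) U.L" "\<And>V. D V \<le> E V"
    and "finite B" "RR E \<subseteq> vs.span B"
  shows "int (vs.dim (RR E)) \<le> int (vs.dim (RR D)) + (div_degree E - div_degree D)"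
  using assms(1,3)
proof (induction "nat (div_degree E - div_degree D)" arbitrary: D rule: less_induct)
  case less
  show ?case
  proof (cases "D = E")
    case False
    define S where "S = {V. D V \<noteq> 0} \<union> {V. E V \<noteq> 0}"
    have S: "finite S" "S \<subseteq> pls" using less.prems(1) assms(2) by (auto simp: S_def divisors_def)
    have degE: "div_degree E = sum E S" and degD: "div_degree D = sum D S"
      using S by (auto intro!: div_degree_eq simp: S_def)
    obtain V where V: "D V < E V" using False less.prems(2) by (metis antisym_conv1 ext)
    hence VS: "V \<in> S" by (auto simp: S_def)
    hence Vp: "V \<in> pls" using S by blast
    define D1 where "D1 = D(V := D V + 1)"
    have D1: "D1 \<in> divisors (range const) U.L" "\<And>W. D1 W \<le> E W"
      unfolding D1_def using divisors_update less.prems Vp V by auto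
    have "div_degree D1 = sum D1 S"
      using S VS by (intro div_degree_eq) (auto simp: D1_def S_def)
    also have "\<dots> = (\<Sum>W\<in>S. D W + (if W = V then 1 else 0))"
      by (intro sum.cong) (auto simp: D1_def)
    also have "\<dots> = div_degree D + 1"
      using S VS by (simp add: sum.distrib degD)
    finally have deg1: "div_degree D1 = div_degree D + 1" .
    have lt: "div_degree D < div_degree E"
      unfolding degD degE using S VS V less.prems(2) by (intro sum_strict_mono_ex1) auto
    have "int (vs.dim (RR E)) \<le> int (vs.dim (RR D1)) + (div_degree E - div_degree D1)"
      using deg1 lt D1 by (intro less.hyps) auto
    moreover have "vs.dim (RR D1) \<le> vs.dim (RR D) + 1"
    proof -
      have "RR D \<subseteq> vs.span B" using RR_mono[of D E] less.prems(2) assms(5) by blast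
      then obtain C where C: "finite C" "C \<subseteq> RR D" "RR D \<subseteq> vs.span C" "card C = vs.dim (RR D)"
        using basis_of_subspace assms(4) by blast
      obtain b where b: "RR D1 \<subseteq> vs.span (insert b (RR D))"
        unfolding D1_def using RR_step[OF Vp] by blast
      have "insert b (RR D) \<subseteq> vs.span (insert b C)"
        using C(3) vs.span_mono[of C "insert b C"] by (auto intro: vs.span_base)
      hence "RR D1 \<subseteq> vs.span (insert b C)" using b vs.span_minimal[OF _ vs.subspace_span] by blast
      hence "vs.dim (RR D1) \<le> card (insert b C)" using C(1) by (intro vs.dim_le_card) auto
      thus ?thesis using C(1,4) card_insert_le_m1[of "card C + 1" C b] by (simp add: card_insert_if split: if_splits)
    qed
    ultimately show ?thesis using deg1 by linarith
  qed simp
qed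

\<comment> \<open>Functions regular away from infinity and the divisors
  \<open>shifted\<close>\<close>
end

context AS_curve
begin

lemma card_fibre: "card {\<beta>. (\<alpha>, \<beta>) \<in> U.points} = p"
  using card_AS_fibre[OF p_ge_2 of_nat_p, of "poly f \<alpha>"] by (simp add: U.points_def)

lemma finite_fibre: "finite {\<beta>. (\<alpha>, \<beta>) \<in> U.points}"
  using card_fibre p_ge_2 by (metis card.infinite not_numeral_le_zero)

lemma in_point_place_max_ideal_iff:
  assumes "(\<alpha>, \<beta>) \<in> U.points"
  shows "ev P \<in> max_ideal (U.point_place (\<alpha>, \<beta>)) \<longleftrightarrow> ev_at \<alpha> \<beta> P = 0"
proof -
  interpret P: AS_point p m f UNIV \<alpha> \<beta> using U.AS_point_points[OF assms] by simp
  have "P.pt 1 \<noteq> 0" by simp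
  thus ?thesis
    using P.max_ideal_\<O>I[of P 1] P.unit_\<O>I[of P 1] by (auto simp: U.point_place_def)
qed

lemma ev_in_point_place:
  assumes "Q \<in> U.points"
  shows "ev P \<in> U.point_place Q"
proof -
  interpret P: AS_point p m f UNIV "fst Q" "snd Q" using assms by (rule U.AS_point_points)
  show ?thesis unfolding U.point_place_def using P.\<O>I1[of P] by simp
qed

lemma reduce:
  obtains P' where "ev P = ev P'" "degree P' < p"
proof -
  obtain P' Q where "degree P' < p" "P = P' + \<Phi> * Q" using U.reduction[of P] by auto
  thus ?thesis using that by (simp add: ev_\<Phi>)
qed

text \<open>Write \<open>z\<close> times \<open>G(x)\<close> as a polynomial in \<open>x\<close> and
  \<open>y\<close>, of degree below \<open>p\<close> in \<open>Y\<close>. Over a root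
  \<open>\<alpha>\<close> of \<open>G\<close> that polynomial vanishes at all \<open>p\<close>
  points of the fibre, hence identically in \<open>Y\<close> at \<open>x = \<alpha>\<close>, so the
  factor \<open>x - \<alpha>\<close> can be cancelled.\<close>

lemma regular_imp_polynomial:
  assumes "z \<in> U.L" "\<And>Q. Q \<in> U.points \<Longrightarrow> z \<in> U.point_place Q"
  obtains P where "z = ev P" "degree P < p"
proof -
  have *: "\<exists>P. z = ev P" if "G \<noteq> 0" "z * of_poly G = ev R" for G R
    using that
  proof (induction "degree G" arbitrary: G R)
    case 0
    then obtain c where c: "G = [:c:]" "c \<noteq> 0" by (metis degree_eq_zeroE pCons_0_0)
    have "z = ev (smult [:inverse c:] R)"
      unfolding ev_smult 0(3)[symmetric] using c by (simp flip: const_def)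
    thus ?case by blast
  next
    case (Suc n)
    obtain \<alpha> where "poly G \<alpha> = 0" using Suc alg_closed_imp_poly_has_root by (metis zero_less_Suc)
    then obtain H where H: "G = [:- \<alpha>, 1:] * H" using poly_eq_0_iff_dvd by blast
    have H0: "H \<noteq> 0" using H Suc by auto
    have deg: "n = degree H" using Suc(2) H0 unfolding H by (subst (asm) degree_mult_eq) auto
    have zG: "z * of_poly G = (x - const \<alpha>) * (z * of_poly H)"
      unfolding H of_poly_simps(6) of_poly_linear x_def by simp
    obtain R' where R': "ev R = ev R'" "degree R' < p" using reduce .
    have at: "ev_at \<alpha> \<beta> R' = 0" if b: "(\<alpha>, \<beta>) \<in> U.points" for \<beta>
    proof -
      have "val_ring U.L (U.point_place (\<alpha>, \<beta>))"
        using U.point_place_facts(1)[OF b] by (intro place_val_ring) (simp add: rational_places_def)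
      then interpret V: val_ring U.L "U.point_place (\<alpha>, \<beta>)" .
      have "of_poly H \<in> U.point_place (\<alpha>, \<beta>)" using ev_in_point_place[OF b, of "[:H:]"] by simp
      hence "(x - const \<alpha>) * (z * of_poly H) \<in> max_ideal (U.point_place (\<alpha>, \<beta>))"
        using U.point_place_facts(3)[OF b] assms(2)[OF b]
        by (intro V.max_ideal_mult V.V.mult_mem) auto
      thus ?thesis
        using in_point_place_max_ideal_iff[OF b, of R'] Suc(4) R'(1) zG by simp
    qed
    define S where "S = map_poly (\<lambda>G. poly G \<alpha>) R'"
    have S: "poly S \<beta> = ev_at \<alpha> \<beta> R'" for \<beta>
    proof -
      have "poly (map_poly (\<lambda>G. poly G \<alpha>) T) \<beta> = ev_at \<alpha> \<beta> T" for T
        by (induction T) (simp_all add: map_poly_pCons)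
      thus ?thesis by (simp add: S_def)
    qed
    have "S = 0"
    proof (rule ccontr)
      assume "S \<noteq> 0"
      have "p \<le> card {\<beta>. poly S \<beta> = 0}"
        using at S card_fibre[of \<alpha>] poly_roots_finite[OF \<open>S \<noteq> 0\<close>]
        by (metis (mono_tags, lifting) card_mono mem_Collect_eq subsetI)
      also have "\<dots> \<le> degree S" using \<open>S \<noteq> 0\<close> by (rule card_poly_roots_bound)
      also have "\<dots> \<le> degree R'" unfolding S_def by (intro degree_le allI impI) (simp add: coeff_map_poly coeff_eq_0)
      finally show False using R'(2) by simp
    qed
    hence "poly (coeff R' j) \<alpha> = 0" for j
      by (metis S_def coeff_0 coeff_map_poly poly_0)
    hence dvd: "[:- \<alpha>, 1:] dvd coeff R' j" for j by (simp add: poly_eq_0_iff_dvd)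
    have "[:[:- \<alpha>, 1:]:] dvd R'" using dvd by (simp add: const_poly_dvd_iff)
    then obtain R1 where "R' = [:[:- \<alpha>, 1:]:] * R1" by blast
    hence "ev R' = (x - const \<alpha>) * ev R1"
      by (simp only: ev_mult ev_const of_poly_linear x_def)
    moreover have "x - const \<alpha> \<noteq> 0"
    proof -
      have "of_poly [:- \<alpha>, 1:] \<noteq> (0 :: 'a ffield)" by simp
      thus ?thesis unfolding of_poly_linear x_def .
    qed
    ultimately have "z * of_poly H = ev R1" using zG Suc(4) R'(1) by simp
    thus ?case using Suc(1)[OF deg H0] by blast
  qed
  obtain P Q where PQ: "ev Q \<noteq> 0" "z = ev P / ev Q" using U.L_cases[OF assms(1)] by metis
  obtain G R where G: "G \<noteq> 0" "ev Q * ev R = of_poly G" using ev_algebraic[OF PQ(1)] .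
  have "z * of_poly G = ev (P * R)" using PQ by (simp flip: G(2))
  from *[OF G(1) this] show ?thesis using that reduce by metis
qed

text \<open>The divisor \<open>div h + p M \<infinity>\<close>, whose Riemann--Roch space is \<open>h\<^sup>-\<^sup>1\<close> times the space of
  functions with poles only at infinity, of order at most \<open>p M\<close>.\<close>

definition shifted :: "'a ffield \<Rightarrow> nat \<Rightarrow> 'a ffield set \<Rightarrow> int" where
  "shifted h M V = (if V \<in> pls then place_val V h + (if V = U.infinity then int (p * M) else 0) else 0)"

definition exponents :: "nat \<Rightarrow> (nat \<times> nat) set" where
  "exponents M = {(i, j). j < p \<and> p * i + (p * m + 1) * j \<le> p * M}"

text \<open>In the residue class of \<open>j\<close> modulo \<open>p\<close> the least pole order is
  \<open>(p * m + 1) * j = p * (m * j) + j\<close>, so this class contributes \<open>m * j\<close>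
  gaps.\<close>

definition gap_number :: nat where
  "gap_number = (\<Sum>j<p. m * j)"

lemma exponents_eq: "exponents M = (SIGMA j:{..<p}. {i. p * i + (p * m + 1) * j \<le> p * M})\<inverse>"
  by (auto simp: exponents_def)

lemma finite_exponents: "finite (exponents M)"
proof (rule finite_subset)
  show "exponents M \<subseteq> {..M} \<times> {..<p}"
  proof
    fix ij assume ij: "ij \<in> exponents M"
    obtain i j where [simp]: "ij = (i, j)" by (cases ij)
    have "p * i + (p * m + 1) * j \<le> p * M" using ij by (simp add: exponents_def)
    hence "p * i \<le> p * M" by linarith
    hence "i \<le> M" using p_ge_2 by simp
    thus "ij \<in> {..M} \<times> {..<p}" using ij by (simp add: exponents_def)
  qed
qed simp

text \<open>For \<open>0 < j < p\<close> the bound on the pole order amounts to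
  \<open>i + m * j < M\<close>, for \<open>j = 0\<close> to \<open>i \<le> M\<close>; the latter
  accounts for the extra 1. The assumption on \<open>M\<close> keeps the subtraction
  \<open>M - m * j\<close> exact.\<close>

lemma card_exponents:
  assumes "M \<ge> p * m"
  shows "card (exponents M) + gap_number = p * M + 1"
proof -
  have le_iff: "p * i + (p * m + 1) * j \<le> p * M \<longleftrightarrow> i \<in> (if j = 0 then {..M} else {..<M - m * j})"
    if "j < p" for i j
  proof (cases "j = 0")
    case True thus ?thesis using p_ge_2 by simp
  next
    case False
    have "p * i + (p * m + 1) * j = p * (i + m * j) + j" by (simp add: algebra_simps)
    also have "\<dots> \<le> p * M \<longleftrightarrow> i + m * j < M"
    proof
      assume a: "p * (i + m * j) + j \<le> p * M"
      hence "p * (i + m * j) < p * M" using False by linarith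
      thus "i + m * j < M" by simp
    next
      assume "i + m * j < M"
      hence "p * (i + m * j + 1) \<le> p * M" by (intro mult_le_mono2) simp
      thus "p * (i + m * j) + j \<le> p * M" using that by simp
    qed
    finally show ?thesis using False by (auto simp: less_diff_conv)
  qed
  have "card (exponents M) = card (SIGMA j:{..<p}. {i. p * i + (p * m + 1) * j \<le> p * M})"
    unfolding exponents_eq by simp
  also have "(SIGMA j:{..<p}. {i. p * i + (p * m + 1) * j \<le> p * M})
    = (SIGMA j:{..<p}. if j = 0 then {..M} else {..<M - m * j})"
    using le_iff by (intro Sigma_cong) auto
  also have "card \<dots> = (\<Sum>j<p. if j = 0 then M + 1 else M - m * j)"
    by (subst card_SigmaI) (auto intro: sum.cong)
  finally have "card (exponents M) + gap_number = (\<Sum>j<p. (if j = 0 then M + 1 else M - m * j) + m * j)"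
    by (simp add: gap_number_def sum.distrib)
  also have "\<dots> = (\<Sum>j<p. M + (if j = 0 then 1 else 0))"
  proof (rule sum.cong[OF refl])
    fix j assume "j \<in> {..<p}"
    hence "m * j \<le> M" using assms by (intro order.trans[OF mult_le_mono2[of j p m]]) (auto simp: mult.commute)
    thus "(if j = 0 then M + 1 else M - m * j) + m * j = M + (if j = 0 then 1 else 0)" by simp
  qed
  also have "\<dots> = p * M + 1" using p_ge_2 by (simp add: sum.distrib)
  finally show ?thesis .
qed

definition basis_fun :: "'a ffield \<Rightarrow> nat \<times> nat \<Rightarrow> 'a ffield" where
  "basis_fun h ij = of_poly (monom 1 (fst ij)) * y ^ snd ij / h"

lemma basis_fun_sum:
  assumes "finite I"
  shows "(\<Sum>ij\<in>I. const (c ij) * basis_fun h ij) = ev (\<Sum>ij\<in>I. monom (monom (c ij) (fst ij)) (snd ij)) / h"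
proof -
  have ev_sum_set: "ev (sum g I) = (\<Sum>i\<in>I. ev (g i))" for g
    by (induction I rule: infinite_finite_induct) simp_all
  have "const a * of_poly (monom 1 i) = of_poly (monom a i)" for a :: 'a and i
    unfolding const_def of_poly_simps(6)[symmetric] by (simp add: smult_monom)
  thus ?thesis
    by (simp add: ev_sum_set basis_fun_def sum_divide_distrib mult.assoc[symmetric])
qed

lemma coeff_basis_sum:
  assumes "finite I"
  shows "coeff (coeff (\<Sum>ij\<in>I. monom (monom (c ij) (fst ij)) (snd ij)) j) i = (if (i, j) \<in> I then c (i, j) else 0)"
proof -
  have "coeff (coeff (\<Sum>ij\<in>I. monom (monom (c ij) (fst ij)) (snd ij)) j) i
    = (\<Sum>ij\<in>I. if ij = (i, j) then c ij else 0)"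
    unfolding coeff_sum by (intro sum.cong) (auto simp: coeff_sum)
  thus ?thesis using assms by simp
qed

lemma basis_fun_independent:
  assumes "h \<noteq> 0" "I \<subseteq> exponents M" and zero: "(\<Sum>ij\<in>I. const (c ij) * basis_fun h ij) = 0" and "ij \<in> I"
  shows "c ij = 0"
proof -
  have I: "finite I" using finite_subset[OF assms(2) finite_exponents] .
  define P where "P = (\<Sum>ij\<in>I. monom (monom (c ij) (fst ij)) (snd ij))"
  have "ev P = 0" using zero assms(1) unfolding basis_fun_sum[OF I] P_def by simp
  moreover have "degree P < p"
  proof -
    have "degree P \<le> p - 1"
      unfolding P_def using assms(2)
      by (intro degree_sum_le I order.trans[OF degree_monom_le]) (auto simp: exponents_def)
    thus ?thesis using p_ge_2 by linarith
  qed
  ultimately have "P = 0" using U.infinity.ev_nonzero[of P] by auto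
  hence "coeff (coeff P (snd ij)) (fst ij) = 0" by simp
  thus ?thesis using assms(4) unfolding P_def coeff_basis_sum[OF I] by simp
qed

lemma inj_basis_fun:
  assumes "h \<noteq> 0"
  shows "inj_on (basis_fun h) (exponents M)"
proof (rule inj_onI, rule ccontr)
  fix a b assume ab: "a \<in> exponents M" "b \<in> exponents M" "basis_fun h a = basis_fun h b" "a \<noteq> b"
  have "(\<Sum>ij\<in>{a, b}. const (if ij = a then 1 else - 1) * basis_fun h ij) = 0"
    using ab by simp
  from basis_fun_independent[OF assms _ this, of M a] ab show False by simp
qed

text \<open>Multiplication by \<open>h\<close> clears all poles at affine points, so
  \<open>z * h\<close> is a polynomial. Its order at infinity bounds every monomial separately
  because distinct monomials have distinct pole orders.\<close>

lemma RR_shifted: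
  assumes "h \<in> U.L" "h \<noteq> 0"
  shows "RR (shifted h M) = vs.span (basis_fun h ` exponents M)"
proof (intro equalityI subsetI)
  fix z assume z: "z \<in> RR (shifted h M)"
  have zL: "z \<in> U.L" using z by (simp add: RR_space_def)
  have pts: "z * h \<in> U.point_place Q" if Q: "Q \<in> U.points" for Q
  proof -
    have V: "U.point_place Q \<in> pls" using Q places_UNIV by blast
    interpret V: val_ring U.L "U.point_place Q" using V by (rule place_val_ring)
    show ?thesis
    proof (cases "z = 0")
      case False
      have ne: "U.point_place Q \<noteq> U.infinity" using U.infinity_not_point_place Q by blast
      have "place_val (U.point_place Q) z \<ge> - place_val (U.point_place Q) h"
        using z V False ne bspec[of pls "\<lambda>V. place_val V z \<ge> - shifted h M V", OF _ V]
        by (simp add: RR_space_def shifted_def)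
      hence "place_val (U.point_place Q) (z * h) \<ge> 0"
        using place_val_mult[OF V zL assms(1) False assms(2)] by simp
      thus ?thesis
        using param_powi_mult_iff(1)[OF V U.L.mult_mem[OF zL assms(1)], of 0] False assms(2) by simp
    qed (simp add: V.V.zero_mem)
  qed
  obtain P where P: "z * h = ev P" "degree P < p"
    using regular_imp_polynomial[OF U.L.mult_mem[OF zL assms(1)] pts] .
  have wt: "wt P \<ge> - int (p * M)" if "P \<noteq> 0"
  proof -
    have V: "U.infinity \<in> pls" using places_UNIV by blast
    have "ev P \<noteq> 0" using U.infinity.ev_nonzero P that by simp
    hence z0: "z \<noteq> 0" using P by auto
    have "place_val U.infinity z \<ge> - place_val U.infinity h - int (p * M)"
      using z V z0 by (auto simp: RR_space_def shifted_def)
    moreover have "place_val U.infinity (ev P) = wt P"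
      using U.infinity.place_val_infinity[OF U.infinity.has_val_ev] P that by simp
    ultimately show ?thesis
      using place_val_mult[OF V zL assms(1) z0 assms(2)] P by simp
  qed
  define c where "c = (\<lambda>ij. coeff (coeff P (snd ij)) (fst ij))"
  have supp: "(i, j) \<in> exponents M" if "coeff (coeff P j) i \<noteq> 0" for i j
  proof -
    have "coeff P j \<noteq> 0" using that by auto
    hence "P \<noteq> 0" "j \<le> degree P" by (auto intro: le_degree)
    moreover have "i \<le> degree (coeff P j)" using that by (rule le_degree)
    hence "p * i \<le> p * degree (coeff P j)" by simp
    moreover have "int (p * degree (coeff P j) + (p * m + 1) * j) \<le> int (p * M)"
      using wt_le[OF \<open>coeff P j \<noteq> 0\<close>] wt[OF \<open>P \<noteq> 0\<close>] by linarith
    hence "p * degree (coeff P j) + (p * m + 1) * j \<le> p * M" by (simp only: of_nat_le_iff)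
    ultimately have "j < p" "p * i + (p * m + 1) * j \<le> p * M" using P(2) by linarith+
    thus ?thesis by (simp add: exponents_def)
  qed
  have "P = (\<Sum>ij\<in>exponents M. monom (monom (c ij) (fst ij)) (snd ij))"
    using supp by (intro poly_eqI) (auto simp: coeff_basis_sum[OF finite_exponents] c_def)
  hence "z = (\<Sum>ij\<in>exponents M. const (c ij) * basis_fun h ij)"
    using P(1) assms(2) unfolding basis_fun_sum[OF finite_exponents] by (simp add: field_simps)
  also have "\<dots> \<in> vs.span (basis_fun h ` exponents M)"
    by (intro vs.span_sum vs.span_scale vs.span_base) auto
  finally show "z \<in> vs.span (basis_fun h ` exponents M)" .
next
  fix z assume "z \<in> vs.span (basis_fun h ` exponents M)"
  moreover have "basis_fun h ` exponents M \<subseteq> RR (shifted h M)"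
  proof (intro subsetI, elim imageE)
    fix b ij assume b: "b = basis_fun h ij" "ij \<in> exponents M"
    define P :: "'a poly poly" where "P = monom (monom 1 (fst ij)) (snd ij)"
    have P: "b * h = ev P" using assms(2) by (simp add: b basis_fun_def P_def)
    have degP: "degree P < p" and P0: "P \<noteq> 0"
      using b(2) by (auto simp: P_def exponents_def degree_monom_eq)
    have evP: "ev P \<noteq> 0" using U.infinity.ev_nonzero degP P0 by simp
    hence b0: "b \<noteq> 0" using P by auto
    have "b = ev P / h" using P assms(2) by (simp add: field_simps)
    hence bL: "b \<in> U.L" using assms(1) U.ev_in_L by (auto intro: U.L.divide_mem)
    have "place_val V b \<ge> - shifted h M V" if V: "V \<in> pls" for V
    proof -
      have sum: "place_val V (ev P) = place_val V b + place_val V h"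
        using place_val_mult[OF V bL assms(1) b0 assms(2)] P by simp
      show ?thesis
      proof (cases "V = U.infinity")
        case True
        have "place_val V (ev P) = wt P"
          unfolding True using U.infinity.place_val_infinity[OF U.infinity.has_val_ev] degP P0 by simp
        moreover obtain j where j: "coeff P j \<noteq> 0" "wt P = - int (p * degree (coeff P j) + (p * m + 1) * j)"
          using wt_attained[OF P0] .
        hence "j = snd ij" "degree (coeff P j) = fst ij"
          by (auto simp: P_def degree_monom_eq split: if_splits)
        hence "wt P \<ge> - int (p * M)" using j(2) b(2) by (auto simp: exponents_def simp del: of_nat_add of_nat_mult)
        ultimately show ?thesis using sum V True by (simp add: shifted_def)
      next
        case False
        then obtain Q where Q: "Q \<in> U.points" "V = U.point_place Q" using V places_UNIV by blast
        have "ev P \<in> V" unfolding Q(2) by (rule ev_in_point_place[OF Q(1)])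
        hence "place_val V (ev P) \<ge> 0"
          using param_powi_mult_iff(1)[OF V _ evP, of 0] U.ev_in_L[of P] by simp
        thus ?thesis using sum V False by (simp add: shifted_def)
      qed
    qed
    thus "b \<in> RR (shifted h M)" using bL by (simp add: RR_space_def)
  qed
  ultimately show "z \<in> RR (shifted h M)" using vs.span_minimal[OF _ subspace_RR] by blast
qed

lemma dim_RR_shifted:
  assumes "h \<in> U.L" "h \<noteq> 0" "M \<ge> p * m"
  shows "int (vs.dim (RR (shifted h M))) = int (p * M) + 1 - int gap_number"
proof -
  have "vs.independent (basis_fun h ` exponents M)"
  proof (rule vs.independent_if_scalars_zero)
    show "finite (basis_fun h ` exponents M)" using finite_exponents by simp
    fix c b assume "(\<Sum>b\<in>basis_fun h ` exponents M. const (c b) * b) = 0" "b \<in> basis_fun h ` exponents M"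
    then obtain ij where ij: "b = basis_fun h ij" "ij \<in> exponents M"
      "(\<Sum>ij\<in>exponents M. const (c (basis_fun h ij)) * basis_fun h ij) = 0"
      by (auto simp: sum.reindex[OF inj_basis_fun[OF assms(2)]])
    thus "c b = 0"
      using basis_fun_independent[OF assms(2) order.refl, where c = "\<lambda>ij. c (basis_fun h ij)"] by blast
  qed
  hence "vs.dim (RR (shifted h M)) = card (basis_fun h ` exponents M)"
    unfolding RR_shifted[OF assms(1,2)] by (rule vs.dim_span_eq_card_independent)
  also have "\<dots> = card (exponents M)" by (rule card_image[OF inj_basis_fun[OF assms(2)]])
  finally show ?thesis using card_exponents[OF assms(3)] by linarith
qed

end

context AS_curve
begin

lemma place_val_point_of_poly:
  assumes "Q \<in> U.points" "poly H (fst Q) \<noteq> 0"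
  shows "place_val (U.point_place Q) (of_poly ([:- fst Q, 1:] ^ n * H)) = int n"
proof -
  interpret P: AS_point p m f UNIV "fst Q" "snd Q" using assms(1) by (rule U.AS_point_points)
  have s: "P.s = of_poly [:- fst Q, 1:]" by (simp add: P.s_eq)
  have "of_poly ([:- fst Q, 1:] ^ n * H) = P.s powi int n * (ev [:H:] / ev 1)"
    by (simp add: s del: mult_pCons_left)
  moreover have "ev [:H:] / ev 1 \<in> P.\<O> - max_ideal P.\<O>"
    using assms(2) by (intro P.unit_\<O>I) simp_all
  ultimately have "P.\<O>.has_val P.s (of_poly ([:- fst Q, 1:] ^ n * H)) (int n)"
    unfolding P.\<O>.has_val_def by blast
  from P.place_val_\<O>[OF this] show ?thesis by (simp add: U.point_place_def)
qed

text \<open>\<open>H\<close> vanishes to order \<open>N\<close> at each of the \<open>p\<close>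
  points over each \<open>\<alpha>\<close> in \<open>S\<close>, and its pole at infinity balances
  this, so the degree is that of the pole bound alone. Enough freedom in \<open>S\<close>,
  \<open>N\<close> and \<open>M\<close> lets these divisors dominate any given one.\<close>

lemma shifted_divisor:
  fixes S :: "'a set" and N M :: nat
  assumes "finite S"
  defines "H \<equiv> \<Prod>\<alpha>\<in>S. [:- \<alpha>, 1:] ^ N"
  defines "E \<equiv> shifted (of_poly H) M"
  shows "E U.infinity = int p * (int M - int N * int (card S))"
    and "\<And>Q. Q \<in> U.points \<Longrightarrow> E (U.point_place Q) = (if fst Q \<in> S then int N else 0)"
    and "E \<in> divisors (range const) U.L" "div_degree E = int (p * M)" "of_poly H \<noteq> (0 :: 'a ffield)"
proof -
  have H0: "H \<noteq> 0" using assms(1) by (simp add: H_def)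
  thus "of_poly H \<noteq> (0 :: 'a ffield)" by simp
  have "degree H = (\<Sum>\<alpha>\<in>S. degree ([:- \<alpha>, 1:] ^ N))"
    unfolding H_def by (rule degree_prod_eq_sum_degree) simp
  hence degH: "degree H = N * card S" by (simp add: degree_linear_power)
  have "U.infinity \<in> pls" using places_UNIV by blast
  moreover have "place_val U.infinity (of_poly H) = - int (p * degree H)"
    using H0 by (intro U.infinity.place_val_infinity U.infinity.has_val_of_poly) simp_all
  ultimately show inf: "E U.infinity = int p * (int M - int N * int (card S))"
    by (simp add: E_def shifted_def degH algebra_simps)
  show pt: "E (U.point_place Q) = (if fst Q \<in> S then int N else 0)" if Q: "Q \<in> U.points" for Q
  proof -
    have "U.point_place Q \<noteq> U.infinity" using U.infinity_not_point_place Q by blast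
    moreover have "U.point_place Q \<in> pls" using places_UNIV Q by blast
    ultimately have E: "E (U.point_place Q) = place_val (U.point_place Q) (of_poly H)"
      by (simp add: E_def shifted_def)
    show ?thesis
    proof (cases "fst Q \<in> S")
      case True
      have "H = [:- fst Q, 1:] ^ N * (\<Prod>\<alpha>\<in>S - {fst Q}. [:- \<alpha>, 1:] ^ N)"
        unfolding H_def using assms(1) True by (rule prod.remove)
      moreover have "poly (\<Prod>\<alpha>\<in>S - {fst Q}. [:- \<alpha>, 1:] ^ N) (fst Q) \<noteq> 0"
        using assms(1) by (simp add: poly_prod)
      ultimately show ?thesis unfolding E using place_val_point_of_poly[OF Q] True by metis
    next
      case False
      have "poly H (fst Q) \<noteq> 0" using assms(1) False by (auto simp: H_def poly_prod)
      from place_val_point_of_poly[OF Q this, of 0] show ?thesis unfolding E using False by simp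
    qed
  qed
  define T where "T = {Q \<in> U.points. fst Q \<in> S}"
  have T: "T = Sigma S (\<lambda>\<alpha>. {\<beta>. (\<alpha>, \<beta>) \<in> U.points})" by (auto simp: T_def)
  have finT: "finite T" unfolding T using assms(1) finite_fibre by (intro finite_SigmaI)
  have cardT: "card T = p * card S"
    unfolding T using assms(1) finite_fibre by (subst card_SigmaI) (simp_all add: card_fibre)
  have supp: "{V. E V \<noteq> 0} \<subseteq> insert U.infinity (U.point_place ` T)"
  proof
    fix V assume V: "V \<in> {V. E V \<noteq> 0}"
    hence "V \<in> pls" by (auto simp: E_def shifted_def split: if_splits)
    hence "V = U.infinity \<or> V \<in> U.point_place ` U.points" using places_UNIV by auto
    thus "V \<in> insert U.infinity (U.point_place ` T)"
      using V pt by (auto simp: T_def split: if_splits)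
  qed
  moreover have fin: "finite (insert U.infinity (U.point_place ` T))" using finT by simp
  ultimately have "finite {V. E V \<noteq> 0}" by (rule finite_subset)
  moreover have "{V. E V \<noteq> 0} \<subseteq> pls" by (auto simp: E_def shifted_def)
  ultimately show "E \<in> divisors (range const) U.L" by (simp add: divisors_def)
  have "U.infinity \<notin> U.point_place ` T" using U.infinity_not_point_place by (auto simp: T_def)
  hence "div_degree E = E U.infinity + sum E (U.point_place ` T)"
    using div_degree_eq[OF fin supp] finT by simp
  also have "sum E (U.point_place ` T) = (\<Sum>Q\<in>T. E (U.point_place Q))"
    using U.inj_point_place by (subst sum.reindex) (auto simp: T_def intro: inj_on_subset)
  also have "\<dots> = (\<Sum>Q\<in>T. int N)" by (intro sum.cong) (auto simp: pt T_def)
  also have "\<dots> = int p * int N * int (card S)" by (simp add: cardT)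
  finally show "div_degree E = int (p * M)" by (simp add: inf algebra_simps)
qed

lemma RR_dim_eq: "RR_dim U.L D = vs.dim (RR D)"
  by (simp add: RR_dim_def)

text \<open>For \<open>D \<le> E\<close> the inequality \<open>RR_dim_le\<close> bounds degree minus
  dimension for \<open>D\<close> by the same difference for \<open>E\<close>, and for a large
  \<open>shifted\<close> divisor that difference is \<open>gap_number - 1\<close>.\<close>

theorem genus_eq_gap_number: "genus U.L = int gap_number"
proof -
  let ?g = "\<lambda>D. div_degree D - int (RR_dim U.L D) + 1"
  have dim: "int (RR_dim U.L (shifted (of_poly H) M)) = int (p * M) + 1 - int gap_number"
    if "of_poly H \<noteq> (0 :: 'a ffield)" "M \<ge> p * m" for H M
    unfolding RR_dim_eq using that U.ev_in_L[of "[:H:]"] by (intro dim_RR_shifted) simp_all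
  have le: "?g D \<le> int gap_number" if D: "D \<in> divisors (range const) U.L" for D
  proof -
    define T where "T = {Q \<in> U.points. D (U.point_place Q) \<noteq> 0}"
    have fin: "finite {V. D V \<noteq> 0}" and sub: "{V. D V \<noteq> 0} \<subseteq> pls" using D by (auto simp: divisors_def)
    have "finite (U.point_place ` T)" using fin by (rule finite_subset[rotated]) (auto simp: T_def)
    moreover have "inj_on U.point_place T" using U.inj_point_place by (auto simp: T_def intro: inj_on_subset)
    ultimately have finT: "finite T" using finite_image_iff by blast
    define S where "S = fst ` T"
    define N where "N = nat (\<Sum>V | D V \<noteq> 0. \<bar>D V\<bar>)"
    have N: "D V \<le> int N" for V
    proof (cases "D V = 0")
      case False
      hence "\<bar>D V\<bar> \<le> (\<Sum>V | D V \<noteq> 0. \<bar>D V\<bar>)" using fin by (intro member_le_sum) auto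
      thus ?thesis by (simp add: N_def)
    qed simp
    \<comment> \<open>This choice gives \<open>E\<close> the coefficient
      \<open>p * (N + p * m)\<close> at infinity, which is at least \<open>N\<close> and so
      dominates \<open>D\<close> there, and it satisfies \<open>M \<ge> p * m\<close>.\<close>
    define M where "M = N + N * card S + p * m"
    define H where "H = (\<Prod>\<alpha>\<in>S. [:- \<alpha>, 1:] ^ N)"
    define E where "E = shifted (of_poly H) M"
    have finS: "finite S" using finT by (simp add: S_def)
    note E = shifted_divisor(1-4)[OF finS, where N = N and M = M, folded H_def, folded E_def]
      and H_nonzero = shifted_divisor(5)[OF finS, where N = N, folded H_def]
    have DE: "D V \<le> E V" for V
    proof (cases "V \<in> pls")
      case False
      hence "D V = 0" using sub by auto
      thus ?thesis using False by (simp add: E_def shifted_def)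
    next
      case True
      then consider "V = U.infinity" | Q where "Q \<in> U.points" "V = U.point_place Q"
        using places_UNIV by blast
      thus ?thesis
      proof cases
        case 1
        have "int N \<le> int (N + p * m)" by simp
        also have "\<dots> \<le> int (p * (N + p * m))" using p_ge_2 unfolding of_nat_le_iff by simp
        also have "\<dots> = E V" unfolding 1 E(1) by (simp add: M_def algebra_simps)
        finally show ?thesis using N[of V] by linarith
      next
        case (2 Q)
        have "fst Q \<in> S" if "D V \<noteq> 0" using that 2 by (auto simp: S_def T_def)
        thus ?thesis using N[of V] 2 E(2)[OF 2(1)] by (cases "D V = 0") auto
      qed
    qed
    have "RR E \<subseteq> vs.span (basis_fun (of_poly H) ` exponents M)"
      unfolding E_def using H_nonzero U.ev_in_L[of "[:H:]"] by (subst RR_shifted) simp_all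
    from RR_dim_le[OF D E(3) DE _ this] finite_exponents
    have "int (RR_dim U.L E) \<le> int (RR_dim U.L D) + (div_degree E - div_degree D)"
      by (simp add: RR_dim_eq)
    moreover have "int (RR_dim U.L E) = int (p * M) + 1 - int gap_number"
      unfolding E_def by (intro dim H_nonzero) (simp add: M_def)
    ultimately show ?thesis using E(4) by linarith
  qed
  \<comment> \<open>With the empty set this is a multiple of infinity, and it attains the
    bound.\<close>
  define E where "E = shifted (of_poly (\<Prod>\<alpha>\<in>{}. [:- \<alpha>, 1:] ^ 0)) (p * m)"
  note E = shifted_divisor(3,4)[OF finite.emptyI, where N = 0 and M = "p * m", folded E_def]
  have "?g E = int gap_number"
    using E(2) dim[OF shifted_divisor(5)[OF finite.emptyI, of 0] order.refl, folded E_def] by simp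
  thus ?thesis
    unfolding genus_def using le E(1) by (intro cSup_eq_maximum) (auto intro!: image_eqI[of _ _ E])
qed

theorem AS_genus_eq: "2 * AS_genus p f = int (p * m * (p - 1))"
proof -
  have "2 * gap_number = m * (2 * (\<Sum>j<p. j))"
    by (simp add: gap_number_def sum_distrib_left mult_ac)
  also have "2 * (\<Sum>j<p. j) = p * (p - 1)"
    using gauss_sum_nat[of "p - 1"] p_ge_2
    by (simp add: atLeast0AtMost lessThan_Suc_atMost[symmetric] mult_ac)
  finally have "2 * gap_number = p * m * (p - 1)" by (simp add: mult_ac)
  hence "2 * int gap_number = int (p * m * (p - 1))" by linarith
  thus ?thesis unfolding AS_genus_def U.L_def[symmetric] by (simp add: genus_eq_gap_number)
qed

end

section \<open>Traces and quadratic forms in characteristic two\<close>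

text \<open>Every fibre of \<open>h\<close> is a translate of the kernel, so a condition on
  \<open>h x\<close> may be counted on the image.\<close>

lemma card_additive_fibres:
  fixes h :: "'a::ab_group_add \<Rightarrow> 'b::ab_group_add"
  assumes "finite G" "0 \<in> G" "\<And>a b. a \<in> G \<Longrightarrow> b \<in> G \<Longrightarrow> a - b \<in> G"
    and "\<And>a b. a \<in> G \<Longrightarrow> b \<in> G \<Longrightarrow> h (a - b) = h a - h b"
  shows "card {x \<in> G. P (h x)} = card {x \<in> G. h x = 0} * card {w \<in> h ` G. P w}"
proof -
  have h0: "h 0 = 0" using assms(4)[OF assms(2,2)] by simp
  have neg: "- a \<in> G" if "a \<in> G" for a using assms(3)[OF assms(2) that] by simp
  have add: "a + b \<in> G" "h (a + b) = h a + h b" if "a \<in> G" "b \<in> G" for a b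
    using assms(3)[OF that(1) neg[OF that(2)]] assms(4)[OF that(1) neg[OF that(2)]]
      assms(4)[OF assms(2) that(2)] by (simp_all add: h0)
  have fib: "card {x \<in> G. h x = h a} = card {x \<in> G. h x = 0}" if a: "a \<in> G" for a
  proof (rule bij_betw_same_card)
    show "bij_betw (\<lambda>x. x - a) {x \<in> G. h x = h a} {x \<in> G. h x = 0}"
      by (rule bij_betw_byWitness[of _ "\<lambda>x. x + a"]) (use a assms(3,4) add in auto)
  qed
  have "{x \<in> G. P (h x)} = (\<Union>w\<in>{w \<in> h ` G. P w}. {x \<in> G. h x = w})" by auto
  also have "card \<dots> = (\<Sum>w\<in>{w \<in> h ` G. P w}. card {x \<in> G. h x = w})"
    using assms(1) by (intro card_UN_disjoint) auto
  also have "\<dots> = (\<Sum>w\<in>{w \<in> h ` G. P w}. card {x \<in> G. h x = 0})"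
    using fib by (intro sum.cong) auto
  finally show ?thesis by simp
qed

lemma card_additive_image:
  fixes h :: "'a::ab_group_add \<Rightarrow> 'b::ab_group_add"
  assumes "finite G" "0 \<in> G" "\<And>a b. a \<in> G \<Longrightarrow> b \<in> G \<Longrightarrow> a - b \<in> G"
    and "\<And>a b. a \<in> G \<Longrightarrow> b \<in> G \<Longrightarrow> h (a - b) = h a - h b"
  shows "card G = card {x \<in> G. h x = 0} * card (h ` G)"
  using card_additive_fibres[OF assms, of "\<lambda>_. True"] by simp

locale char_two_tower =
  fixes p q k r :: nat and t :: "'a::alg_closed_field"
  assumes p_eq: "p = 2 ^ k" and k: "k \<ge> 1" and q_eq: "q = p ^ r" and r: "r \<ge> 1"
    and char2: "CHAR('a) = 2" and t: "t \<in> GF q" and trace_t: "gf_trace 2 (k * r) t = 1"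
begin

lemma two [simp]: "(2 :: 'a) = 0"
  using char2 of_nat_CHAR[where 'a = 'a] by simp

lemma add_self [simp]: "(a :: 'a) + a = 0"
  using two by (metis mult_2 mult_zero_left)

lemma minus_eq: "(a :: 'a) - b = a + b"
  by (simp add: diff_eq_eq add.assoc)

lemma uminus_eq [simp]: "- (a :: 'a) = a"
  using minus_eq[of 0 a] by simp

lemma add_eq_0_iff2: "(a :: 'a) + b = 0 \<longleftrightarrow> a = b"
  by (simp flip: minus_eq)

lemma add_self_left [simp]: "(a :: 'a) + (a + b) = b"
  by (simp flip: add.assoc)

lemma p_ge_2: "p \<ge> 2"
  unfolding p_eq using k self_le_power[of 2 k] power_increasing[of 1 k "2::nat"] by simp

lemma q_pow: "q = 2 ^ (k * r)"
  by (simp add: q_eq p_eq power_mult)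

lemma power_two_add: "((a :: 'a) + b) ^ (2 ^ n) = a ^ (2 ^ n) + b ^ (2 ^ n)"
proof (induction n arbitrary: a b)
  case (Suc n)
  have "(a + b)\<^sup>2 = a\<^sup>2 + b\<^sup>2" by (simp add: power2_sum two)
  thus ?case using Suc[of "a\<^sup>2" "b\<^sup>2"] by (simp add: power_mult)
qed simp

lemma p_pow: "p ^ i = 2 ^ (k * i)"
  by (simp add: p_eq power_mult)

lemma frob_add [simp]: "((a :: 'a) + b) ^ (p ^ i) = a ^ (p ^ i) + b ^ (p ^ i)"
  unfolding p_pow by (rule power_two_add)

lemma frob_add_p [simp]: "((a :: 'a) + b) ^ p = a ^ p + b ^ p"
  using frob_add[of a b 1] by simp

lemma frob_add_q [simp]: "((a :: 'a) + b) ^ q = a ^ q + b ^ q"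
  unfolding q_eq by simp

lemma frob_0 [simp]: "(0 :: 'a) ^ (p ^ i) = 0" "(0 :: 'a) ^ p = 0" "(0 :: 'a) ^ q = 0"
  using p_ge_2 by (auto simp: q_eq power_0_left)

lemma frob_sum: "(\<Sum>i\<in>I. h i :: 'a) ^ (p ^ n) = (\<Sum>i\<in>I. h i ^ (p ^ n))"
  by (induction I rule: infinite_finite_induct) simp_all

lemma frob_inj: "(a :: 'a) ^ (p ^ i) = b ^ (p ^ i) \<longleftrightarrow> a = b"
proof
  assume "a ^ (p ^ i) = b ^ (p ^ i)"
  hence "(a + b) ^ (p ^ i) = 0" by simp
  hence "a + b = 0" by (simp del: frob_add)
  thus "a = b" by (simp add: add_eq_0_iff2)
qed simp

lemma subfield_GF: "subfield_set (GF (p ^ n) :: 'a set)"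
proof
  show "1 \<in> (GF (p ^ n) :: 'a set)" by (simp add: GF_def)
  fix a b :: 'a assume ab: "a \<in> GF (p ^ n)" "b \<in> GF (p ^ n)"
  thus "a - b \<in> GF (p ^ n)" by (simp add: GF_def minus_eq)
  show "a * b \<in> GF (p ^ n)" using ab by (simp add: GF_def power_mult_distrib)
next
  fix a :: 'a assume "a \<in> GF (p ^ n)"
  thus "inverse a \<in> GF (p ^ n)" by (simp add: GF_def power_inverse)
qed

lemma card_GF: "n \<ge> 1 \<Longrightarrow> card (GF (p ^ n) :: 'a set) = p ^ n"
  and finite_GF: "n \<ge> 1 \<Longrightarrow> finite (GF (p ^ n) :: 'a set)"
proof -
  assume n: "n \<ge> 1"
  have pn: "p ^ n \<ge> 2" using n p_ge_2 self_le_power[of p n] by linarith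
  have "of_nat (p ^ n) = (0 :: 'a)" using n k by (simp add: p_pow two)
  from card_AS_fibre[OF pn this, of 0] show c: "card (GF (p ^ n) :: 'a set) = p ^ n"
    by (simp add: GF_def)
  thus "finite (GF (p ^ n) :: 'a set)" using pn by (metis card.infinite not_numeral_le_zero)
qed

lemma q2_eq: "q\<^sup>2 = p ^ (2 * r)"
  by (simp add: q_eq power_mult[symmetric] mult.commute)

abbreviation "Fp \<equiv> GF p :: 'a set"
abbreviation "Fq \<equiv> GF q :: 'a set"
abbreviation "Fqq \<equiv> GF (q\<^sup>2) :: 'a set"

lemma q_ge_2: "q \<ge> 2"
  unfolding q_eq using r p_ge_2 self_le_power[of p r] by linarith

sublocale Fp: subfield_set Fp using subfield_GF[of 1] by simp
sublocale Fq: subfield_set Fq using subfield_GF[of r] by (simp add: q_eq)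
sublocale Fqq: subfield_set Fqq using subfield_GF[of "2 * r"] by (simp add: q2_eq)

lemma card_Fp: "card Fp = p" using card_GF[of 1] by simp
lemma card_Fq: "card Fq = q" using card_GF[of r] r by (simp add: q_eq)
lemma card_Fqq: "card Fqq = q\<^sup>2" using card_GF[of "2 * r"] r by (simp add: q2_eq)
lemma finite_Fp: "finite Fp" using finite_GF[of 1] by simp
lemma finite_Fq: "finite Fq" using finite_GF[of r] r by (simp add: q_eq)
lemma finite_Fqq: "finite Fqq" using finite_GF[of "2 * r"] r by (simp add: q2_eq)

lemma Fq_sub_Fqq: "Fq \<subseteq> Fqq"
  by (auto simp: GF_def power2_eq_square power_mult)

lemma Fp_frob: "c \<in> Fp \<Longrightarrow> c ^ (p ^ i) = c"
  by (induction i) (auto simp: GF_def power_mult)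

lemma frob_mem: "z \<in> GF n \<Longrightarrow> z ^ i \<in> (GF n :: 'a set)"
  unfolding GF_def by (simp add: power_mult[symmetric] mult.commute[of i]) (simp add: power_mult)

abbreviation "T \<equiv> gf_trace p (2 * r) :: 'a \<Rightarrow> 'a"
abbreviation "Tq \<equiv> gf_trace p r :: 'a \<Rightarrow> 'a"

lemma trace_add [simp]: "gf_trace p n (a + b) = gf_trace p n a + gf_trace p n (b :: 'a)"
  by (simp add: gf_trace_def sum.distrib)

lemma trace_0 [simp]: "gf_trace p n (0 :: 'a) = 0"
  by (simp add: gf_trace_def)

lemma trace_sum: "gf_trace p n (\<Sum>i\<in>I. h i :: 'a) = (\<Sum>i\<in>I. gf_trace p n (h i))"
  by (induction I rule: infinite_finite_induct) simp_all

lemma trace_scale: "c \<in> Fp \<Longrightarrow> gf_trace p n (c * z) = c * gf_trace p n z"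
  by (simp add: gf_trace_def power_mult_distrib Fp_frob sum_distrib_left)

lemma trace_square: "gf_trace p n (z\<^sup>2 :: 'a) = (gf_trace p n z)\<^sup>2"
proof -
  have "(\<Sum>i\<in>I. h i :: 'a)\<^sup>2 = (\<Sum>i\<in>I. (h i)\<^sup>2)" for I :: "nat set" and h
    using power_two_add[where n = 1]
    by (induction I rule: infinite_finite_induct) simp_all
  thus ?thesis by (simp add: gf_trace_def power_mult[symmetric] mult.commute)
qed

text \<open>The sum telescopes, addition and subtraction being the same.\<close>

lemma trace_AS: "gf_trace p n (z ^ p + z) = z ^ (p ^ n) + (z :: 'a)"
  by (induction n) (simp_all add: gf_trace_def power_mult[symmetric] add.assoc)

lemma trace_frob_p: "z \<in> GF (p ^ n) \<Longrightarrow> gf_trace p n (z ^ p) = gf_trace p n (z :: 'a)"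
  using trace_AS[of n z] by (simp add: GF_def add_eq_0_iff2)

lemma trace_frob: "z \<in> GF (p ^ n) \<Longrightarrow> gf_trace p n (z ^ (p ^ i)) = gf_trace p n (z :: 'a)"
proof (induction i)
  case (Suc i)
  have "gf_trace p n ((z ^ (p ^ i)) ^ p) = gf_trace p n (z ^ (p ^ i))"
    using Suc.prems by (intro trace_frob_p frob_mem)
  thus ?case using Suc by (simp add: power_mult[symmetric] mult.commute)
qed simp

lemma trace_in_Fp: "z \<in> GF (p ^ n) \<Longrightarrow> gf_trace p n (z :: 'a) \<in> Fp"
proof -
  assume z: "z \<in> GF (p ^ n)"
  have "(gf_trace p n z) ^ p = gf_trace p n (z ^ p)"
    using frob_sum[of "\<lambda>i. z ^ (p ^ i)" "{..<n}" 1]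
    by (simp add: gf_trace_def power_mult[symmetric] mult.commute)
  thus ?thesis using trace_frob_p[OF z] by (simp add: GF_def)
qed

lemma T_eq: "T z = Tq (z + z ^ q)"
proof -
  have "T z = (\<Sum>i<r + r. z ^ (p ^ i))" by (simp add: gf_trace_def mult_2)
  also have "\<dots> = (\<Sum>i<r. z ^ (p ^ i)) + (\<Sum>i<r. z ^ (p ^ (r + i)))"
    by (simp add: sum.nat_group lessThan_atLeast0 sum.atLeastLessThan_concat[symmetric, of 0 r "r + r"]
        sum.shift_bounds_nat_ivl[of _ 0 r r, simplified] add.commute)
  also have "(\<Sum>i<r. z ^ (p ^ (r + i))) = (\<Sum>i<r. (z ^ q) ^ (p ^ i))"
    by (simp add: q_eq power_add power_mult)
  finally show ?thesis by (simp add: gf_trace_def sum.distrib)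
qed

text \<open>In characteristic two the relative trace \<open>z + z ^ q\<close> kills
  \<open>Fq\<close>. This is the source of the totally singular space.\<close>

lemma T_Fq: "z \<in> Fq \<Longrightarrow> T z = 0"
  by (simp add: T_eq GF_def)

text \<open>Additive Hilbert 90. By \<open>trace_AS\<close> every solution in the closure satisfies
  \<open>b ^ (p ^ n) + b = gf_trace p n c\<close>, so either all \<open>p\<close> solutions lie in
  the field or none does.\<close>

lemma AS_fibre:
  fixes c :: 'a
  assumes "c \<in> GF (p ^ n)" "n \<ge> 1"
  shows "card {b \<in> GF (p ^ n). b ^ p - b = c} = (if gf_trace p n c = 0 then p else 0)"
proof (cases "gf_trace p n c = 0")
  case True
  have "{b \<in> GF (p ^ n). b ^ p - b = c} = {b. b ^ p - b = c}"
  proof (intro equalityI subsetI)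
    fix b assume "b \<in> {b. b ^ p - b = c}"
    hence b: "b ^ p + b = c" by (simp add: minus_eq)
    hence "b ^ (p ^ n) = b" using trace_AS[of n b] True by (simp add: add_eq_0_iff2)
    thus "b \<in> {b \<in> GF (p ^ n). b ^ p - b = c}" using b by (simp add: GF_def minus_eq)
  qed simp
  moreover have "of_nat p = (0 :: 'a)" using k by (simp add: p_eq two)
  ultimately show ?thesis using True card_AS_fibre[OF p_ge_2, of c] by simp
next
  case False
  have empty: "{b \<in> GF (p ^ n). b ^ p - b = c} = {}"
  proof (intro equals0I)
    fix b assume "b \<in> {b \<in> GF (p ^ n). b ^ p - b = c}"
    hence "b ^ (p ^ n) = b" "b ^ p + b = c" by (auto simp: GF_def minus_eq)
    thus False using trace_AS[of n b] False by simp
  qed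
  show ?thesis unfolding empty using False by simp
qed

text \<open>The kernel of \<open>Tq\<close> is the image of \<open>x ^ p + x\<close> on
  \<open>Fq\<close>, whose kernel is \<open>Fp\<close>. Counting shows that \<open>Tq\<close> has
  \<open>p\<close> values, hence all of \<open>Fp\<close>, each taken equally often.\<close>

lemma card_trace_fibre:
  assumes "a \<in> Fp"
  shows "p * card {c \<in> Fq. Tq c = a} = q"
proof -
  have G: "finite Fq" "0 \<in> Fq" "\<And>a b. a \<in> Fq \<Longrightarrow> b \<in> Fq \<Longrightarrow> a - b \<in> Fq"
    using finite_Fq Fq.zero_mem Fq.diff_mem by blast+
  have "card Fq = card {x \<in> Fq. x ^ p + x = 0} * card ((\<lambda>x. x ^ p + x) ` Fq)"
    by (rule card_additive_image[OF G]) (simp_all add: minus_eq add_ac)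
  moreover have "{x \<in> Fq. x ^ p + x = 0} = Fp"
  proof -
    have "x \<in> Fq" if "x ^ p = x" for x
      using Fp_frob[of x r] that by (simp add: GF_def q_eq)
    thus ?thesis by (auto simp: add_eq_0_iff2 GF_def)
  qed
  moreover have img: "(\<lambda>x. x ^ p + x) ` Fq = {c \<in> Fq. Tq c = 0}"
  proof (intro equalityI subsetI)
    fix c assume "c \<in> (\<lambda>x. x ^ p + x) ` Fq"
    then obtain x where x: "x \<in> Fq" "c = x ^ p + x" by blast
    hence "c \<in> Fq" by (auto intro: Fq.add_mem Fq.power_mem)
    moreover have "Tq c = 0" using trace_AS[of r x] x by (simp add: GF_def q_eq)
    ultimately show "c \<in> {c \<in> Fq. Tq c = 0}" by simp
  next
    fix c assume c: "c \<in> {c \<in> Fq. Tq c = 0}"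
    hence "card {b \<in> GF (p ^ r). b ^ p - b = c} = p"
      using AS_fibre[of c r] r by (simp add: q_eq)
    hence "{b \<in> GF (p ^ r). b ^ p - b = c} \<noteq> {}" using p_ge_2 by (metis card.empty not_numeral_le_zero)
    thus "c \<in> (\<lambda>x. x ^ p + x) ` Fq" by (auto simp: q_eq minus_eq)
  qed
  ultimately have ker: "q = p * card {c \<in> Fq. Tq c = 0}" by (simp add: card_Fq card_Fp)
  have Tdiff: "Tq (a - b) = Tq a - Tq b" for a b by (simp add: minus_eq)
  have "card Fq = card {x \<in> Fq. Tq x = 0} * card (Tq ` Fq)"
    by (rule card_additive_image[OF G]) (simp_all add: Tdiff)
  moreover have "card {x \<in> Fq. Tq x = 0} \<noteq> 0"
    using ker q_ge_2 by (metis mult_0_right not_numeral_le_zero)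
  ultimately have "card (Tq ` Fq) = p"
    using ker unfolding card_Fq by (metis mult.commute mult_cancel1)
  moreover have "Tq ` Fq \<subseteq> Fp" using trace_in_Fp[of _ r] by (auto simp: q_eq)
  ultimately have "Tq ` Fq = Fp" using card_subset_eq[OF finite_Fp] card_Fp by metis
  hence "{w \<in> Tq ` Fq. w = a} = {a}" using assms by auto
  hence "card {c \<in> Fq. Tq c = a} = card {x \<in> Fq. Tq x = 0}"
    using card_additive_fibres[OF G, of Tq "\<lambda>w. w = a"] Tdiff by simp
  thus ?thesis using ker by simp
qed

text \<open>The absolute trace of \<open>t\<close> is 1, so \<open>\<omega>\<close> is conjugate to
  \<open>\<omega> + 1\<close> over \<open>Fq\<close>. Hence
  \<open>(\<omega> * w) ^ q + \<omega> * w = w\<close> for \<open>w\<close> in \<open>Fq\<close>, an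
  explicit section of the relative trace.\<close>

definition \<omega> :: 'a where "\<omega> = (SOME w. w\<^sup>2 + w = t)"

lemma \<omega>: "\<omega>\<^sup>2 + \<omega> = t"
proof -
  have "card {z :: 'a. z ^ 2 - z = t} = 2" by (rule card_AS_fibre) (simp_all add: two)
  hence "{z :: 'a. z ^ 2 - z = t} \<noteq> {}" by (metis card.empty zero_neq_numeral)
  hence "\<exists>w. w\<^sup>2 + w = t" by (auto simp: minus_eq)
  thus ?thesis unfolding \<omega>_def by (rule someI_ex)
qed

lemma \<omega>_q: "\<omega> ^ q = \<omega> + 1"
proof -
  have "gf_trace 2 n (z\<^sup>2 + z) = z ^ (2 ^ n) + z" for n and z :: 'a
  proof (induction n)
    case (Suc n)
    thus ?case by (simp add: gf_trace_def power_two_add power_mult[symmetric] add.assoc)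
  qed (simp add: gf_trace_def)
  from this[of "k * r" \<omega>] have "\<omega> ^ q + \<omega> = 1" by (simp add: \<omega> trace_t q_pow)
  thus ?thesis by (metis add.commute add_self_left)
qed

lemma \<omega>_in_Fqq: "\<omega> \<in> Fqq"
  by (simp add: GF_def power2_eq_square power_mult \<omega>_q add.assoc)

text \<open>Arises from the relative trace of \<open>\<omega> ^ (p + 1)\<close>, which is
  \<open>1 + \<tau>\<close>.\<close>

definition \<tau> :: 'a where "\<tau> = \<omega> ^ p + \<omega>"

lemma Tq_\<tau>: "Tq \<tau> = 1"
  unfolding \<tau>_def trace_AS using \<omega>_q by (simp add: q_eq add_ac)

end

text \<open>Keeps of \<open>f_U\<close> only its F_p-linearity, its compatibility with the
  \<open>q\<close>-Frobenius and the position of its kernel, so that the count of zeros is free of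
  polynomials.\<close>

locale twisted_form = char_two_tower p q k r t
  for p q k r :: nat and t :: "'a::alg_closed_field" +
  fixes u :: "'a \<Rightarrow> 'a" and s0 :: 'a
  assumes u_add [simp]: "u (a + b) = u a + u b"
    and u_scale: "c \<in> Fp \<Longrightarrow> u (c * a) = c * u a"
    and u_q: "u (a ^ q) = u a ^ q"
    and u_ker: "u a = 0 \<Longrightarrow> a \<in> Fq"
    and s0: "s0 \<in> Fq"
begin

definition P :: nat where "P = card {a. u a = 0}"

text \<open>For \<open>u = f\<^sub>U\<close> the traces of \<open>x R(x)\<close> and of \<open>x R\<^sub>t(x)\<close> are \<open>form 0 (u x)\<close> and \<open>form t (u x)\<close>.\<close>

definition form :: "'a \<Rightarrow> 'a \<Rightarrow> 'a" where
  "form l a = T (a ^ (p + 1) + s0 * a\<^sup>2) + (T (l * (a ^ p + a)))\<^sup>2"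

text \<open>This is \<open>form l\<close> at \<open>\<omega> * w\<close> for \<open>w\<close> in
  \<open>Fq\<close>, with the relative trace already taken: by
  \<open>\<omega> ^ q = \<omega> + 1\<close> the term \<open>w ^ (p + 1)\<close> gets the factor
  \<open>1 + \<tau>\<close> and \<open>w^2\<close> the factor 1.\<close>

definition reduced_form :: "'a \<Rightarrow> 'a \<Rightarrow> 'a" where
  "reduced_form l w = Tq ((1 + \<tau>) * w ^ (p + 1) + s0 * w\<^sup>2) + (Tq (l * (w ^ p + w)))\<^sup>2"

text \<open>The values of \<open>u (x ^ q + x)\<close> at those \<open>x\<close> where the form does
  not change under translation by \<open>M\<close>.\<close>

definition Y :: "'a set" where "Y = {w \<in> u ` Fq. w ^ (p\<^sup>2) = w}"

definition zeros :: "'a \<Rightarrow> 'a set" where "zeros l = {w \<in> Y. reduced_form l w = 0}"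

lemma power_q_commute: "(z ^ n) ^ q = ((z :: 'a) ^ q) ^ n"
  by (simp add: power_mult[symmetric] mult.commute)

lemma square_add: "((a :: 'a) + b)\<^sup>2 = a\<^sup>2 + b\<^sup>2"
  using power_two_add[of a b 1] by simp

lemma power_p_plus_1: "(z :: 'a) ^ (p + 1) = z * z ^ p" "(z :: 'a) ^ (1 + p) = z * z ^ p"
  by simp_all

lemmas char2_simps = distrib_left distrib_right mult_ac add_ac mult_1_left mult_1_right
  add_self add_self_left add_0_left add_0_right frob_add_p frob_add_q square_add
  power_p_plus_1

lemma u_0 [simp]: "u 0 = 0"
  using u_add[of 0 0] by simp

lemma u_diff: "u (a - b) = u a - u b"
  by (simp add: minus_eq)

lemma u_Fq: "a \<in> Fq \<Longrightarrow> u a \<in> Fq"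
  using u_q[of a] by (simp add: GF_def)

lemma u_Fqq: "a \<in> Fqq \<Longrightarrow> u a \<in> Fqq"
  using u_q[of a] u_q[of "a ^ q"] by (simp add: GF_def power2_eq_square power_mult)

text \<open>Terms in \<open>c\<close> alone lie in \<open>Fq\<close> and vanish under
  \<open>T\<close>. The mixed term \<open>a ^ p * c + a * c ^ p\<close> has relative trace
  \<open>w ^ p * c + w * c ^ p\<close>; a Frobenius applied to the first summand under
  \<open>Tq\<close> collects the factor \<open>c ^ p\<close>.\<close>

lemma form_add_Fq:
  assumes c: "c \<in> Fq" and l: "l \<in> Fq" and a: "a \<in> Fqq"
  defines "w \<equiv> a ^ q + a"
  shows "form l (a + c) = form l a + Tq (c ^ p * (w + w ^ (p\<^sup>2)))"
proof -
  have cq: "c ^ q = c" and lq: "l ^ q = l" using c l by (simp_all add: GF_def)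
  have eq: "(a + c) ^ (p + 1) + s0 * (a + c)\<^sup>2
    = (a ^ (p + 1) + s0 * a\<^sup>2) + (c ^ (p + 1) + s0 * c\<^sup>2) + (a ^ p * c + a * c ^ p)"
    by (simp only: char2_simps)
  have "c ^ (p + 1) + s0 * c\<^sup>2 \<in> Fq" by (intro Fq.mems c s0)
  hence T1: "T (c ^ (p + 1) + s0 * c\<^sup>2) = 0" by (rule T_Fq)
  have wq: "w \<in> Fq"
    using a by (simp add: w_def GF_def power2_eq_square power_mult add.commute)
  have "T (a ^ p * c + a * c ^ p) = Tq (w ^ p * c + w * c ^ p)"
  proof -
    have "(a ^ p * c + a * c ^ p) + (a ^ p * c + a * c ^ p) ^ q = w ^ p * c + w * c ^ p"
      by (simp only: w_def power_mult_distrib power_q_commute[where n = p] cq char2_simps)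
    thus ?thesis by (simp only: T_eq)
  qed
  also have "\<dots> = Tq (w ^ p * c) + Tq (w * c ^ p)" by simp
  also have "Tq (w ^ p * c) = Tq ((w ^ p * c) ^ p)"
    using trace_frob_p[of "w ^ p * c" r] wq c Fq.mult_mem Fq.power_mem by (simp add: q_eq)
  also have "(w ^ p * c) ^ p = c ^ p * w ^ (p\<^sup>2)"
    by (simp only: power_mult_distrib power_mult[symmetric] power2_eq_square mult.commute)
  finally have T2: "T (a ^ p * c + a * c ^ p) = Tq (c ^ p * (w + w ^ (p\<^sup>2)))"
    by (simp only: char2_simps trace_add)
  have "l * (c ^ p + c) \<in> Fq" by (intro Fq.mems c l)
  hence "T (l * (c ^ p + c)) = 0" by (rule T_Fq)
  moreover have "l * ((a + c) ^ p + (a + c)) = l * (a ^ p + a) + l * (c ^ p + c)"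
    by (simp only: char2_simps)
  ultimately have T3: "T (l * ((a + c) ^ p + (a + c))) = T (l * (a ^ p + a))" by simp
  have "T ((a + c) ^ (p + 1) + s0 * (a + c)\<^sup>2)
    = T (a ^ (p + 1) + s0 * a\<^sup>2) + T (c ^ (p + 1) + s0 * c\<^sup>2) + T (a ^ p * c + a * c ^ p)"
    unfolding eq by (simp only: trace_add)
  thus ?thesis unfolding form_def T1 T2 T3 by (simp add: add_ac)
qed

text \<open>The elements \<open>a\<close> and \<open>\<omega> * w\<close> have the same relative
  trace \<open>w\<close>, so they differ by some \<open>c\<close> in \<open>Fq\<close>. As
  \<open>w\<close> is fixed by the square of the \<open>p\<close>-Frobenius,
  \<open>form_add_Fq\<close> shows that \<open>c\<close> does not affect the value.\<close>

lemma form_reduced: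
  assumes a: "a \<in> Fqq" and l: "l \<in> Fq"
  defines "w \<equiv> a ^ q + a"
  assumes w: "w ^ (p\<^sup>2) = w"
  shows "form l a = reduced_form l w"
proof -
  have lq: "l ^ q = l" and s0q: "s0 ^ q = s0" using l s0 by (simp_all add: GF_def)
  have aq: "(a ^ q) ^ q = a" using a by (simp add: GF_def power2_eq_square power_mult)
  have wq: "w ^ q = w" by (simp add: w_def aq add.commute)
  define c where "c = a + \<omega> * w"
  have "c ^ q = a ^ q + (\<omega> + 1) * w" by (simp add: c_def power_mult_distrib \<omega>_q wq)
  also have "\<dots> = c" by (simp only: c_def w_def char2_simps)
  finally have c: "c \<in> Fq" by (simp add: GF_def)
  have wL: "\<omega> * w \<in> Fqq"
    using wq by (intro Fqq.mult_mem \<omega>_in_Fqq) (simp add: GF_def power2_eq_square power_mult)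
  have "(\<omega> * w) ^ q + \<omega> * w = w" by (simp only: power_mult_distrib \<omega>_q wq char2_simps)
  hence "form l (\<omega> * w + c) = form l (\<omega> * w)"
    using form_add_Fq[OF c l wL] w by simp
  moreover have "\<omega> * w + c = a" by (simp add: c_def add.left_commute)
  ultimately have "form l a = form l (\<omega> * w)" by simp
  also have "\<dots> = reduced_form l w"
  proof -
    have "((\<omega> * w) ^ (p + 1) + s0 * (\<omega> * w)\<^sup>2) + ((\<omega> * w) ^ (p + 1) + s0 * (\<omega> * w)\<^sup>2) ^ q
      = ((\<omega> * w) ^ (p + 1) + s0 * (\<omega> * w)\<^sup>2) + (((\<omega> * w) ^ q) ^ (p + 1) + s0 * ((\<omega> * w) ^ q)\<^sup>2)"
      by (simp only: frob_add_q power_mult_distrib[of _ _ q] s0q power_q_commute[where n = "p + 1"]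
          power_q_commute[where n = 2])
    also have "(\<omega> * w) ^ q = \<omega> * w + w"
      by (simp only: power_mult_distrib \<omega>_q wq char2_simps)
    also have "(\<omega> * w) ^ (p + 1) + s0 * (\<omega> * w)\<^sup>2 + ((\<omega> * w + w) ^ (p + 1) + s0 * (\<omega> * w + w)\<^sup>2)
      = (1 + \<tau>) * w ^ (p + 1) + s0 * w\<^sup>2"
      by (simp only: \<tau>_def power_mult_distrib char2_simps)
    finally have 1: "T ((\<omega> * w) ^ (p + 1) + s0 * (\<omega> * w)\<^sup>2) = Tq ((1 + \<tau>) * w ^ (p + 1) + s0 * w\<^sup>2)"
      by (simp only: T_eq)
    have "l * ((\<omega> * w) ^ p + \<omega> * w) + (l * ((\<omega> * w) ^ p + \<omega> * w)) ^ q
      = l * ((\<omega> * w) ^ p + \<omega> * w) + l * (((\<omega> * w) ^ q) ^ p + (\<omega> * w) ^ q)"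
      by (simp only: frob_add_q power_mult_distrib[of _ _ q] lq power_q_commute[where n = p])
    also have "(\<omega> * w) ^ q = \<omega> * w + w"
      by (simp only: power_mult_distrib \<omega>_q wq char2_simps)
    also have "l * ((\<omega> * w) ^ p + \<omega> * w) + l * ((\<omega> * w + w) ^ p + (\<omega> * w + w)) = l * (w ^ p + w)"
      by (simp only: char2_simps)
    finally have 2: "T (l * ((\<omega> * w) ^ p + \<omega> * w)) = Tq (l * (w ^ p + w))"
      by (simp only: T_eq)
    show ?thesis unfolding form_def reduced_form_def 1 2 ..
  qed
  finally show ?thesis .
qed

lemma ker_eq: "{a \<in> Fq. u a = 0} = {a. u a = 0}"
  using u_ker by auto

lemma Fq_group: "finite Fq" "0 \<in> Fq" "\<And>a b. a \<in> Fq \<Longrightarrow> b \<in> Fq \<Longrightarrow> a - b \<in> Fq"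
  using finite_Fq Fq.zero_mem Fq.diff_mem by blast+

lemma Fqq_group: "finite Fqq" "0 \<in> Fqq" "\<And>a b. a \<in> Fqq \<Longrightarrow> b \<in> Fqq \<Longrightarrow> a - b \<in> Fqq"
  using finite_Fqq Fqq.zero_mem Fqq.diff_mem by blast+

lemma rel_trace_image: "(\<lambda>x. x ^ q + x) ` Fqq = Fq"
proof (intro equalityI subsetI)
  fix w assume "w \<in> (\<lambda>x. x ^ q + x) ` Fqq"
  thus "w \<in> Fq" by (auto simp: GF_def power2_eq_square power_mult add.commute)
next
  fix w assume w: "w \<in> Fq"
  hence wq: "w ^ q = w" by (simp add: GF_def)
  have "(\<omega> * w) ^ q + \<omega> * w = w" by (simp only: power_mult_distrib \<omega>_q wq char2_simps)
  moreover have "\<omega> * w \<in> Fqq" using w Fq_sub_Fqq by (intro Fqq.mult_mem \<omega>_in_Fqq) blast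
  ultimately show "w \<in> (\<lambda>x. x ^ q + x) ` Fqq" by (intro rev_image_eqI[of "\<omega> * w"]) simp_all
qed

lemma card_rel_trace: "card {x \<in> Fqq. R (x ^ q + x)} = q * card {w \<in> Fq. R w}"
proof -
  have "card {x \<in> Fqq. R (x ^ q + x)} = card {x \<in> Fqq. x ^ q + x = 0} * card {w \<in> (\<lambda>x. x ^ q + x) ` Fqq. R w}"
    by (rule card_additive_fibres[OF Fqq_group]) (simp_all add: minus_eq add_ac)
  also have "{x \<in> Fqq. x ^ q + x = 0} = Fq"
    using Fq_sub_Fqq by (auto simp: GF_def add_eq_0_iff2)
  finally show ?thesis by (simp add: rel_trace_image card_Fq)
qed

lemma card_u_fibres: "card {w \<in> Fq. R (u w)} = P * card {w \<in> u ` Fq. R w}"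
  using card_additive_fibres[OF Fq_group, of u R] by (simp add: u_diff ker_eq P_def)

lemma card_u_rel_trace: "card {x \<in> Fqq. R (u (x ^ q + x))} = q * P * card {w \<in> u ` Fq. R w}"
  using card_rel_trace[of "\<lambda>w. R (u w)"] card_u_fibres by simp

text \<open>Since \<open>u\<close> commutes with the \<open>q\<close>-Frobenius, the condition says
  that \<open>u x\<close> lies in \<open>Fq\<close>: this is the totally singular space.\<close>

definition M :: "'a set" where "M = {x \<in> Fqq. u (x ^ q + x) = 0}"

lemma card_M: "card M = q * P"
proof -
  have "0 \<in> u ` Fq" using Fq.zero_mem by (intro rev_image_eqI[of 0]) simp_all
  hence "{w \<in> u ` Fq. w = 0} = {0}" by blast
  thus ?thesis using card_u_rel_trace[of "\<lambda>w. w = 0"] by (simp add: M_def)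
qed

lemma P_pos: "P > 0"
proof -
  have "{a. u a = 0} \<subseteq> Fq" using u_ker by blast
  hence "finite {a. u a = 0}" using finite_Fq by (rule finite_subset)
  moreover have "0 \<in> {a. u a = 0}" by simp
  ultimately show ?thesis unfolding P_def card_gt_0_iff by blast
qed

lemma M_group: "finite M" "0 \<in> M" "\<And>a b. a \<in> M \<Longrightarrow> b \<in> M \<Longrightarrow> a - b \<in> M"
proof -
  show "finite M" unfolding M_def using finite_Fqq by simp
  show "0 \<in> M" by (simp add: M_def Fqq.zero_mem)
  fix a b assume ab: "a \<in> M" "b \<in> M"
  have "(a - b) ^ q + (a - b) = (a ^ q + a) + (b ^ q + b)" by (simp add: minus_eq add_ac)
  hence "u ((a - b) ^ q + (a - b)) = 0" using ab by (simp only: u_add M_def mem_Collect_eq add_0)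
  moreover have "a - b \<in> Fqq" using ab by (intro Fqq.diff_mem) (simp_all add: M_def)
  ultimately show "a - b \<in> M" by (simp add: M_def)
qed

lemma card_M_fibres: "card {x \<in> M. R (u x)} = P * card {c \<in> Fq. R c}"
proof -
  have ker: "{x \<in> M. u x = 0} = {a. u a = 0}"
  proof -
    have "a \<in> M" if "u a = 0" for a
      using u_ker[OF that] Fq_sub_Fqq by (auto simp: M_def GF_def)
    thus ?thesis by auto
  qed
  have "card M = P * card (u ` M)"
    using card_additive_image[OF M_group, of u] by (simp add: u_diff ker P_def)
  hence "card (u ` M) = q" using card_M P_pos by simp
  moreover have "u ` M \<subseteq> Fq"
    using u_q by (auto simp: M_def GF_def add_eq_0_iff2)
  ultimately have "u ` M = Fq" using card_subset_eq[OF finite_Fq] card_Fq by metis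
  thus ?thesis using card_additive_fibres[OF M_group, of u R] by (simp add: u_diff ker P_def)
qed

text \<open>The map \<open>c \<mapsto> c ^ p * d\<close> permutes \<open>Fq\<close>, so this is a
  fibre of the trace.\<close>

lemma card_Tq_fibre:
  assumes d: "d \<in> Fq" "d \<noteq> 0" and a: "a \<in> Fp"
  shows "p * card {c \<in> Fq. Tq (c ^ p * d) = a} = q"
proof -
  have inj: "inj_on (\<lambda>c. c ^ p * d) Fq"
    using d frob_inj[of _ 1] by (auto simp: inj_on_def)
  have "(\<lambda>c. c ^ p * d) ` Fq \<subseteq> Fq" using d by (auto intro!: Fq.mult_mem Fq.power_mem)
  hence surj: "(\<lambda>c. c ^ p * d) ` Fq = Fq"
    using card_image[OF inj] card_subset_eq[OF finite_Fq] by metis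
  have "bij_betw (\<lambda>c. c ^ p * d) {c \<in> Fq. Tq (c ^ p * d) = a} {c \<in> Fq. Tq c = a}"
    unfolding bij_betw_def
  proof
    show "inj_on (\<lambda>c. c ^ p * d) {c \<in> Fq. Tq (c ^ p * d) = a}"
      using inj by (rule inj_on_subset) auto
    have "(\<lambda>c. c ^ p * d) ` {c \<in> Fq. Tq (c ^ p * d) = a} = {c \<in> (\<lambda>c. c ^ p * d) ` Fq. Tq c = a}"
      by blast
    thus "(\<lambda>c. c ^ p * d) ` {c \<in> Fq. Tq (c ^ p * d) = a} = {c \<in> Fq. Tq c = a}"
      unfolding surj .
  qed
  from bij_betw_same_card[OF this] show ?thesis using card_trace_fibre[OF a] by (simp only:)
qed

lemma form_in_Fp:
  assumes "a \<in> Fqq" "l \<in> Fq"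
  shows "form l a \<in> Fp"
proof -
  have s0': "s0 \<in> Fqq" "l \<in> Fqq" using s0 assms Fq_sub_Fqq by auto
  have T: "T z \<in> Fp" if "z \<in> Fqq" for z using trace_in_Fp[of z "2 * r"] that by (simp add: q2_eq)
  have "a ^ (p + 1) + s0 * a\<^sup>2 \<in> Fqq" "l * (a ^ p + a) \<in> Fqq"
    by (intro Fqq.add_mem Fqq.mult_mem Fqq.power_mem s0' assms)+
  thus ?thesis unfolding form_def by (intro Fp.add_mem Fp.power_mem T)
qed

text \<open>The zeros of the form are counted by averaging over translations by \<open>M\<close>: along \<open>M\<close> the form
  is affine linear, and it is constant exactly where \<open>w = u (x\<^sup>q + x)\<close> is fixed by the square
  of the Frobenius map.\<close>

theorem card_form_zeros:
  assumes l: "l \<in> Fq"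
  shows "p * card {x \<in> Fqq. form l (u x) = 0} + q * P * card Y = q\<^sup>2 + p * (q * P * card (zeros l))"
proof -
  \<comment> \<open>By \<open>form_add_Fq\<close> this is the coefficient of the linear function
    that a translation by \<open>M\<close> adds to the form.\<close>
  define \<delta> where "\<delta> = (\<lambda>x. u (x ^ q + x) + u (x ^ q + x) ^ (p\<^sup>2))"
  define Z where "Z = {x \<in> Fqq. form l (u x) = 0}"
  define A where "A = {x \<in> Fqq. \<delta> x = 0}"
  have \<delta>_Fq: "\<delta> x \<in> Fq" if "x \<in> Fqq" for x
  proof -
    have "x ^ q + x \<in> (\<lambda>x. x ^ q + x) ` Fqq" using that by (rule imageI)
    hence "u (x ^ q + x) \<in> Fq" unfolding rel_trace_image by (rule u_Fq)
    thus ?thesis unfolding \<delta>_def by (intro Fq.add_mem Fq.power_mem)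
  qed
  have shift: "form l (u (x + m)) = form l (u x) + Tq (u m ^ p * \<delta> x)" if x: "x \<in> Fqq" and m: "m \<in> M" for x m
  proof -
    have "u m \<in> Fq" using m u_q by (simp add: M_def GF_def add_eq_0_iff2)
    from form_add_Fq[OF this l u_Fqq[OF x]] show ?thesis by (simp add: \<delta>_def u_q)
  qed
  have bij: "card {x \<in> Fqq. form l (u (x + m)) = 0} = card Z" if m: "m \<in> M" for m
  proof (rule bij_betw_same_card)
    have mF: "m \<in> Fqq" using m by (simp add: M_def)
    show "bij_betw (\<lambda>x. x + m) {x \<in> Fqq. form l (u (x + m)) = 0} Z"
      by (rule bij_betw_byWitness[of _ "\<lambda>x. x + m"])
         (use mF in \<open>auto simp: Z_def add.assoc intro: Fqq.add_mem simp del: u_add\<close>)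
  qed
  have inner: "p * card {m \<in> M. form l (u (x + m)) = 0}
      = (if \<delta> x = 0 then (if form l (u x) = 0 then p * (q * P) else 0) else q * P)" if x: "x \<in> Fqq" for x
  proof -
    have "{m \<in> M. form l (u (x + m)) = 0} = {m \<in> M. Tq (u m ^ p * \<delta> x) = form l (u x)}"
      using shift[OF x] by (auto simp: add_eq_0_iff2)
    hence c: "card {m \<in> M. form l (u (x + m)) = 0} = P * card {c \<in> Fq. Tq (c ^ p * \<delta> x) = form l (u x)}"
      using card_M_fibres[of "\<lambda>c. Tq (c ^ p * \<delta> x) = form l (u x)"] by simp
    show ?thesis
    proof (cases "\<delta> x = 0")
      case True thus ?thesis unfolding c by (auto simp: card_Fq)
    next
      case False
      have "p * card {c \<in> Fq. Tq (c ^ p * \<delta> x) = form l (u x)} = q"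
        by (intro card_Tq_fibre \<delta>_Fq x False form_in_Fp u_Fqq l)
      thus ?thesis unfolding c using False by (simp add: mult.left_commute)
    qed
  qed
  \<comment> \<open>Double count the pairs \<open>x\<close>, \<open>m\<close> with
    \<open>form l (u (x + m)) = 0\<close>. Each \<open>m\<close> contributes \<open>card Z\<close>;
    each \<open>x\<close> contributes all of \<open>M\<close>, nothing, or exactly one
    \<open>p\<close>-th of \<open>M\<close>, according to \<open>inner\<close>.\<close>
  have "q * P * (p * card Z) = p * (\<Sum>m\<in>M. card {x \<in> Fqq. form l (u (x + m)) = 0})"
    using bij by (simp add: card_M)
  also have "(\<Sum>m\<in>M. card {x \<in> Fqq. form l (u (x + m)) = 0})
      = (\<Sum>m\<in>M. \<Sum>x\<in>Fqq. if form l (u (x + m)) = 0 then 1 else 0)"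
    using finite_Fqq by (intro sum.cong refl) (simp add: sum.If_cases Int_def)
  also have "\<dots> = (\<Sum>x\<in>Fqq. \<Sum>m\<in>M. if form l (u (x + m)) = 0 then 1 else 0)"
    by (rule sum.swap)
  also have "\<dots> = (\<Sum>x\<in>Fqq. card {m \<in> M. form l (u (x + m)) = 0})"
    using M_group(1) by (intro sum.cong refl) (simp add: sum.If_cases Int_def)
  also have "p * \<dots> = (\<Sum>x\<in>Fqq. if \<delta> x = 0 then (if form l (u x) = 0 then p * (q * P) else 0) else q * P)"
    unfolding sum_distrib_left using inner by (intro sum.cong refl) auto
  also have "\<dots> = (\<Sum>x\<in>Fqq. q * P * (p * (if \<delta> x = 0 \<and> form l (u x) = 0 then 1 else 0) + (if \<delta> x = 0 then 0 else 1)))"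
    by (intro sum.cong refl) auto
  also have "\<dots> = q * P * (\<Sum>x\<in>Fqq. p * (if \<delta> x = 0 \<and> form l (u x) = 0 then 1 else 0) + (if \<delta> x = 0 then 0 else 1))"
    by (rule sum_distrib_left[symmetric])
  finally have "p * card Z = (\<Sum>x\<in>Fqq. p * (if \<delta> x = 0 \<and> form l (u x) = 0 then 1 else 0) + (if \<delta> x = 0 then 0 else 1))"
    using P_pos q_ge_2 by simp
  also have "\<dots> = p * card {x \<in> Fqq. \<delta> x = 0 \<and> form l (u x) = 0} + card (Fqq - A)"
  proof -
    have "Fqq - A = {x \<in> Fqq. \<delta> x \<noteq> 0}" by (auto simp: A_def)
    thus ?thesis using finite_Fqq
      by (simp add: sum.distrib sum_distrib_left[symmetric] sum.If_cases Int_def Collect_neg_eq[symmetric])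
  qed
  also have "card (Fqq - A) = q\<^sup>2 - card A"
    using finite_Fqq by (subst card_Diff_subset) (auto simp: A_def card_Fqq)
  finally have main: "p * card Z = p * card {x \<in> Fqq. \<delta> x = 0 \<and> form l (u x) = 0} + (q\<^sup>2 - card A)" .
  have "A \<subseteq> Fqq" by (auto simp: A_def)
  hence "card A \<le> q\<^sup>2" using card_mono[OF finite_Fqq] by (simp add: card_Fqq)
  moreover have "card A = q * P * card Y"
  proof -
    have "A = {x \<in> Fqq. u (x ^ q + x) ^ (p\<^sup>2) = u (x ^ q + x)}"
      unfolding A_def \<delta>_def add_eq_0_iff2 by (rule Collect_cong) metis
    thus ?thesis using card_u_rel_trace[of "\<lambda>w. w ^ (p\<^sup>2) = w"] by (simp only: Y_def)
  qed
  moreover have "{x \<in> Fqq. \<delta> x = 0 \<and> form l (u x) = 0}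
    = {x \<in> Fqq. u (x ^ q + x) ^ (p\<^sup>2) = u (x ^ q + x) \<and> reduced_form l (u (x ^ q + x)) = 0}"
  proof -
    have "form l (u x) = reduced_form l (u (x ^ q + x))"
      if "x \<in> Fqq" "u (x ^ q + x) ^ (p\<^sup>2) = u (x ^ q + x)" for x
      using form_reduced[OF u_Fqq[OF that(1)] l] that(2) by (simp add: u_q)
    thus ?thesis unfolding \<delta>_def add_eq_0_iff2 by (intro Collect_cong) metis
  qed
  hence "card {x \<in> Fqq. \<delta> x = 0 \<and> form l (u x) = 0} = q * P * card (zeros l)"
    using card_u_rel_trace[of "\<lambda>w. w ^ (p\<^sup>2) = w \<and> reduced_form l w = 0"]
    by (simp only: zeros_def Y_def mem_Collect_eq conj_assoc)
  ultimately show ?thesis using main unfolding Z_def by simp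
qed

end

section \<open>The reduced form on the field with p^2 elements\<close>

context twisted_form
begin

abbreviation "Fp2 \<equiv> GF (p\<^sup>2) :: 'a set"

sublocale Fp2: subfield_set Fp2 using subfield_GF[of 2] by simp

lemma card_Fp2: "card Fp2 = p\<^sup>2" using card_GF[of 2] by simp
lemma finite_Fp2: "finite Fp2" using finite_GF[of 2] by simp

lemma Y_sub: "Y \<subseteq> Fp2" "Y \<subseteq> Fq"
  using u_Fq by (auto simp: Y_def GF_def)

lemma finite_Y: "finite Y"
  using finite_subset[OF Y_sub(1) finite_Fp2] .

lemma Y_add: "v \<in> Y \<Longrightarrow> w \<in> Y \<Longrightarrow> v + w \<in> Y"
proof -
  assume "v \<in> Y" "w \<in> Y"
  then obtain a b where ab: "a \<in> Fq" "b \<in> Fq" "v = u a" "w = u b" "v ^ (p\<^sup>2) = v" "w ^ (p\<^sup>2) = w"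
    by (auto simp: Y_def)
  have "v + w = u (a + b)" using ab by simp
  moreover have "a + b \<in> Fq" using ab(1,2) by (rule Fq.add_mem)
  ultimately have "v + w \<in> u ` Fq" by (rule image_eqI)
  moreover have "(v + w) ^ (p\<^sup>2) = v + w" using ab(5,6) by simp
  ultimately show ?thesis by (simp add: Y_def)
qed

lemma Fp_sub: "Fp \<subseteq> Fq" "Fp \<subseteq> Fp2"
  using Fp_frob[of _ r] Fp_frob[of _ 2] by (auto simp: GF_def q_eq)

lemma Y_scale: "c \<in> Fp \<Longrightarrow> w \<in> Y \<Longrightarrow> c * w \<in> Y"
proof -
  assume c: "c \<in> Fp" and "w \<in> Y"
  then obtain a where a: "a \<in> Fq" "w = u a" "w ^ (p\<^sup>2) = w"
    by (auto simp: Y_def)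
  have "c * w = u (c * a)" using a c u_scale by simp
  moreover have "c * a \<in> Fq" using a(1) c Fp_sub(1) by (intro Fq.mult_mem) auto
  moreover have "(c * w) ^ (p\<^sup>2) = c * w"
    using a(3) Fp_frob[OF c, of 2] by (simp add: power_mult_distrib)
  ultimately show ?thesis by (simp add: Y_def)
qed

lemma zero_in_Y: "0 \<in> Y"
proof -
  have "0 \<in> u ` Fq" using Fq.zero_mem by (intro rev_image_eqI[of 0]) simp_all
  moreover have "(0 :: 'a) ^ (p\<^sup>2) = 0" by simp
  ultimately show ?thesis unfolding Y_def by blast
qed

text \<open>\<open>Y\<close> is an F_p-subspace of a plane; with more than \<open>p\<close> elements
  it contains two independent vectors.\<close>

lemma card_Y:
  assumes "card Y > p"
  shows "Y = Fp2"
proof -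
  have "\<exists>w\<in>Y. w \<notin> {0}"
  proof (rule ccontr)
    assume "\<not> ?thesis"
    hence "card Y \<le> card {0 :: 'a}" by (intro card_mono) auto
    thus False using assms p_ge_2 by simp
  qed
  then obtain w1 where w1: "w1 \<in> Y" "w1 \<noteq> 0" by auto
  have "\<exists>w\<in>Y. w \<notin> (\<lambda>c. c * w1) ` Fp"
  proof (rule ccontr)
    assume "\<not> ?thesis"
    hence "card Y \<le> card ((\<lambda>c. c * w1) ` Fp)" using finite_Fp by (intro card_mono) auto
    also have "\<dots> \<le> p" using card_image_le[OF finite_Fp] card_Fp by metis
    finally show False using assms by simp
  qed
  then obtain w2 where w2: "w2 \<in> Y" "w2 \<notin> (\<lambda>c. c * w1) ` Fp" by blast
  have inj: "inj_on (\<lambda>(a, b). a * w1 + b * w2) (Fp \<times> Fp)"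
  proof (rule inj_onI, clarify)
    fix a b c d assume abcd: "a \<in> Fp" "b \<in> Fp" "c \<in> Fp" "d \<in> Fp"
      and eq: "a * w1 + b * w2 = c * w1 + d * w2"
    have "(a - c) * w1 - (d - b) * w2 = (a * w1 + b * w2) - (c * w1 + d * w2)"
      by (simp only: minus_eq distrib_right add_ac)
    also have "\<dots> = 0" using eq by simp
    finally have eq': "(a - c) * w1 = (d - b) * w2" by (simp only: right_minus_eq)
    have "b = d"
    proof (rule ccontr)
      assume "b \<noteq> d"
      hence "w2 = ((a - c) / (d - b)) * w1" using eq' by (simp add: nonzero_eq_divide_eq mult.commute)
      moreover have "(a - c) / (d - b) \<in> Fp" by (intro Fp.divide_mem Fp.diff_mem abcd)
      ultimately show False using w2(2) by blast
    qed
    thus "a = c \<and> b = d" using eq w1(2) by simp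
  qed
  have "(\<lambda>(a, b). a * w1 + b * w2) ` (Fp \<times> Fp) \<subseteq> Y"
    using w1(1) w2(1) by (auto intro: Y_add Y_scale)
  from card_mono[OF finite_Y this] have "p\<^sup>2 \<le> card Y"
    unfolding card_image[OF inj] by (simp add: card_cartesian_product card_Fp power2_eq_square)
  thus ?thesis using card_seteq[OF finite_Fp2 Y_sub(1)] card_Fp2 by simp
qed

lemma reduced_form_scale:
  assumes "c \<in> Fp"
  shows "reduced_form l (c * w) = c\<^sup>2 * reduced_form l w"
proof -
  have cp: "c ^ p = c" using assms by (simp add: GF_def)
  have e1: "(1 + \<tau>) * (c * w) ^ (p + 1) + s0 * (c * w)\<^sup>2 = c\<^sup>2 * ((1 + \<tau>) * w ^ (p + 1) + s0 * w\<^sup>2)"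
    by (simp only: power_mult_distrib power_p_plus_1 cp power2_eq_square distrib_left mult_ac)
  have e2: "l * ((c * w) ^ p + c * w) = c * (l * (w ^ p + w))"
    by (simp only: power_mult_distrib cp distrib_left mult_ac)
  have "c\<^sup>2 \<in> Fp" using assms by (rule Fp.power_mem)
  thus ?thesis
    unfolding reduced_form_def e1 e2 trace_scale[OF assms] trace_scale[OF \<open>c\<^sup>2 \<in> Fp\<close>]
    by (simp only: power_mult_distrib distrib_left)
qed

lemma zero_in_zeros: "0 \<in> zeros l"
  using zero_in_Y reduced_form_scale[OF Fp.zero_mem, of l 0] by (simp add: zeros_def)

text \<open>The zeros are stable under scaling by \<open>Fp\<close>, so one nonzero zero would bring
  a whole line.\<close>

lemma zeros_trivial:
  assumes "card (zeros l) < p"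
  shows "zeros l = {0}"
proof (rule ccontr)
  assume "zeros l \<noteq> {0}"
  then obtain w where w: "w \<in> zeros l" "w \<noteq> 0" using zero_in_zeros by blast
  have "(\<lambda>c. c * w) ` Fp \<subseteq> zeros l"
    using w(1) by (auto simp: zeros_def reduced_form_scale intro: Y_scale)
  moreover have "finite (zeros l)" using finite_Y by (simp add: zeros_def)
  ultimately have "card ((\<lambda>c. c * w) ` Fp) \<le> card (zeros l)" by (intro card_mono)
  moreover have "inj_on (\<lambda>c. c * w) Fp" using w(2) by (auto intro: inj_onI)
  ultimately show False using assms by (simp add: card_image card_Fp)
qed

lemma norm_in_Fp: "w \<in> Fp2 \<Longrightarrow> w ^ (p + 1) \<in> Fp" and trace_in_Fp': "w \<in> Fp2 \<Longrightarrow> w ^ p + w \<in> Fp"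
proof -
  assume w: "w \<in> Fp2"
  hence wpp: "(w ^ p) ^ p = w" by (simp add: GF_def power2_eq_square power_mult)
  have "(w ^ (p + 1)) ^ p = w ^ (p + 1)"
    by (simp only: power_p_plus_1 power_mult_distrib wpp mult.commute)
  thus "w ^ (p + 1) \<in> Fp" by (simp only: GF_def mem_Collect_eq)
  have "(w ^ p + w) ^ p = w ^ p + w" by (simp only: frob_add_p wpp add.commute)
  thus "w ^ p + w \<in> Fp" by (simp only: GF_def mem_Collect_eq)
qed

text \<open>For even \<open>r\<close>, the only case in which it is used, this is the trace of
  \<open>s0\<close> from \<open>Fq\<close> to the field with \<open>p^2\<close> elements.\<close>

definition \<sigma> :: 'a where "\<sigma> = gf_trace (p\<^sup>2) (r div 2) s0"

text \<open>\<open>Y = Fp2\<close> makes \<open>r\<close> even, so \<open>Tq 1 = 0\<close> and the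
  hypothesis becomes \<open>Tq s0 = 0\<close>, which says that \<open>\<sigma>\<close> lies in
  \<open>Fp\<close>. The norm and the trace of \<open>w\<close> lie in \<open>Fp\<close> and come
  out of \<open>Tq\<close>, leaving the factors \<open>Tq (1 + \<tau>) = 1\<close> and
  \<open>Tq l\<close>.\<close>

lemma reduced_form_eq:
  assumes Y: "Y = Fp2" and s0_trace: "Tq (1 + s0) = 0"
  shows "\<sigma> \<in> Fp"
    and "w \<in> Fp2 \<Longrightarrow> l \<in> Fq \<Longrightarrow> reduced_form l w = w ^ (p + 1) + (\<sigma> + (Tq l)\<^sup>2) * (w ^ p + w)\<^sup>2"
proof -
  have "\<not> Fp2 \<subseteq> Fp"
  proof
    assume "Fp2 \<subseteq> Fp"
    hence "p\<^sup>2 \<le> p" using card_mono[OF finite_Fp] card_Fp2 card_Fp by metis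
    thus False using p_ge_2 by (simp add: power2_eq_square)
  qed
  then obtain v where v: "v \<in> Fp2" "v \<notin> Fp" by blast
  have vpp: "(v ^ p) ^ p = v" using v by (simp add: GF_def power2_eq_square power_mult)
  have even_pow: "z ^ (p ^ (2 * i)) = z" if "z \<in> Fp2" for z i
  proof (induction i)
    case (Suc i)
    have "z ^ (p ^ (2 * Suc i)) = (z ^ (p\<^sup>2)) ^ (p ^ (2 * i))"
      by (simp only: power_mult[symmetric] power_add[symmetric] mult_Suc_right)
    thus ?case using Suc that by (simp add: GF_def)
  qed simp
  \<comment> \<open>An element fixed by an even and by the next odd power of the
    \<open>p\<close>-Frobenius lies in \<open>Fp\<close>, but \<open>v\<close> does not.\<close>
  have ev: "even r"
  proof (rule ccontr)
    assume "odd r"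
    then obtain i where i: "r = 2 * i + 1" using oddE by blast
    have "v \<in> Fq" using v(1) Y Y_sub(2) by blast
    hence "v ^ (p ^ (2 * i + 1)) = v" by (simp add: GF_def q_eq i)
    hence "(v ^ (p ^ (2 * i))) ^ p = v" by (simp only: power_add power_one_right power_mult[symmetric])
    hence "v ^ p = v" using even_pow[OF v(1)] by simp
    thus False using v(2) by (simp add: GF_def)
  qed
  then obtain n where n: "r = 2 * n" by blast
  have "of_nat r = (0 :: 'a)" by (simp add: n)
  hence Tq1: "Tq 1 = 0" by (simp add: gf_trace_def)
  hence Tqs0: "Tq s0 = 0" using s0_trace by simp
  \<comment> \<open>Transitivity of the trace through the field with \<open>p^2\<close> elements,
    where \<open>z\<close> is a scalar for the first stage.\<close>
  have split: "gf_trace p (2 * j) (s0 * z) = gf_trace (p\<^sup>2) j s0 * z + gf_trace (p\<^sup>2) j s0 ^ p * z ^ p"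
    if z: "z \<in> Fp2" for z j
  proof (induction j)
    case 0 thus ?case by (simp add: gf_trace_def)
  next
    case (Suc j)
    have e1: "(s0 * z) ^ (p ^ (2 * j)) = s0 ^ ((p\<^sup>2) ^ j) * z"
      using even_pow[OF z, of j] by (simp add: power_mult_distrib power_mult)
    have e2: "(s0 * z) ^ (p ^ (Suc (2 * j))) = (s0 ^ ((p\<^sup>2) ^ j)) ^ p * z ^ p"
    proof -
      have "(s0 * z) ^ (p ^ (Suc (2 * j))) = ((s0 * z) ^ (p ^ (2 * j))) ^ p"
        by (simp only: power_Suc power_mult[symmetric] mult.commute)
      thus ?thesis unfolding e1 by (simp only: power_mult_distrib)
    qed
    have "gf_trace p (2 * Suc j) (s0 * z)
      = gf_trace p (2 * j) (s0 * z) + (s0 * z) ^ (p ^ (2 * j)) + (s0 * z) ^ (p ^ (Suc (2 * j)))"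
      by (simp only: gf_trace_def mult_Suc_right add_2_eq_Suc sum.lessThan_Suc)
    also have "\<dots> = gf_trace (p\<^sup>2) j s0 * z + gf_trace (p\<^sup>2) j s0 ^ p * z ^ p
      + s0 ^ ((p\<^sup>2) ^ j) * z + (s0 ^ ((p\<^sup>2) ^ j)) ^ p * z ^ p"
      unfolding Suc e1 e2 ..
    also have "\<dots> = (gf_trace (p\<^sup>2) j s0 + s0 ^ ((p\<^sup>2) ^ j)) * z
      + (gf_trace (p\<^sup>2) j s0 + s0 ^ ((p\<^sup>2) ^ j)) ^ p * z ^ p"
      by (simp only: frob_add_p distrib_right add_ac)
    also have "gf_trace (p\<^sup>2) j s0 + s0 ^ ((p\<^sup>2) ^ j) = gf_trace (p\<^sup>2) (Suc j) s0"
      by (simp only: gf_trace_def sum.lessThan_Suc)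
    finally show ?case .
  qed
  have sig: "\<sigma> = gf_trace (p\<^sup>2) n s0" unfolding \<sigma>_def by (simp add: n)
  have "Tq (s0 * 1) = \<sigma> * 1 + \<sigma> ^ p * 1 ^ p"
    using split[OF Fp2.one_mem, of n] by (simp only: n[symmetric] sig[symmetric])
  hence "\<sigma> + \<sigma> ^ p = 0" using Tqs0 by simp
  hence sp: "\<sigma> ^ p = \<sigma>" by (simp only: add_eq_0_iff2)
  thus "\<sigma> \<in> Fp" by (simp add: GF_def)
  assume w: "w \<in> Fp2" and l: "l \<in> Fq"
  have "Tq ((1 + \<tau>) * w ^ (p + 1)) = w ^ (p + 1) * Tq (1 + \<tau>)"
    using trace_scale[OF norm_in_Fp[OF w]] by (simp only: mult.commute)
  hence 1: "Tq ((1 + \<tau>) * w ^ (p + 1)) = w ^ (p + 1)" by (simp add: Tq1 Tq_\<tau>)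
  have "w\<^sup>2 \<in> Fp2" using w by (rule Fp2.power_mem)
  from split[OF this, of n] have "Tq (s0 * w\<^sup>2) = \<sigma> * w\<^sup>2 + \<sigma> * (w\<^sup>2) ^ p"
    by (simp only: n[symmetric] sig[symmetric] sp)
  also have "\<dots> = \<sigma> * (w ^ p + w)\<^sup>2"
    by (simp only: square_add distrib_left add.commute power_mult[symmetric] mult.commute)
  finally have 2: "Tq (s0 * w\<^sup>2) = \<sigma> * (w ^ p + w)\<^sup>2" .
  have "Tq (l * (w ^ p + w)) = (w ^ p + w) * Tq l"
    using trace_scale[OF trace_in_Fp'[OF w]] by (simp only: mult.commute)
  hence 3: "(Tq (l * (w ^ p + w)))\<^sup>2 = (Tq l)\<^sup>2 * (w ^ p + w)\<^sup>2"
    by (simp only: power_mult_distrib mult.commute)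
  show "reduced_form l w = w ^ (p + 1) + (\<sigma> + (Tq l)\<^sup>2) * (w ^ p + w)\<^sup>2"
    unfolding reduced_form_def trace_add 1 2 3 by (simp only: distrib_right add.assoc)
qed

text \<open>Adding the square of \<open>Tq t\<close> changes the Arf invariant, so the anisotropic form becomes a
  hyperbolic plane.\<close>

lemma card_zeros_twisted:
  assumes Y: "Y = Fp2" and s0_trace: "Tq (1 + s0) = 0" and aniso: "zeros 0 = {0}"
  shows "card (zeros t) = 2 * p - 1"
proof -
  note rf = reduced_form_eq[OF Y s0_trace]
  \<comment> \<open>The trace of \<open>\<omega>\<close> solves the quadratic equation for
    \<open>Tq t\<close>, and \<open>\<theta> ^ p = \<theta> + 1\<close> expresses that
    \<open>Tq t\<close> has absolute trace 1.\<close>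
  define \<theta> where "\<theta> = Tq \<omega>"
  have \<theta>1: "\<theta>\<^sup>2 + \<theta> = Tq t"
    unfolding \<theta>_def trace_square[symmetric] trace_add[symmetric] \<omega> ..
  have "\<theta> ^ p + \<theta> = Tq \<tau>"
  proof -
    have "\<theta> ^ p = Tq (\<omega> ^ p)"
      using frob_sum[of "\<lambda>i. \<omega> ^ (p ^ i)" "{..<r}" 1]
      by (simp add: \<theta>_def gf_trace_def power_mult[symmetric] mult.commute)
    thus ?thesis by (simp add: \<theta>_def \<tau>_def)
  qed
  hence "\<theta> ^ p = Tq \<tau> + \<theta>" by (metis add.commute add_self_left)
  hence \<theta>2: "\<theta> ^ p = \<theta> + 1" by (simp add: Tq_\<tau> add.commute)
  have "card {z :: 'a. z ^ 2 - z = \<sigma>} = 2" by (rule card_AS_fibre) simp_all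
  hence "{z :: 'a. z ^ 2 - z = \<sigma>} \<noteq> {}" by (metis card.empty zero_neq_numeral)
  then obtain \<rho> where \<rho>: "\<rho>\<^sup>2 + \<rho> = \<sigma>" by (auto simp: minus_eq)
  \<comment> \<open>\<open>d\<close> is the absolute trace of \<open>\<sigma>\<close>, hence 0 or 1.
    If it were 1, then \<open>\<rho>\<close> would be a nonzero zero of the anisotropic
    form.\<close>
  define d where "d = \<rho> ^ p + \<rho>"
  have "d\<^sup>2 + d = \<sigma> ^ p + \<sigma>"
    by (simp only: d_def \<rho>[symmetric] frob_add_p square_add power_mult[symmetric] mult.commute add_ac)
  also have "\<dots> = 0" using rf(1) by (simp add: GF_def)
  finally have "d * (d + 1) = 0" by (simp only: power2_eq_square distrib_left mult_1_right)
  hence "d = 0 \<or> d = 1" by (simp only: mult_eq_0_iff add_eq_0_iff2)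
  moreover have "d \<noteq> 1"
  proof
    assume d1: "d = 1"
    have "d + \<rho> = \<rho> ^ p" by (simp only: d_def add.assoc add_self add_0_right)
    hence \<rho>p: "\<rho> ^ p = \<rho> + 1" using d1 by (simp only: add.commute)
    hence "(\<rho> ^ p) ^ p = \<rho>" by (simp add: add.assoc)
    hence \<rho>_mem: "\<rho> \<in> Fp2" by (simp add: GF_def power2_eq_square power_mult)
    have "reduced_form 0 \<rho> = \<rho> ^ (p + 1) + (\<sigma> + (Tq 0)\<^sup>2) * (\<rho> ^ p + \<rho>)\<^sup>2"
      by (rule rf(2)[OF \<rho>_mem Fq.zero_mem])
    also have "\<dots> = \<rho> * (\<rho> + 1) + \<sigma>"
      using d1 by (simp add: d_def[symmetric] \<rho>p)
    also have "\<dots> = 0"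
      by (simp only: \<rho>[symmetric] distrib_left mult_1_right power2_eq_square add_self)
    finally have "\<rho> \<in> zeros 0" using \<rho>_mem Y by (simp add: zeros_def)
    hence "\<rho> = 0" using aniso by simp
    thus False using \<rho>p by simp
  qed
  ultimately have \<rho>p: "\<rho> ^ p = \<rho>" by (simp add: d_def add_eq_0_iff2)
  \<comment> \<open>The shift by the square of \<open>\<theta>\<close> turns a root for
    \<open>\<sigma>\<close> into a root for \<open>\<sigma> + (Tq t)^2\<close>, and it turns
    \<open>\<rho> ^ p = \<rho>\<close> into \<open>v ^ p = v + 1\<close>.\<close>
  define v where "v = \<rho> + \<theta>\<^sup>2"
  define b where "b = (\<lambda>w :: 'a. w ^ p + w)"
  have vv: "v\<^sup>2 + v = \<sigma> + (Tq t)\<^sup>2"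
    by (simp only: v_def \<rho>[symmetric] \<theta>1[symmetric] square_add add_ac)
  have "(\<theta>\<^sup>2) ^ p = (\<theta> ^ p)\<^sup>2" by (simp only: power_mult[symmetric] mult.commute)
  hence vp: "v ^ p = v + 1"
    by (simp add: v_def \<rho>p \<theta>2 square_add add.assoc)
  have v1: "(v + 1)\<^sup>2 + (v + 1) = v\<^sup>2 + v" by (simp add: square_add add_ac)
  have roots: "y\<^sup>2 + y = \<sigma> + (Tq t)\<^sup>2 \<longleftrightarrow> y = v \<or> y = v + 1" for y
  proof
    assume "y\<^sup>2 + y = \<sigma> + (Tq t)\<^sup>2"
    hence "(y\<^sup>2 + y) + (v\<^sup>2 + v) = 0" using vv by simp
    hence "(y + v) * (y + v + 1) = 0"
      by (simp only: distrib_left distrib_right mult_1_left mult_1_right power2_eq_square mult_ac add_ac add_self_left add_self)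
    hence "y + v = 0 \<or> y + (v + 1) = 0" by (simp only: mult_eq_0_iff add.assoc)
    thus "y = v \<or> y = v + 1" by (simp only: add_eq_0_iff2)
  next
    assume "y = v \<or> y = v + 1"
    thus "y\<^sup>2 + y = \<sigma> + (Tq t)\<^sup>2" using vv v1 by auto
  qed
  have form_t: "reduced_form t w = w ^ p * w + (\<sigma> + (Tq t)\<^sup>2) * (b w)\<^sup>2" if "w \<in> Fp2" for w
    using rf(2)[OF that t] by (simp add: b_def mult.commute)
  \<comment> \<open>With \<open>c = w ^ p + w\<close> nonzero and \<open>w = c * y\<close>, the form
    is \<open>c^2\<close> times \<open>y^2 + y + \<sigma> + (Tq t)^2\<close>. So the nonzero zeros
    lie on the two lines through the roots \<open>v\<close> and \<open>v + 1\<close>.\<close>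
  have zeros_iff: "w \<in> zeros t \<longleftrightarrow> w = 0 \<or> (\<exists>c\<in>Fp - {0}. w = c * v \<or> w = c * (v + 1))" for w
  proof
    assume "w \<in> zeros t"
    hence w: "w \<in> Fp2" "w ^ p * w + (\<sigma> + (Tq t)\<^sup>2) * (b w)\<^sup>2 = 0"
      using Y form_t by (auto simp: zeros_def)
    show "w = 0 \<or> (\<exists>c\<in>Fp - {0}. w = c * v \<or> w = c * (v + 1))"
    proof (cases "b w = 0")
      case True
      hence "w ^ p * w = 0" using w(2) by simp
      thus ?thesis by auto
    next
      case False
      define c where "c = b w"
      have c: "c \<in> Fp" "c \<noteq> 0" using trace_in_Fp'[OF w(1)] False by (simp_all add: c_def b_def)
      define y where "y = w / c"
      have wy: "w = c * y" using c(2) by (simp add: y_def)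
      have wp: "w ^ p = c + w" by (simp add: c_def b_def add.assoc)
      have "w ^ p * w = c\<^sup>2 * (y\<^sup>2 + y)"
        unfolding wp by (simp only: wy distrib_left distrib_right power2_eq_square mult_ac add_ac)
      hence "c\<^sup>2 * ((y\<^sup>2 + y) + (\<sigma> + (Tq t)\<^sup>2)) = 0"
        using w(2) by (simp only: c_def[symmetric] distrib_left mult.commute)
      hence "(y\<^sup>2 + y) + (\<sigma> + (Tq t)\<^sup>2) = 0" using c(2) by (simp only: mult_eq_0_iff power_eq_0_iff) simp
      hence "y\<^sup>2 + y = \<sigma> + (Tq t)\<^sup>2" by (simp only: add_eq_0_iff2)
      hence "y = v \<or> y = v + 1" by (simp only: roots)
      thus ?thesis using wy c by blast
    qed
  next
    have in_zeros: "c * y \<in> zeros t" if c: "c \<in> Fp" and y: "y\<^sup>2 + y = \<sigma> + (Tq t)\<^sup>2" "y ^ p = y + 1" for c y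
    proof -
      have "(y ^ p) ^ p = y" by (simp add: y(2) add.assoc)
      hence ym: "y \<in> Fp2" by (simp add: GF_def power2_eq_square power_mult)
      have "b y = 1" by (simp add: b_def y(2) add.commute)
      hence "reduced_form t y = (y + 1) * y + (y\<^sup>2 + y)"
        using form_t[OF ym] y by simp
      also have "\<dots> = 0" by (simp only: distrib_right mult_1_left power2_eq_square add_self)
      finally have "reduced_form t (c * y) = 0" unfolding reduced_form_scale[OF c] by simp
      moreover have "c * y \<in> Y" using Y_scale[OF c] Y ym by blast
      ultimately show ?thesis by (simp add: zeros_def)
    qed
    have "(v + 1) ^ p = v + 1 + 1" by (simp add: vp)
    note 1 = in_zeros[OF _ vv vp] in_zeros[OF _ v1[unfolded vv] this]
    assume "w = 0 \<or> (\<exists>c\<in>Fp - {0}. w = c * v \<or> w = c * (v + 1))"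
    thus "w \<in> zeros t" using 1 zero_in_zeros by blast
  qed
  define h where "h = (\<lambda>(c, i). c * (v + i))"
  have "zeros t = insert 0 (h ` ((Fp - {0}) \<times> {0, 1}))"
    using zeros_iff by (auto simp: h_def image_iff)
  \<comment> \<open>The map \<open>b\<close> recovers the scalar \<open>c\<close>, so the two lines
    meet only in 0 and the count is \<open>1 + 2 * (p - 1)\<close>.\<close>
  moreover have bh: "b (c * (v + i)) = c" if "c \<in> Fp" "i \<in> {0, 1}" for c i
  proof -
    have "c ^ p = c" "i ^ p = i" using that by (auto simp: GF_def)
    hence "b (c * (v + i)) = c * (v + 1 + i) + c * (v + i)"
      by (simp only: b_def power_mult_distrib frob_add_p vp)
    also have "\<dots> = c" by (simp only: distrib_left mult_1_right add_ac add_self_left add_self add_0_left add_0_right)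
    finally show ?thesis .
  qed
  have "0 \<notin> h ` ((Fp - {0}) \<times> {0, 1})"
  proof
    assume "0 \<in> h ` ((Fp - {0}) \<times> {0, 1})"
    then obtain P where P: "h P = 0" "P \<in> (Fp - {0}) \<times> {0, 1}" by (elim imageE) simp
    obtain c i where "P = (c, i)" by (cases P)
    with P have ci: "c \<in> Fp" "c \<noteq> 0" "i \<in> {0, 1}" "c * (v + i) = 0"
      by (simp_all only: h_def prod.case mem_Sigma_iff Diff_iff singleton_iff not_False_eq_True)
    show False using bh[OF ci(1,3)] ci(2) unfolding ci(4) by (simp add: b_def)
  qed
  moreover have "inj_on h ((Fp - {0}) \<times> {0, 1})"
  proof (rule inj_onI)
    fix P Q assume PQ: "P \<in> (Fp - {0}) \<times> {0, 1}" "Q \<in> (Fp - {0}) \<times> {0, 1}" "h P = h Q"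
    obtain c i where P: "P = (c, i)" by (cases P)
    obtain c' i' where Q: "Q = (c', i')" by (cases Q)
    have "c = c'" using PQ bh[of c i] bh[of c' i'] by (simp add: P Q h_def)
    moreover have "c \<noteq> 0" using PQ P by simp
    ultimately show "P = Q" using PQ(3) by (simp add: P Q h_def)
  qed
  moreover have "card ((Fp - {0}) \<times> {0, 1 :: 'a}) = (p - 1) * 2"
    using finite_Fp Fp.zero_mem by (simp add: card_cartesian_product card_Fp)
  moreover have "finite ((Fp - {0}) \<times> {0, 1 :: 'a})" using finite_Fp by simp
  ultimately have "card (zeros t) = 1 + (p - 1) * 2"
    by (simp add: card_image)
  thus ?thesis using p_ge_2 by simp
qed

text \<open>Subtracting the minimality equation from \<open>card_form_zeros\<close> gives
  \<open>P * card Y = p * P * card (zeros 0) + (p - 1) * N\<close>. As the last term is positive,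
  \<open>card Y > p\<close>, so \<open>Y\<close> is the full plane; then
  \<open>card (zeros 0) < p\<close> leaves only 0. Passing from 1 to \<open>2 * p - 1\<close> zeros
  reverses the sign of the deviation.\<close>

theorem minimal_imp_maximal:
  assumes minimal: "p * card {x \<in> Fqq. form 0 (u x) = 0} + (p - 1) * N * q = q\<^sup>2" and N: "N > 0"
    and s0_trace: "\<And>a. a \<in> Fq \<Longrightarrow> u a = 1 \<Longrightarrow> Tq (1 + s0) = 0"
  shows "p * P = N" "p * card {x \<in> Fqq. form t (u x) = 0} = q\<^sup>2 + (p - 1) * N * q"
proof -
  have "q * (P * card Y) = q * (p * (P * card (zeros 0)) + (p - 1) * N)"
    using card_form_zeros[OF Fq.zero_mem] minimal by (simp add: algebra_simps)
  hence eq: "P * card Y = p * (P * card (zeros 0)) + (p - 1) * N" using q_ge_2 by simp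
  have "(p - 1) * N > 0" using N p_ge_2 by simp
  hence "P * (p * card (zeros 0)) < P * card Y" unfolding eq by (simp add: mult_ac)
  hence lt: "p * card (zeros 0) < card Y" by simp
  have "finite (zeros 0)" using finite_Y by (simp add: zeros_def)
  hence "card (zeros 0) > 0" using zero_in_zeros by (auto simp: card_gt_0_iff)
  hence "p * 1 \<le> p * card (zeros 0)" by (intro mult_le_mono2) simp
  hence "card Y > p" using lt by linarith
  hence Y: "Y = Fp2" by (rule card_Y)
  have "card Y = p\<^sup>2" unfolding Y by (rule card_Fp2)
  hence cY: "card Y = p * p" by (simp only: power2_eq_square)
  hence "card (zeros 0) < p" using lt by simp
  hence Z0: "zeros 0 = {0}" by (rule zeros_trivial)
  \<comment> \<open>The condition on \<open>s0\<close> is available only once \<open>u\<close> takes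
    the value 1 on \<open>Fq\<close>, which the equality \<open>Y = Fp2\<close> now
    provides.\<close>
  have "1 \<in> Y" unfolding Y by (rule Fp2.one_mem)
  then obtain a where "a \<in> Fq" "u a = 1" by (auto simp: Y_def)
  hence "Tq (1 + s0) = 0" by (rule s0_trace)
  hence Zt: "card (zeros t) = 2 * p - 1" by (rule card_zeros_twisted[OF Y _ Z0])
  have "P * (p * p) = p * P + (p - 1) * N" using eq cY Z0 by simp
  moreover obtain j where j: "p = Suc j" "j > 0" using p_ge_2 by (cases p) auto
  ultimately have "j * (p * P) = j * N" by (simp add: algebra_simps)
  thus pP: "p * P = N" using j by simp
  have "p * card {x \<in> Fqq. form t (u x) = 0} + q * P * (p * p) = q\<^sup>2 + p * (q * P * (2 * p - 1))"
    using card_form_zeros[OF t] cY Zt by simp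
  moreover have "p * (q * P * (2 * p - 1)) = q * P * (p * p) + (p - 1) * N * q"
    unfolding pP[symmetric] j(1) by (simp add: algebra_simps)
  ultimately show "p * card {x \<in> Fqq. form t (u x) = 0} = q\<^sup>2 + (p - 1) * N * q" by linarith
qed

end

section \<open>Linearized polynomials\<close>

context char_two_tower
begin

definition linearized :: "'a poly \<Rightarrow> bool" where
  "linearized g \<longleftrightarrow> (\<forall>n. coeff g n \<noteq> 0 \<longrightarrow> (\<exists>i. n = p ^ i))"

lemma linearized_eq_sum:
  fixes g :: "'a poly"
  assumes "linearized g" "degree g \<le> p ^ d"
  shows "g = (\<Sum>i\<le>d. monom (coeff g (p ^ i)) (p ^ i))"
proof (rule poly_eqI)
  fix n
  have inj: "p ^ i = p ^ j \<longleftrightarrow> i = j" for i j using p_ge_2 by (simp add: power_inject_exp)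
  show "coeff g n = coeff (\<Sum>i\<le>d. monom (coeff g (p ^ i)) (p ^ i)) n"
  proof (cases "\<exists>i. n = p ^ i")
    case True
    then obtain j where j: "n = p ^ j" by blast
    have "coeff (\<Sum>i\<le>d. monom (coeff g (p ^ i)) (p ^ i)) n = (\<Sum>i\<le>d. if i = j then coeff g (p ^ i) else 0)"
      by (simp add: coeff_sum j inj)
    also have "\<dots> = (if j \<le> d then coeff g n else 0)" by (simp add: j)
    also have "\<dots> = coeff g n"
    proof (cases "j \<le> d")
      case False
      hence "p ^ d < p ^ j" using p_ge_2 by (intro power_strict_increasing) auto
      hence "coeff g n = 0" using assms(2) j by (intro coeff_eq_0) simp
      thus ?thesis by simp
    qed simp
    finally show ?thesis ..
  next
    case False
    hence "coeff g n = 0" using assms(1) unfolding linearized_def by blast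
    moreover have "coeff (\<Sum>i\<le>d. monom (coeff g (p ^ i)) (p ^ i)) n = (\<Sum>i\<le>d. 0)"
      unfolding coeff_sum using False by (intro sum.cong) auto
    ultimately show ?thesis by simp
  qed
qed

lemma linearized_poly:
  fixes g :: "'a poly"
  assumes "linearized g" "degree g \<le> p ^ d"
  shows "poly g x = (\<Sum>i\<le>d. coeff g (p ^ i) * x ^ (p ^ i))"
  by (subst linearized_eq_sum[OF assms]) (simp_all add: poly_sum poly_monom)

lemma linearized_map:
  fixes g :: "'a poly"
  assumes "linearized g"
  shows "poly g (x + y) = poly g x + poly g y" "c \<in> Fp \<Longrightarrow> poly g (c * x) = c * poly g x"
proof -
  have "degree g \<le> p ^ degree g" using p_ge_2 power_gt_expt[of p "degree g"] by simp
  note eq = linearized_poly[OF assms this]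
  show "poly g (x + y) = poly g x + poly g y"
    unfolding eq by (simp add: sum.distrib distrib_left)
  show "c \<in> Fp \<Longrightarrow> poly g (c * x) = c * poly g x"
    unfolding eq by (simp add: power_mult_distrib Fp_frob sum_distrib_left mult_ac)
qed

lemma poly_frob_q:
  assumes "g \<in> poly_over Fq"
  shows "poly g (x ^ q) = poly g x ^ q"
proof -
  have "coeff g i ^ q = coeff g i" for i using assms by (simp add: poly_over_def GF_def)
  moreover have "(x ^ q) ^ i = (x ^ i) ^ q" for i by (simp add: power_mult[symmetric] mult.commute)
  moreover have "(\<Sum>i\<in>I. h i :: 'a) ^ q = (\<Sum>i\<in>I. h i ^ q)" for I :: "nat set" and h
    unfolding q_eq by (rule frob_sum)
  ultimately show ?thesis by (simp add: poly_altdef power_mult_distrib)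
qed

lemma linearized_power_p:
  fixes g :: "'a poly"
  assumes "linearized g"
  shows "linearized (g ^ p)"
  unfolding linearized_def
proof (intro allI impI)
  fix n assume n: "coeff (g ^ p) n \<noteq> 0"
  have "degree g \<le> p ^ degree g" using p_ge_2 power_gt_expt[of p "degree g"] by simp
  from linearized_eq_sum[OF assms this]
  have "g ^ p = (\<Sum>i\<le>degree g. monom (coeff g (p ^ i)) (p ^ i)) ^ p" by simp
  also have "\<dots> = (\<Sum>i\<le>degree g. monom (coeff g (p ^ i)) (p ^ i) ^ p)"
    by (rule freshmans_dream_sum'[where n = k]) (simp_all add: char2 p_eq)
  also have "\<dots> = (\<Sum>i\<le>degree g. monom (coeff g (p ^ i) ^ p) (p ^ (i + 1)))"
    by (simp add: monom_power mult.commute)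
  finally have "coeff (g ^ p) n = (\<Sum>i\<le>degree g. coeff (monom (coeff g (p ^ i) ^ p) (p ^ (i + 1))) n)"
    by (simp only: coeff_sum)
  then obtain i where "coeff (monom (coeff g (p ^ i) ^ p) (p ^ (i + 1))) n \<noteq> 0"
    using n by (metis (no_types, lifting) sum.neutral)
  thus "\<exists>i. n = p ^ i" by (metis coeff_monom)
qed

lemma frob_root:
  assumes "z \<in> Fq"
  shows "frob_root p i z ^ (p ^ i) = z" "frob_root p i z \<in> Fq"
proof -
  have "p ^ i > 0" using p_ge_2 by simp
  then obtain v where v: "v ^ (p ^ i) = z" using nth_root_exists by blast
  hence "frob_root p i z = v" unfolding frob_root_def using frob_inj by (intro the_equality) auto
  thus *: "frob_root p i z ^ (p ^ i) = z" using v by simp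
  have "(frob_root p i z ^ q) ^ (p ^ i) = (frob_root p i z ^ (p ^ i)) ^ q"
    by (simp only: power_mult[symmetric] mult.commute)
  also have "\<dots> = frob_root p i z ^ (p ^ i)" using assms * by (simp add: GF_def)
  finally have "frob_root p i z ^ q = frob_root p i z" by (simp only: frob_inj)
  thus "frob_root p i z \<in> Fq" by (simp add: GF_def)
qed

text \<open>\<open>F_star\<close> is the adjoint of \<open>F\<close> for the trace pairing: apply
  the \<open>p ^ i\<close>-Frobenius, under which the trace is invariant, to the \<open>i\<close>-th
  summand.\<close>

lemma trace_F_star:
  fixes F :: "'a poly"
  assumes F: "linearized F" "degree F \<le> p ^ d" "F \<in> poly_over Fq"
    and x: "x \<in> Fqq"
  shows "F_star p d F t \<in> Fq" "T (F_star p d F t * x) = T (t * poly F x)"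
proof -
  have b: "coeff F (p ^ i) * t \<in> Fq" for i
    using F(3) t by (intro Fq.mult_mem) (simp_all add: poly_over_def)
  note root = frob_root[OF b]
  show "F_star p d F t \<in> Fq" unfolding F_star_def by (intro Fq.sum_mem root)
  have "T (frob_root p i (coeff F (p ^ i) * t) * x) = T (coeff F (p ^ i) * t * x ^ (p ^ i))" for i
  proof -
    have "frob_root p i (coeff F (p ^ i) * t) * x \<in> Fqq"
      using root(2)[of i] Fq_sub_Fqq x by (intro Fqq.mult_mem) auto
    hence "T ((frob_root p i (coeff F (p ^ i) * t) * x) ^ (p ^ i)) = T (frob_root p i (coeff F (p ^ i) * t) * x)"
      by (intro trace_frob) (simp add: q2_eq)
    thus ?thesis by (simp add: power_mult_distrib root(1))
  qed
  hence "T (F_star p d F t * x) = T (\<Sum>i\<le>d. coeff F (p ^ i) * t * x ^ (p ^ i))"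
    unfolding F_star_def sum_distrib_right trace_sum by simp
  also have "(\<Sum>i\<le>d. coeff F (p ^ i) * t * x ^ (p ^ i)) = t * poly F x"
    unfolding linearized_poly[OF F(1,2)] sum_distrib_left by (simp add: mult_ac)
  finally show "T (F_star p d F t * x) = T (t * poly F x)" .
qed

lemma card_AS_points_trace:
  assumes "f \<in> poly_over Fq" "degree f = p * m + 1"
  shows "card (AS_points p Fqq f) = 1 + p * card {x \<in> Fqq. T (poly f x) = 0}"
proof -
  have fqq: "f \<in> polys_in Fqq" using assms(1) Fq_sub_Fqq by (auto simp: poly_over_eq polys_in_def)
  have "of_nat p = (0 :: 'a)" using k by (simp add: p_eq)
  then interpret C: AS_curve_over p m f Fqq
    using fqq assms(2) p_ge_2 by unfold_locales
  have "C.points = (SIGMA x:Fqq. {y \<in> Fqq. y ^ p - y = poly f x})" by (auto simp: C.points_def)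
  hence "card C.points = (\<Sum>x\<in>Fqq. card {y \<in> Fqq. y ^ p - y = poly f x})"
    using finite_Fqq by simp
  also have "\<dots> = (\<Sum>x\<in>Fqq. if T (poly f x) = 0 then p else 0)"
  proof (rule sum.cong[OF refl])
    fix x assume "x \<in> Fqq"
    hence "poly f x \<in> Fqq" by (intro Fqq.poly_mem fqq)
    thus "card {y \<in> Fqq. y ^ p - y = poly f x} = (if T (poly f x) = 0 then p else 0)"
      using AS_fibre[of "poly f x" "2 * r"] r by (simp add: q2_eq)
  qed
  also have "\<dots> = p * card {x \<in> Fqq. T (poly f x) = 0}"
    using finite_Fqq by (simp add: sum.If_cases Int_def)
  finally show ?thesis using C.card_AS_points[OF finite_Fqq] by simp
qed

text \<open>The polynomial \<open>x * R(x)\<close> has degree \<open>p ^ e + 1\<close>, so the curve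
  has \<open>m = p ^ (e - 1)\<close>.\<close>

lemma AS_genus_pCons:
  fixes R :: "'a poly"
  assumes "degree R = p ^ e" "e \<ge> 1"
  shows "2 * AS_genus p (pCons 0 R) = int (p ^ e * (p - 1))" "degree (pCons 0 R) = p * p ^ (e - 1) + 1"
proof -
  have e: "p * p ^ (e - 1) = p ^ e" using assms(2) by (cases e) auto
  have "R \<noteq> 0" using assms p_ge_2 by auto
  thus deg: "degree (pCons 0 R) = p * p ^ (e - 1) + 1" using assms(1) e by simp
  have "of_nat p = (0 :: 'a)" using k by (simp add: p_eq)
  then interpret C: AS_curve p "p ^ (e - 1)" "pCons 0 R"
    using deg p_ge_2 by unfold_locales
  show "2 * AS_genus p (pCons 0 R) = int (p ^ e * (p - 1))"
    using C.AS_genus_eq unfolding e .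
qed

text \<open>The point at infinity accounts for the summand 1, and each zero of the trace carries
  \<open>p\<close> affine points. Minimality is written with a sum to stay within the natural
  numbers.\<close>

lemma C_maximal_minimal_iff:
  fixes R :: "'a poly"
  assumes "R \<in> poly_over Fq" "degree R = p ^ e" "e \<ge> 1"
  defines "n \<equiv> card {x \<in> Fqq. T (poly (pCons 0 R) x) = 0}"
  shows "C_maximal p q R \<longleftrightarrow> p * n = q\<^sup>2 + (p - 1) * p ^ e * q"
    and "C_minimal p q R \<longleftrightarrow> p * n + (p - 1) * p ^ e * q = q\<^sup>2"
proof -
  have "pCons 0 R \<in> poly_over Fq"
    using assms(1) Fq.zero_mem by (auto simp: poly_over_def coeff_pCons split: nat.splits)
  from card_AS_points_trace[OF this AS_genus_pCons(2)[OF assms(2,3)]]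
  have c: "int (card (AS_points p Fqq (pCons 0 R))) = 1 + int (p * n)" by (simp add: n_def)
  have g: "2 * AS_genus p (pCons 0 R) * int q = int ((p - 1) * p ^ e * q)"
    unfolding AS_genus_pCons(1)[OF assms(2,3)] by simp
  have "C_maximal p q R \<longleftrightarrow> int (p * n) = int (q\<^sup>2 + (p - 1) * p ^ e * q)"
    unfolding C_maximal_def c g by (simp add: add.commute)
  thus "C_maximal p q R \<longleftrightarrow> p * n = q\<^sup>2 + (p - 1) * p ^ e * q" by (simp only: of_nat_eq_iff)
  have "C_minimal p q R \<longleftrightarrow> int (p * n + (p - 1) * p ^ e * q) = int (q\<^sup>2)"
    unfolding C_minimal_def c g by (simp add: algebra_simps)
  thus "C_minimal p q R \<longleftrightarrow> p * n + (p - 1) * p ^ e * q = q\<^sup>2" by (simp only: of_nat_eq_iff)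
qed

end

theorem theorem1p3:
  fixes p q k r e :: nat
    and R fU FA :: "'a::alg_closed_field poly"
    and a :: "nat \<Rightarrow> 'a"
    and A :: "('a \<times> 'a) set"
    and t :: 'a
  assumes p: "p = 2 ^ k" "k \<ge> 1"
    and q: "q = p ^ r" "r \<ge> 1"
    and closure: "CHAR('a) = 2" "\<forall>u::'a. algebraic_over (GF q) u"
    and R: "R = (\<Sum>i\<le>e. monom (a i) (p ^ i))" "\<forall>i\<le>e. a i \<in> GF q" "e \<ge> 1" "a e \<noteq> 0"
    and A: "maximal_abelian_subgroup (H_group p e R) A"
    and fU: "fU \<in> lin_polys p q" "coprime fU (pderiv fU)"
    and FA: "FA = fU ^ p + fU"
    and Ubar: "Ubar p e R A = Ker fU"
    and Abar: "Abar A = Ker FA"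
    and S_Delta: "\<exists>S \<Delta> s0. s0 \<in> GF q \<and> S = monom 1 p + monom s0 1 \<and> \<Delta> \<in> poly_over (GF q) \<and>
                    \<Delta> ^ p + \<Delta> = pCons 0 R + fU * (pcompose S fU)"
    and t: "t \<in> GF q" "gf_trace 2 (k * r) t = 1"
    and A_rat: "A \<subseteq> GF q \<times> GF q"
    and minimal: "C_minimal p q R"
  shows "C_maximal p q (R + monom ((F_star p e FA t) ^ 2) 1)"
proof -
  interpret W: char_two_tower p q k r t
    using p q closure t by unfold_locales
  obtain s0 \<Delta> where s0: "s0 \<in> GF q" and \<Delta>: "\<Delta> \<in> poly_over (GF q)"
    and eq: "\<Delta> ^ p + \<Delta> = pCons 0 R + fU * (pcompose (monom 1 p + monom s0 1) fU)"
    using S_Delta by blast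
  define u where "u = poly fU"
  have lin: "W.linearized fU" and fU_over: "fU \<in> poly_over (GF q)"
    using fU(1) by (auto simp: lin_polys_def W.linearized_def)
  have FA_eval: "poly FA x = u x ^ p + u x" for x by (simp add: FA u_def poly_power)
  have KerFA: "Ker FA \<subseteq> GF q"
    using A_rat unfolding Abar[symmetric] Abar_def by auto
  have ker: "x \<in> GF q" if "u x = 0" for x
    using that FA_eval[of x] KerFA by (auto simp: Ker_def)
  \<comment> \<open>A zero of \<open>u\<close> is a zero of \<open>FA\<close>, hence a first
    coordinate of an element of \<open>A\<close>, and so lies in \<open>GF q\<close>.\<close>
  interpret Q: twisted_form p q k r t u s0
    using ker s0 W.linearized_map[OF lin] W.poly_frob_q[OF fU_over]
    by unfold_locales (simp_all add: u_def)
  have xR: "x * poly R x = (poly \<Delta> x ^ p + poly \<Delta> x) + (u x ^ (p + 1) + s0 * (u x)\<^sup>2)" for x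
  proof -
    have "poly \<Delta> x ^ p + poly \<Delta> x = x * poly R x + u x * (u x ^ p + s0 * u x)"
      using arg_cong[OF eq, of "\<lambda>P. poly P x"] by (simp add: u_def poly_power poly_pcompose poly_monom)
    also have "u x * (u x ^ p + s0 * u x) = u x ^ (p + 1) + s0 * (u x)\<^sup>2"
      by (simp add: power2_eq_square distrib_left mult_ac)
    finally show ?thesis by (simp add: add.assoc)
  qed
  have \<Delta>_qq: "\<Delta> \<in> polys_in W.Fqq" using \<Delta> W.Fq_sub_Fqq by (auto simp: poly_over_eq polys_in_def)
  \<comment> \<open>The part \<open>\<Delta>^p + \<Delta>\<close> has trace zero by
    \<open>trace_AS\<close>, since \<open>poly \<Delta> x\<close> lies in the field with
    \<open>q^2\<close> elements.\<close>
  have TR: "W.T (x * poly R x) = W.T (u x ^ (p + 1) + s0 * (u x)\<^sup>2)" if x: "x \<in> W.Fqq" for x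
  proof -
    have "poly \<Delta> x \<in> GF (p ^ (2 * r))" using W.Fqq.poly_mem[OF \<Delta>_qq x] by (simp add: W.q2_eq)
    hence "W.T (poly \<Delta> x ^ p + poly \<Delta> x) = 0" unfolding W.trace_AS by (simp add: GF_def)
    thus ?thesis unfolding xR W.trace_add[of "2 * r" "poly \<Delta> x ^ p + poly \<Delta> x"] by simp
  qed
  \<comment> \<open>If \<open>u x = 1\<close>, then \<open>FA\<close> vanishes at \<open>x\<close>
    because \<open>1 + 1 = 0\<close>. So \<open>x\<close> has a partner \<open>b\<close> in
    \<open>GF q\<close> with \<open>b^p + b = x * R(x)\<close>, which makes the trace of
    \<open>x * R(x)\<close> to F_p zero; up to \<open>\<Delta>\<close> that element is
    \<open>1 + s0\<close>.\<close>
  have s0_trace: "W.Tq (1 + s0) = 0" if x: "x \<in> W.Fq" "u x = 1" for x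
  proof -
    have "x \<in> Abar A" unfolding Abar Ker_def using x(2) by (simp add: FA_eval)
    then obtain b where b: "(x, b) \<in> A" by (auto simp: Abar_def)
    have "A \<subseteq> carrier (H_group p e R)"
      using A by (auto simp: maximal_abelian_subgroup_def dest: subgroup.subset)
    hence "b ^ p + b = x * poly R x" using b by (auto simp: H_group_def W.minus_eq)
    moreover have "b \<in> GF (p ^ r)" using A_rat b q by auto
    ultimately have "W.Tq (x * poly R x) = 0" using W.trace_AS[of r b] by (simp add: GF_def)
    moreover have "poly \<Delta> x \<in> GF (p ^ r)"
      using W.Fq.poly_mem[OF \<Delta>[unfolded poly_over_eq] x(1)] q by simp
    hence "W.Tq (poly \<Delta> x ^ p + poly \<Delta> x) = 0" unfolding W.trace_AS by (simp add: GF_def)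
    ultimately show ?thesis
      unfolding xR W.trace_add[of r "poly \<Delta> x ^ p + poly \<Delta> x"] x(2) by simp
  qed
  have R_over: "R \<in> poly_over (GF q)"
    unfolding R(1) poly_over_eq using R(2) W.Fq.subring_polys_in
    by (intro subring_set.sum_mem W.Fq.monom_in_polys_in) auto
  have degR: "degree R = p ^ e"
  proof (rule antisym)
    show "degree R \<le> p ^ e"
      unfolding R(1) using W.p_ge_2
      by (intro degree_sum_le order.trans[OF degree_monom_le] power_increasing) auto
    have "coeff R (p ^ e) = (\<Sum>i\<le>e. if i = e then a i else 0)"
      unfolding R(1) coeff_sum using W.p_ge_2 by (intro sum.cong) (auto simp: power_inject_exp)
    thus "p ^ e \<le> degree R" using R(4) by (intro le_degree) simp
  qed
  have form0: "Q.form 0 z = W.T (z ^ (p + 1) + s0 * z\<^sup>2)" for z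
    unfolding Q.form_def by simp
  have "{x \<in> W.Fqq. W.T (poly (pCons 0 R) x) = 0} = {x \<in> W.Fqq. Q.form 0 (u x) = 0}"
    using TR form0 by auto
  hence min: "p * card {x \<in> W.Fqq. Q.form 0 (u x) = 0} + (p - 1) * p ^ e * q = q\<^sup>2"
    using minimal W.C_maximal_minimal_iff(2)[OF R_over degR R(3)] by simp
  have "p ^ e > 0" using W.p_ge_2 by simp
  note concl = Q.minimal_imp_maximal[OF min this s0_trace]
  have fU0: "fU \<noteq> 0" using fU(2) by auto
  \<comment> \<open>Separability makes the degree of \<open>fU\<close> equal to the order of its
    kernel. With \<open>p * P = p ^ e\<close> this bounds the degree of \<open>FA\<close> by
    \<open>p ^ e\<close>, so that \<open>F_star p e FA t\<close> involves every coefficient of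
    \<open>FA\<close>.\<close>
  have "poly (pderiv fU) z \<noteq> 0" if "poly fU z = 0" for z
  proof
    assume "poly (pderiv fU) z = 0"
    hence "[:- z, 1:] dvd fU" "[:- z, 1:] dvd pderiv fU" using that by (simp_all add: poly_eq_0_iff_dvd)
    hence "is_unit [:- z, 1:]" using fU(2) coprime_common_divisor by blast
    thus False by (simp add: is_unit_poly_iff)
  qed
  from card_roots_separable[OF fU0 this] have "degree fU = Q.P" unfolding Q.P_def by (simp add: u_def)
  hence degU: "p * degree fU = p ^ e" using concl(1) by simp
  have degFA: "degree FA \<le> p ^ e"
  proof -
    have "degree fU * 1 \<le> degree fU * p" using W.p_ge_2 by (intro mult_le_mono2) simp
    hence "degree fU \<le> p ^ e" using degU by (simp add: mult.commute)
    moreover have "degree (fU ^ p) \<le> p ^ e" using degree_power_le[of fU p] degU by (simp add: mult.commute)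
    ultimately show ?thesis unfolding FA by (intro degree_add_le)
  qed
  have FA_lin: "W.linearized FA"
    unfolding W.linearized_def
  proof (intro allI impI)
    fix n assume "coeff FA n \<noteq> 0"
    hence "coeff (fU ^ p) n \<noteq> 0 \<or> coeff fU n \<noteq> 0" unfolding FA by auto
    thus "\<exists>i. n = p ^ i" using W.linearized_power_p[OF lin] lin unfolding W.linearized_def by blast
  qed
  have FA_over: "FA \<in> poly_over (GF q)"
    unfolding FA using fU_over subring_set.add_mem[OF W.Fq.subring_polys_in]
      subring_set.power_mem[OF W.Fq.subring_polys_in] by (simp add: poly_over_eq)
  define c where "c = F_star p e FA t"
  note adj = W.trace_F_star[OF FA_lin degFA FA_over, folded c_def]
  have cq: "c \<in> W.Fq" using adj(1)[OF W.Fqq.zero_mem] .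
  define Rt where "Rt = R + monom (c\<^sup>2) 1"
  have Rt_over: "Rt \<in> poly_over (GF q)"
    unfolding Rt_def poly_over_eq
    by (intro subring_set.add_mem[OF W.Fq.subring_polys_in] W.Fq.monom_in_polys_in
        W.Fq.power_mem cq R_over[unfolded poly_over_eq])
  have "1 < p ^ e" using R(3) W.p_ge_2 by (intro one_less_power) auto
  hence "degree (monom (c\<^sup>2) 1) < degree R"
    using degR degree_monom_le[of "c\<^sup>2" 1] by simp
  hence degRt: "degree Rt = p ^ e" unfolding Rt_def using degR by (simp add: degree_add_eq_left)
  have "W.T (poly (pCons 0 Rt) x) = Q.form t (u x)" if x: "x \<in> W.Fqq" for x
  proof -
    \<comment> \<open>The new term is the square of \<open>c * x\<close>, so its trace is the square
      of \<open>T (c * x)\<close>. By adjointness this is \<open>T (t * FA(x))\<close>, and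
      \<open>FA(x)\<close> is \<open>u x ^ p + u x\<close>, as in the definition of
      \<open>form t\<close>.\<close>
    have "poly (pCons 0 Rt) x = x * poly R x + (c * x)\<^sup>2"
      by (simp add: Rt_def poly_monom power2_eq_square algebra_simps)
    hence "W.T (poly (pCons 0 Rt) x) = W.T (x * poly R x) + (W.T (c * x))\<^sup>2"
      by (simp only: W.trace_add W.trace_square)
    also have "\<dots> = Q.form t (u x)"
      unfolding Q.form_def TR[OF x] adj(2)[OF x] FA_eval ..
    finally show ?thesis .
  qed
  hence "{x \<in> W.Fqq. W.T (poly (pCons 0 Rt) x) = 0} = {x \<in> W.Fqq. Q.form t (u x) = 0}" by auto
  hence "C_maximal p q Rt"
    using concl(2) W.C_maximal_minimal_iff(1)[OF Rt_over degRt R(3)] by simp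
  thus ?thesis by (simp add: Rt_def c_def)
qed

end
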